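(* Let $\beta\in(0,1)$ and $\nu>0$, let $\{\lambda(t)\}_{t\ge 0}$ be the intensity of a Hawkes process with parameters $\theta\ge0$, $\eta>0$, $\kappa>0$ and jump sizes of mean $\mu$ and variance $\psi^2$, and let $\{E^{\beta,\nu}_t\}_{t\ge0}$ be an independent inverse tempered $\beta$-stable subordinator. Suppose $\gamma=\kappa-\eta\mu>0$. Then for $t\ge0$ the mean of $\lambda(E^{\beta,\nu}_t)$ is $$\mathbb{E}_0[\lambda(E^{\beta,\nu}_t)]=\Bigl(\lambda_0-\frac{\kappa\theta}{\gamma}\Bigr)\Bigl(1-\gamma e^{-\nu t}\sum_{m=0}^\infty\nu^m t^{\beta+m}M_{\beta,\beta+m+1}((\nu^\beta-\gamma)t^\beta)\Bigr)+\frac{\kappa\theta}{\gamma},$$ and its variance is $$\begin{aligned}\mathbb{V}_0[\lambda(E^{\beta,\nu}_t)]=\;&e^{-\nu t}(\rho_1\lambda_0+\rho_2)\Bigl[\sum_{m=0}^\infty 2\nu^m t^{\beta+m}M_{\beta,\beta+m+1}((\nu^\beta-2\gamma)t^\beta)-\sum_{m=0}^\infty\nu^m t^{\beta+m}M_{\beta,\beta+m+1}((\nu^\beta-\gamma)t^\beta)\Bigr]\\&-\rho_2e^{-\nu t}\sum_{m=0}^\infty\nu^m t^{\beta+m}M_{\beta,\beta+m+1}((\nu^\beta-2\gamma)t^\beta)+\Bigl(\lambda_0-\frac{\kappa\theta}{\gamma}\Bigr)^2\mathbb{V}_0\bigl[e^{-\gamma E^{\beta,\nu}_t}\bigr].\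end{aligned}$$
   Context: Hawkes process: $\{(N_t,\lambda_t)\}_{t\ge0}$ (write $\lambda(t)=\lambda_t$), where $N_t$ is a counting process with stochastic intensity $\lambda_t$ satisfying $$\lambda_t=\theta+e^{-\kappa(t-s)}(\lambda_s-\theta)+\eta\int_s^t e^{-\kappa(t-u)}\,dP_u,\qquad t\ge s,$$ with $\theta\ge0$, $\eta>0$, $\kappa>0$ and $P_t=\sum_{i=1}^{N_t}\xi_i$, where $(\xi_i)$ are i.i.d. positive random variables with finite positive mean $\mu$ and finite variance $\psi^2$. $\mathbb{E}_0,\mathbb{V}_0$ denote expectation and variance conditional on $\mathcal{F}_0$, the initial information of the Hawkes process (so $\lambda_0$ is treated as known). Inverse tempered stable subordinator: the tempered $\beta$-stable subordinator $\{D^{\beta,\nu}_t\}_{t\ge0}$ is the subordinator with $\mathbb{E}[e^{-sD^{\beta,\nu}_t}]=e^{-t((s+\nu)^\beta-\nu^\beta)}$, and $E^{\beta,\nu}_t=\inf\{r\ge0: D^{\beta,\nu}_r>t\}$. It is independent of the Hawkes process. Constants: $\rho_1=\eta^2(\psi^2+\mu^2)$ and $\rho_2=\dfrac{\eta^2\kappa\theta(\psi^2+\mu^2)}{\eta\mu-\kappa}$. Generalized Mittag-Leffler function: $M^c_{a,b}(z)=\sum_{n=0}^\infty\frac{(c)_n}{\Gamma(an+b)}\frac{z^n}{n!}$, with $(c)_n=c(c+1)\cdots(c+n-1)$ for $n\ge 1$ and $(c)_0=1$; $M_{a,b}=M^1_{a,b}$, i.e. $M_{a,b}(z)=\sum_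{n\ge0}z^n/\Gamma(an+b)$.
   Formalization: Beyond the jump sizes being i.i.d., each ξ_n is assumed independent of the history strictly before its arrival time T_n (the usual meaning of a marked Hawkes process); without this the formulas can fail, e.g. if ξ_n is the integrated intensity between T_{n-1} and T_n. *)

theory Defs
  imports "HOL-Probability.Probability"
begin

section \<open>Mittag-Leffler functions\<close>

definition mittag_leffler_gen :: "real \<Rightarrow> real \<Rightarrow> real \<Rightarrow> real \<Rightarrow> real" where
  "mittag_leffler_gen c a b z =
     (\<Sum>n. pochhammer c n / Gamma (a * real n + b) * (z ^ n / fact n))"

definition mittag_leffler :: "real \<Rightarrow> real \<Rightarrow> real \<Rightarrow> real" where
  "mittag_leffler a b z = mittag_leffler_gen 1 a b z"

section \<open>Conditional variance\<close>

definition cond_var :: "'a measure \<Rightarrow> 'a measure \<Rightarrow> ('a \<Rightarrow> real) \<Rightarrow> 'a \<Rightarrow> real" where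
  "cond_var M G X = real_cond_exp M G (\<lambda>\<omega>. (X \<omega> - real_cond_exp M G X \<omega>)\<^sup>2)"

section \<open>Processes on the half line\<close>

text \<open>Processes and filtrations are indexed by \<^typ>\<open>real\<close>, but only times \<open>t \<ge> 0\<close> are
  meaningful. The Stieltjes measure of a path \<open>X\<close> is that of the path extended to negative times
  by \<open>X 0\<close>, so it lives on \<open>(0, \<infinity>)\<close>.\<close>

definition stieltjes :: "(real \<Rightarrow> real) \<Rightarrow> real measure" where
  "stieltjes X = interval_measure (\<lambda>u. X (max 0 u))"

definition history :: "'a measure \<Rightarrow> (real \<Rightarrow> 'a measure) \<Rightarrow> 'a set set" where
  "history M F = sigma_sets (space M) (\<Union>t\<in>{0..}. sets (F t))"

definition process_algebra :: "'a measure \<Rightarrow> (real \<Rightarrow> 'a \<Rightarrow> real) \<Rightarrow> 'a set set" where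
  "process_algebra M X =
     sigma_sets (space M) (\<Union>t\<in>{0..}. sets (vimage_algebra (space M) (X t) borel))"

section \<open>Counting processes with a stochastic intensity\<close>

definition counting_path :: "(real \<Rightarrow> nat) \<Rightarrow> bool" where
  "counting_path n \<longleftrightarrow>
     n 0 = 0 \<and> mono_on {0..} n \<and>
     (\<forall>t\<ge>0. continuous (at_right t) (\<lambda>u. real (n u))) \<and>
     (\<forall>t>0. \<exists>s\<in>{0..<t}. n t \<le> n s + 1)"

definition predictable_algebra :: "'a measure \<Rightarrow> (real \<Rightarrow> 'a measure) \<Rightarrow> (real \<times> 'a) measure" where
  "predictable_algebra M F =
     sigma ({0<..} \<times> space M) {{s<..t} \<times> A | s t A. 0 \<le> s \<and> s \<le> t \<and> A \<in> sets (F s)}"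

text \<open>Intensity in the sense of Bremaud: \<open>E[\<integral> C dN] = E[\<integral> C \<lambda> ds]\<close> for all nonnegative
  predictable \<open>C\<close>.\<close>

definition stochastic_intensity ::
    "'a measure \<Rightarrow> (real \<Rightarrow> 'a measure) \<Rightarrow> (real \<Rightarrow> 'a \<Rightarrow> nat) \<Rightarrow> (real \<Rightarrow> 'a \<Rightarrow> real) \<Rightarrow> bool" where
  "stochastic_intensity M F N lam \<longleftrightarrow>
     (\<forall>t\<ge>0. \<forall>\<omega>\<in>space M. 0 \<le> lam t \<omega>) \<and>
     (\<forall>t\<ge>0. (\<lambda>(u, \<omega>). lam u \<omega>) \<in> borel_measurable (restrict_space borel {0..t} \<Otimes>\<^sub>M F t)) \<and>
     (\<forall>t\<ge>0. AE \<omega> in M. (\<integral>\<^sup>+u\<in>{0..t}. ennreal (lam u \<omega>) \<partial>lborel) < \<infinity>) \<and>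
     (\<forall>C :: real \<times> 'a \<Rightarrow> ennreal. C \<in> borel_measurable (predictable_algebra M F) \<longrightarrow>
        (\<integral>\<^sup>+\<omega>. (\<integral>\<^sup>+u\<in>{0<..}. C (u, \<omega>) \<partial>stieltjes (\<lambda>u. real (N u \<omega>))) \<partial>M) =
        (\<integral>\<^sup>+\<omega>. (\<integral>\<^sup>+u\<in>{0<..}. C (u, \<omega>) * ennreal (lam u \<omega>) \<partial>lborel) \<partial>M))"

text \<open>The strict past of the \<open>n\<close>-th jump time \<open>T\<^sub>n = inf {t. n \<le> N\<^sub>t}\<close>: generated by \<open>F\<^sub>0\<close> and the sets
  \<open>A \<inter> {t < T\<^sub>n}\<close> with \<open>A \<in> F\<^sub>t\<close>, where \<open>t < T\<^sub>n\<close> means \<open>N\<^sub>t < n\<close>.\<close>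

definition strict_past ::
    "'a measure \<Rightarrow> (real \<Rightarrow> 'a measure) \<Rightarrow> (real \<Rightarrow> 'a \<Rightarrow> nat) \<Rightarrow> nat \<Rightarrow> 'a set set" where
  "strict_past M F N n = sigma_sets (space M)
     (sets (F 0) \<union> {A \<inter> {\<omega>\<in>space M. N t \<omega> < n} | t A. 0 \<le> t \<and> A \<in> sets (F t)})"

section \<open>Hawkes processes\<close>

definition marked_sum :: "(real \<Rightarrow> 'a \<Rightarrow> nat) \<Rightarrow> (nat \<Rightarrow> 'a \<Rightarrow> real) \<Rightarrow> real \<Rightarrow> 'a \<Rightarrow> real" where
  "marked_sum N \<xi> t \<omega> = (\<Sum>i=1..N t \<omega>. \<xi> i \<omega>)"

text \<open>\<open>F\<close> is the history of the Hawkes process, \<open>F 0\<close> its initial information; \<open>F\<close> may be the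
  filtration generated by \<open>N\<close> and \<open>lam\<close>, or carry more initial information. The marks
  \<open>\<xi> 1, \<xi> 2, \<dots>\<close> feed back into the intensity, so they cannot be independent of \<open>N\<close>; instead each
  mark is independent of everything that happened before its arrival.\<close>

locale hawkes_process = prob_space M + filtration "space M" F
  for M :: "'a measure" and F :: "real \<Rightarrow> 'a measure" +
  fixes N :: "real \<Rightarrow> 'a \<Rightarrow> nat"
    and lam :: "real \<Rightarrow> 'a \<Rightarrow> real"
    and \<xi> :: "nat \<Rightarrow> 'a \<Rightarrow> real"
    and \<theta> \<eta> \<kappa> \<mu> \<psi> :: real
  assumes theta_nonneg: "0 \<le> \<theta>" and eta_pos: "0 < \<eta>" and kappa_pos: "0 < \<kappa>"
    and subalgebra_F: "\<And>t. subalgebra M (F t)"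
    and N_adapted: "\<And>t. 0 \<le> t \<Longrightarrow> N t \<in> measurable (F t) (count_space UNIV)"
    and N_counting: "\<And>\<omega>. \<omega> \<in> space M \<Longrightarrow> counting_path (\<lambda>t. N t \<omega>)"
    and intensity: "stochastic_intensity M F N lam"
    and marks_pos: "\<And>i \<omega>. 1 \<le> i \<Longrightarrow> \<omega> \<in> space M \<Longrightarrow> 0 < \<xi> i \<omega>"
    and marks_indep: "indep_vars (\<lambda>_. borel) \<xi> {1..}"
    and marks_ident: "\<And>i. 1 \<le> i \<Longrightarrow> distr M borel (\<xi> i) = distr M borel (\<xi> 1)"
    and marks_square_integrable: "integrable M (\<lambda>\<omega>. (\<xi> 1 \<omega>)\<^sup>2)"
    and marks_mean: "expectation (\<xi> 1) = \<mu>"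
    and marks_variance: "variance (\<xi> 1) = \<psi>\<^sup>2"
    and marks_unpredictable: "\<And>n. 1 \<le> n \<Longrightarrow>
      indep_set (strict_past M F N n) (sets (vimage_algebra (space M) (\<xi> n) borel))"
    and dynamics: "\<And>s t \<omega>. 0 \<le> s \<Longrightarrow> s \<le> t \<Longrightarrow> \<omega> \<in> space M \<Longrightarrow>
      lam t \<omega> = \<theta> + exp (- \<kappa> * (t - s)) * (lam s \<omega> - \<theta>)
        + \<eta> * (LINT u:{s<..t}|stieltjes (\<lambda>u. marked_sum N \<xi> u \<omega>). exp (- \<kappa> * (t - u)))"

section \<open>Tempered stable subordinators and their inverses\<close>

locale subordinator = prob_space M
  for M :: "'a measure" +
  fixes D :: "real \<Rightarrow> 'a \<Rightarrow> real"
  assumes D_measurable: "\<And>t. 0 \<le> t \<Longrightarrow> D t \<in> borel_measurable M"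
    and D_zero: "\<And>\<omega>. \<omega> \<in> space M \<Longrightarrow> D 0 \<omega> = 0"
    and D_mono: "\<And>\<omega>. \<omega> \<in> space M \<Longrightarrow> mono_on {0..} (\<lambda>t. D t \<omega>)"
    and D_right_continuous:
      "\<And>\<omega> t. \<omega> \<in> space M \<Longrightarrow> 0 \<le> t \<Longrightarrow> continuous (at_right t) (\<lambda>u. D u \<omega>)"
    and D_stationary: "\<And>s h. 0 \<le> s \<Longrightarrow> 0 \<le> h \<Longrightarrow>
      distr M borel (\<lambda>\<omega>. D (s + h) \<omega> - D s \<omega>) = distr M borel (D h)"
    and D_indep_increments: "\<And>(\<tau> :: nat \<Rightarrow> real) n. 0 \<le> \<tau> 0 \<Longrightarrow> mono \<tau> \<Longrightarrow>
      indep_vars (\<lambda>_. borel) (\<lambda>i \<omega>. D (\<tau> (Suc i)) \<omega> - D (\<tau> i) \<omega>) {..<n}"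

locale tempered_stable_subordinator = subordinator +
  fixes \<beta> \<nu> :: real
  assumes laplace: "\<And>s t. 0 \<le> s \<Longrightarrow> 0 \<le> t \<Longrightarrow>
    expectation (\<lambda>\<omega>. exp (- s * D t \<omega>)) = exp (- t * ((s + \<nu>) powr \<beta> - \<nu> powr \<beta>))"

text \<open>The mathematical convention \<open>inf {} = \<infinity>\<close> is not available for real values, and the real
  \<open>Inf {}\<close> could be a negative number, hence not a time. The value 0 in this case is immaterial: tempered
  stable subordinators with \<open>0 < \<beta> < 1\<close> and \<open>0 < \<nu>\<close> are almost surely unbounded.\<close>

definition first_passage :: "(real \<Rightarrow> 'a \<Rightarrow> real) \<Rightarrow> real \<Rightarrow> 'a \<Rightarrow> real" where
  "first_passage D t \<omega> =
     (if \<exists>r\<ge>0. t < D r \<omega> then Inf {r. 0 \<le> r \<and> t < D r \<omega>} else 0)"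

end

theory Submission
  imports Defs "HOL-Real_Asymp.Real_Asymp"
begin

text \<open>
  The exponential decay of the intensity is removed by passing to
  \<open>Z\<^sub>t = e\<^sup>\<kappa>\<^sup>t (\<lambda>\<^sub>t - \<theta>) + \<theta>\<close>. By the dynamics, \<open>Z\<close> is a pure jump process: it starts at
  \<open>\<lambda>\<^sub>0\<close> and gains \<open>\<eta> e\<^sup>\<kappa>\<^sup>T \<xi>\<^sub>k\<close> at the \<open>k\<close>-th jump time \<open>T = T\<^sub>k\<close>
  (\<open>accum_eq\<close>); in particular it is nonnegative and increasing. The mark \<open>\<xi>\<^sub>k\<close> is
  independent of the strict past of \<open>T\<^sub>k\<close>, and the left limit of \<open>Z\<close> is predictable, so
  the definition of a stochastic intensity turns a sum over jumps into a time integral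
  (\<open>state_compensator\<close>): \<open>E \<Sum> h(T\<^sub>k, Z(T\<^sub>k-)) g(\<xi>\<^sub>k) = E g(\<xi>\<^sub>1) \<cdot> E \<integral> h(u, Z\<^sub>u) \<lambda>\<^sub>u du\<close>.

  Let \<open>A\<close> be an event of the initial information on which \<open>\<lambda>\<^sub>0\<close> is bounded. Applied to the
  increments of \<open>Z\<close> and of \<open>(1 + Z)\<^sup>2\<close>, the formula shows that \<open>E 1\<^sub>A Z\<^sub>t\<close> and
  \<open>E 1\<^sub>A (1 + Z\<^sub>t)\<^sup>2\<close> solve linear integral equations. These determine them
  (\<open>linear_volterra_unique\<close>) once they are known to be finite, and finiteness comes from a
  Gronwall bound for the process truncated at a level of \<open>Z\<close> (\<open>square_accum_finite\<close>). The
  solutions are exponential polynomials: \<open>E 1\<^sub>A \<lambda>\<^sub>t\<close> and \<open>E 1\<^sub>A \<lambda>\<^sub>t\<^sup>2\<close> are linear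
  combinations of \<open>1\<close>, \<open>e\<^sup>-\<^sup>\<gamma>\<^sup>t\<close> and \<open>e\<^sup>-\<^sup>2\<^sup>\<gamma>\<^sup>t\<close>
  (\<open>intensity_moments\<close>).

  The random time \<open>E\<^sub>t\<close> is independent of the whole history, so by Fubini it may be inserted
  for \<open>t\<close> in these formulas, and its law enters only through the numbers
  \<open>E e\<^sup>-\<^sup>a\<^sup>E\<close> with \<open>a = \<gamma>, 2\<gamma>\<close> (\<open>time_changed_expectation\<close>). As \<open>\<lambda>\<^sub>0\<close> may fail to be
  integrable, conditional expectations are identified on each event \<open>\<lambda>\<^sub>0 \<le> K\<close> separately; these
  events exhaust the space.

  It remains to compute \<open>E e\<^sup>-\<^sup>a\<^sup>E\<close>. For almost every \<open>t\<close>, \<open>E\<^sub>t > r\<close> means \<open>D\<^sub>r \<le> t\<close>, and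
  therefore the Laplace transform in \<open>t\<close> of \<open>E (1 - e\<^sup>-\<^sup>a\<^sup>E)\<close> is \<open>a / (s (a + \<phi>(s)))\<close> with
  \<open>\<phi>(s) = (s + \<nu>)\<^sup>\<beta> - \<nu>\<^sup>\<beta>\<close> (\<open>passage_transform_laplace\<close>). Writing \<open>p = s + \<nu>\<close> and
  \<open>\<omega> = \<nu>\<^sup>\<beta> - a\<close>, expanding \<open>1 / ((p - \<nu>) (p\<^sup>\<beta> - \<omega>))\<close> in the geometric series in \<open>\<nu> / p\<close>
  and in \<open>\<omega> / p\<^sup>\<beta>\<close> and inverting term by term gives the series of Mittag-Leffler functions
  (\<open>tempered_series_laplace\<close>). Uniqueness of Laplace transforms of right continuous functions
  (\<open>laplace_unique\<close>) yields \<open>first_passage_laplace\<close>.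
\<close>


section \<open>Mittag-Leffler series and their Laplace transforms\<close>

text \<open>The Laplace transform is recorded together with absolute convergence, at a single abscissa.\<close>

definition has_laplace :: "(real \<Rightarrow> real) \<Rightarrow> real \<Rightarrow> real \<Rightarrow> bool" where
  "has_laplace f p L \<longleftrightarrow>
     has_bochner_integral lborel (\<lambda>t. indicator {0..} t * (exp (- p * t) * f t)) L"

text \<open>The factor \<open>1 / \<Gamma>(x + 1)\<close> makes the Laplace transform of the kernel a pure power,
  \<open>p\<^sup>-\<^sup>x\<^sup>-\<^sup>1\<close>, so that series of kernels are transformed into power series.\<close>

definition gamma_kernel :: "real \<Rightarrow> real \<Rightarrow> real" where
  "gamma_kernel x t = t powr x / Gamma (x + 1)"

lemma gamma_kernel_nonneg: "0 \<le> x \<Longrightarrow> 0 \<le> gamma_kernel x t"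
  by (simp add: gamma_kernel_def Gamma_real_pos less_imp_le)

lemma gamma_kernel_measurable [measurable]: "gamma_kernel x \<in> borel_measurable borel"
  unfolding gamma_kernel_def by measurable

lemma gamma_kernel_laplace:
  assumes x: "0 \<le> x" and p: "0 < p"
  shows "has_laplace (gamma_kernel x) p (p powr (- x - 1))"
  unfolding has_laplace_def
proof (rule has_bochner_integral_nn_integral)
  show "AE t in lborel. 0 \<le> indicator {0..} t * (exp (- p * t) * gamma_kernel x t)"
    using gamma_kernel_nonneg[OF x] by simp
  have G: "Gamma (x + 1) > 0" using x by (intro Gamma_real_pos) simp
  have "ennreal (Gamma (x + 1)) = (\<integral>\<^sup>+ t. ennreal (indicator {0..} t * t powr x / exp t) \<partial>lborel)"
    using Gamma_conv_nn_integral_real[of "x + 1"] x by simp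
  also have "\<dots> = p * (\<integral>\<^sup>+ t. ennreal (indicator {0..} (p * t) * (p * t) powr x / exp (p * t)) \<partial>lborel)"
    using nn_integral_real_affine[of "\<lambda>t. ennreal (indicator {0..} t * t powr x / exp t)" p 0] p
    by simp
  also have "(\<integral>\<^sup>+ t. ennreal (indicator {0..} (p * t) * (p * t) powr x / exp (p * t)) \<partial>lborel)
     = (\<integral>\<^sup>+ t. ennreal (p powr x * Gamma (x + 1)) *
            ennreal (indicator {0..} t * (exp (- p * t) * gamma_kernel x t)) \<partial>lborel)"
    using p G
    by (intro nn_integral_cong)
      (auto simp: ennreal_mult[symmetric] gamma_kernel_def indicator_def zero_le_mult_iff powr_mult
         exp_minus field_simps)
  also have "\<dots> = ennreal (p powr x * Gamma (x + 1)) *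
     (\<integral>\<^sup>+ t. ennreal (indicator {0..} t * (exp (- p * t) * gamma_kernel x t)) \<partial>lborel)"
    by (rule nn_integral_cmult) measurable
  finally have e: "ennreal (Gamma (x + 1)) = ennreal p * (ennreal (p powr x * Gamma (x + 1)) *
     (\<integral>\<^sup>+ t. ennreal (indicator {0..} t * (exp (- p * t) * gamma_kernel x t)) \<partial>lborel))" (is "_ = _ * (_ * ?I)") .
  have "ennreal (p powr (- x - 1)) = ennreal (1 / (p * (p powr x * Gamma (x + 1)))) * ennreal (Gamma (x + 1))"
    using p G by (simp add: ennreal_mult[symmetric] powr_minus powr_diff field_simps)
  also have "\<dots> = ennreal (1 / (p * (p powr x * Gamma (x + 1))) * (p * (p powr x * Gamma (x + 1)))) * ?I"
    unfolding e using p G by (subst ennreal_mult) (auto simp: ennreal_mult mult.assoc)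
  also have "\<dots> = ?I"
    using p G by simp
  finally show "?I = ennreal (p powr (- x - 1))" ..
qed (auto)

lemma exp_has_laplace:
  fixes p t :: real
  assumes p: "0 < p" and t: "0 \<le> t"
  shows "has_bochner_integral lborel (\<lambda>u. indicator {t..} u * exp (- p * u)) (exp (- p * t) / p)"
proof (rule has_bochner_integral_nn_integral)
  have "(\<integral>\<^sup>+ u. ennreal (exp (- p * u)) * indicator {t..} u \<partial>lborel) = ennreal (0 - (- exp (- p * t) / p))"
  proof (rule nn_integral_FTC_atLeast)
    show "((\<lambda>a. - exp (- p * a) / p) \<longlongrightarrow> 0) at_top"
      using p by real_asymp
  qed (use p in \<open>auto intro!: derivative_eq_intros\<close>)
  then show "(\<integral>\<^sup>+ u. ennreal (indicator {t..} u * exp (- p * u)) \<partial>lborel) = ennreal (exp (- p * t) / p)"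
    by (subst (asm) nn_integral_cong[where v="\<lambda>u. ennreal (indicator {t..} u * exp (- p * u))"])
       (auto simp: indicator_def)
qed (use p in auto)

text \<open>The kernel increases in \<open>t\<close>, so its Laplace integral at \<open>s\<close> is at least the part over
  \<open>[t, \<infinity>)\<close> with the kernel frozen at \<open>t\<close>. The bound is geometric in \<open>x\<close>; choosing \<open>s\<close>
  large makes all the series below converge without any estimate of the Gamma function.\<close>

lemma gamma_kernel_bound:
  assumes x: "0 \<le> x" and s: "0 < s" and t: "0 \<le> t"
  shows "gamma_kernel x t \<le> s powr (- x) * exp (s * t)"
proof -
  have L: "has_bochner_integral lborel (\<lambda>u. indicator {0..} u * (exp (- s * u) * gamma_kernel x u)) (s powr (- x - 1))"
    using gamma_kernel_laplace[OF x s] unfolding has_laplace_def .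
  have T: "has_bochner_integral lborel (\<lambda>u. gamma_kernel x t * (indicator {t..} u * exp (- s * u)))
     (gamma_kernel x t * (exp (- s * t) / s))"
    using exp_has_laplace[OF s t] by (rule has_bochner_integral_mult_right)
  have "gamma_kernel x t * (exp (- s * t) / s) \<le> s powr (- x - 1)"
  proof -
    have "integral\<^sup>L lborel (\<lambda>u. gamma_kernel x t * (indicator {t..} u * exp (- s * u)))
      \<le> integral\<^sup>L lborel (\<lambda>u. indicator {0..} u * (exp (- s * u) * gamma_kernel x u))"
    proof (rule integral_mono)
      fix u :: real
      have "t \<le> u \<Longrightarrow> gamma_kernel x t \<le> gamma_kernel x u"
        using x t by (auto simp: gamma_kernel_def intro!: divide_right_mono powr_mono2)
      then show "gamma_kernel x t * (indicator {t..} u * exp (- s * u)) \<le> indicator {0..} u * (exp (- s * u) * gamma_kernel x u)"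
        using t gamma_kernel_nonneg[OF x] by (auto simp: indicator_def mult.commute)
    qed (use L T in \<open>auto simp: has_bochner_integral_iff\<close>)
    then show ?thesis using L T by (simp add: has_bochner_integral_iff)
  qed
  then have "gamma_kernel x t * exp (- s * t) \<le> s powr (- x)"
    using s by (simp add: powr_diff field_simps)
  then show ?thesis
    by (simp add: exp_minus field_simps)
qed

lemma gamma_kernel_continuous: "0 < x \<Longrightarrow> continuous_on {0..} (gamma_kernel x)"
  unfolding gamma_kernel_def
  using Gamma_real_pos[of "x + 1"]
  by (intro continuous_on_divide continuous_on_powr' continuous_on_const continuous_on_id) force+

text \<open>The common exponential rate makes the sum of the moduli integrable against \<open>e\<^sup>-\<^sup>p\<^sup>t\<close>,
  hence sum and integral may be exchanged; on bounded intervals the same bound gives uniform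
  convergence. The conclusion has again the shape of the hypotheses, so the lemma can be iterated
  for a double series.\<close>

lemma laplace_series:
  fixes f :: "nat \<Rightarrow> real \<Rightarrow> real"
  assumes cont: "\<And>k. continuous_on {0..} (f k)"
    and bound: "\<And>k t. 0 \<le> t \<Longrightarrow> \<bar>f k t\<bar> \<le> b k * exp (\<sigma> * t)"
    and b: "summable b" and p: "\<sigma> < p"
    and L: "\<And>k. has_laplace (f k) p (L k)"
  shows "\<And>t. 0 \<le> t \<Longrightarrow> summable (\<lambda>k. f k t)"
    and "continuous_on {0..} (\<lambda>t. \<Sum>k. f k t)"
    and "\<And>t. 0 \<le> t \<Longrightarrow> \<bar>\<Sum>k. f k t\<bar> \<le> suminf b * exp (\<sigma> * t)"
    and "has_laplace (\<lambda>t. \<Sum>k. f k t) p (suminf L)"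
proof -
  have b0: "0 \<le> b k" for k using bound[of 0 k] by simp
  have sb: "summable (\<lambda>k. b k * exp (\<sigma> * t))" for t by (intro summable_mult2 b)
  show sn: "summable (\<lambda>k. f k t)" if "0 \<le> t" for t
    using bound[OF that] by (intro summable_comparison_test'[OF sb[of t]]) auto
  have sna: "summable (\<lambda>k. \<bar>f k t\<bar>)" if "0 \<le> t" for t
    using bound[OF that] by (intro summable_comparison_test'[OF sb[of t]]) auto
  show "\<bar>\<Sum>k. f k t\<bar> \<le> suminf b * exp (\<sigma> * t)" if t: "0 \<le> t" for t
  proof -
    have "\<bar>\<Sum>k. f k t\<bar> \<le> (\<Sum>k. \<bar>f k t\<bar>)" by (rule summable_rabs[OF sna[OF t]])
    also have "\<dots> \<le> (\<Sum>k. b k * exp (\<sigma> * t))" by (intro suminf_le bound t sna sb)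
    also have "\<dots> = suminf b * exp (\<sigma> * t)" using suminf_mult2[OF b] by simp
    finally show ?thesis .
  qed
  have cT: "continuous_on {0..T} (\<lambda>t. \<Sum>k. f k t)" for T
  proof (rule uniform_limit_theorem)
    show "uniform_limit {0..T} (\<lambda>n t. \<Sum>k<n. f k t) (\<lambda>t. \<Sum>k. f k t) sequentially"
    proof (rule Weierstrass_m_test)
      fix n t assume t: "t \<in> {0..T}"
      have "b n * exp (\<sigma> * t) \<le> b n * exp (\<bar>\<sigma>\<bar> * T)"
        using t b0[of n] by (intro mult_left_mono) (auto intro!: mult_mono)
      with bound[of t n] t show "norm (f n t) \<le> b n * exp (\<bar>\<sigma>\<bar> * T)" by auto
    qed (intro summable_mult2 b)
    show "\<forall>\<^sub>F n in sequentially. continuous_on {0..T} (\<lambda>t. \<Sum>k<n. f k t)"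
      by (intro always_eventually allI continuous_on_sum continuous_on_subset[OF cont]) auto
  qed simp
  show "continuous_on {0..} (\<lambda>t. \<Sum>k. f k t)"
  proof (subst continuous_on_eq_continuous_within, rule ballI)
    fix x :: real assume x: "x \<in> {0..}"
    have "continuous (at x within {0..x+1}) (\<lambda>t. \<Sum>k. f k t)"
      using cT[of "x + 1"] x by (auto simp: continuous_on_eq_continuous_within)
    moreover have "at x within {0..x+1} = at x within {0..}"
      by (rule at_within_nhd[of _ "{..<x+1}"]) auto
    ultimately show "continuous (at x within {0..}) (\<lambda>t. \<Sum>k. f k t)" by simp
  qed
  define E where "E = (\<lambda>t. indicator {0..} t * exp (- (p - \<sigma>) * t))"
  have E: "has_bochner_integral lborel E (1 / (p - \<sigma>))"
    using exp_has_laplace[of "p - \<sigma>" 0] p by (simp add: E_def)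
  define g where "g = (\<lambda>k t. indicator {0..} t * (exp (- p * t) * f k t))"
  have g: "has_bochner_integral lborel (g k) (L k)" for k
    using L[of k] by (simp add: has_laplace_def g_def)
  have gE: "\<bar>g k t\<bar> \<le> b k * E t" for k t
  proof (cases "0 \<le> t")
    case True
    have "exp (- p * t) * \<bar>f k t\<bar> \<le> exp (- p * t) * (b k * exp (\<sigma> * t))"
      using bound[OF True] by (intro mult_left_mono) auto
    also have "\<dots> = b k * exp (- (p - \<sigma>) * t)"
      by (simp add: exp_add[symmetric] algebra_simps)
    finally show ?thesis using True by (simp add: g_def E_def abs_mult)
  qed (simp add: g_def E_def)
  have si: "summable (\<lambda>k. integral\<^sup>L lborel (\<lambda>t. norm (g k t)))"
  proof (rule summable_comparison_test')
    show "summable (\<lambda>k. b k * (1 / (p - \<sigma>)))" by (intro summable_mult2 b)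
    fix k :: nat
    have "integral\<^sup>L lborel (\<lambda>t. norm (g k t)) \<le> integral\<^sup>L lborel (\<lambda>t. b k * E t)"
      using g[of k] E gE[of k] by (intro integral_mono) (auto simp: has_bochner_integral_iff)
    also have "\<dots> = b k * (1 / (p - \<sigma>))" using E by (simp add: has_bochner_integral_iff)
    finally show "norm (integral\<^sup>L lborel (\<lambda>t. norm (g k t))) \<le> b k * (1 / (p - \<sigma>))" by simp
  qed
  have ae: "AE t in lborel. summable (\<lambda>k. norm (g k t))"
  proof (rule AE_I2)
    fix t :: real
    show "summable (\<lambda>k. norm (g k t))"
    proof (cases "0 \<le> t")
      case True
      then show ?thesis using summable_mult[OF sna[OF True], of "exp (- p * t)"] by (simp add: g_def abs_mult)
    qed (simp add: g_def)
  qed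
  have gi: "integrable lborel (g k)" for k using g[of k] by (simp add: has_bochner_integral_iff)
  have "has_bochner_integral lborel (\<lambda>t. \<Sum>k. g k t) (suminf L)"
    using integrable_suminf[OF gi ae si] integral_suminf[OF gi ae si] g
    by (simp add: has_bochner_integral_iff)
  moreover have "(\<Sum>k. g k t) = indicator {0..} t * (exp (- p * t) * (\<Sum>k. f k t))" for t
    using sn[of t] by (cases "0 \<le> t") (simp_all add: g_def suminf_mult)
  ultimately show "has_laplace (\<lambda>t. \<Sum>k. f k t) p (suminf L)"
    unfolding has_laplace_def by simp
qed

text \<open>By the geometric series in \<open>\<omega> / p\<^sup>\<beta>\<close>, this is the expansion of
  \<open>p\<^sup>-\<^sup>m\<^sup>-\<^sup>1 / (p\<^sup>\<beta> - \<omega>)\<close> into pure powers.\<close>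

lemma stable_series_inner:
  fixes \<omega> \<beta> \<sigma> p :: real and m :: nat
  assumes \<beta>: "0 < \<beta>" and \<sigma>: "0 < \<sigma>" "\<bar>\<omega>\<bar> < \<sigma> powr \<beta>" and p: "\<sigma> < p"
  defines "A \<equiv> \<lambda>t. \<Sum>n. \<omega> ^ n * gamma_kernel (real m + \<beta> * (real n + 1)) t"
  defines "C \<equiv> \<sigma> powr (- \<beta>) / (1 - \<bar>\<omega>\<bar> * \<sigma> powr (- \<beta>))"
  shows "continuous_on {0..} A"
    and "\<And>t. 0 \<le> t \<Longrightarrow> summable (\<lambda>n. \<omega> ^ n * gamma_kernel (real m + \<beta> * (real n + 1)) t)"
    and "\<And>t. 0 \<le> t \<Longrightarrow> \<bar>A t\<bar> \<le> (1 / \<sigma>) ^ m * C * exp (\<sigma> * t)"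
    and "has_laplace A p ((1 / p) ^ m * (1 / (p * (p powr \<beta> - \<omega>))))"
proof -
  define b where "b = (\<lambda>n. ((1 / \<sigma>) ^ m * \<sigma> powr (- \<beta>)) * (\<bar>\<omega>\<bar> * \<sigma> powr (- \<beta>)) ^ n)"
  define L where "L = (\<lambda>n. ((1 / p) ^ m * p powr (- \<beta>) / p) * (\<omega> * p powr (- \<beta>)) ^ n)"
  have p0: "0 < p" using \<sigma> p by simp
  have q1: "\<bar>\<omega>\<bar> * \<sigma> powr (- \<beta>) < 1"
    using \<sigma> by (simp add: powr_minus field_simps)
  have "\<bar>\<omega>\<bar> < p powr \<beta>"
    using \<sigma> p powr_less_mono2[of \<beta> \<sigma> p] \<beta> by simp
  then have q2: "\<bar>\<omega> * p powr (- \<beta>)\<bar> < 1"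
    using p0 by (simp add: powr_minus field_simps abs_mult)
  have ex: "s powr - (real m + \<beta> * (real n + 1)) = (1 / s) ^ m * s powr (- \<beta>) * (s powr (- \<beta>)) ^ n"
    if "0 < s" for s n
  proof -
    have "- (real m + \<beta> * (real n + 1)) = - real m + - \<beta> + (- \<beta>) * real n" by (simp add: algebra_simps)
    then have "s powr - (real m + \<beta> * (real n + 1)) = s powr (- real m) * s powr (- \<beta>) * s powr ((- \<beta>) * real n)"
      by (simp only: powr_add)
    moreover have "s powr (- real m) = (1 / s) ^ m"
      using that by (simp add: powr_minus powr_realpow power_divide inverse_eq_divide)
    moreover have "s powr ((- \<beta>) * real n) = (s powr (- \<beta>)) ^ n"
      using that powr_realpow[of "s powr - \<beta>" n] unfolding powr_powr[symmetric] by simp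
    ultimately show ?thesis by simp
  qed
  have bs: "b sums (((1 / \<sigma>) ^ m * \<sigma> powr (- \<beta>)) * (1 / (1 - \<bar>\<omega>\<bar> * \<sigma> powr (- \<beta>))))"
    unfolding b_def using q1 by (intro sums_mult geometric_sums) (simp add: abs_mult)
  have Ls: "L sums (((1 / p) ^ m * p powr (- \<beta>) / p) * (1 / (1 - \<omega> * p powr (- \<beta>))))"
    unfolding L_def using q2 by (intro sums_mult geometric_sums) simp
  have bC: "suminf b = (1 / \<sigma>) ^ m * C"
    using bs by (simp add: sums_iff C_def)
  have Lv: "suminf L = (1 / p) ^ m * (1 / (p * (p powr \<beta> - \<omega>)))"
  proof -
    define P where "P = p powr \<beta>"
    have "0 < P" "0 < P - \<omega>" using \<open>\<bar>\<omega>\<bar> < p powr \<beta>\<close> by (auto simp: P_def)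
    then have "inverse P * (1 / (1 - \<omega> * inverse P)) = 1 / (P - \<omega>)" by (simp add: field_simps)
    then have "p powr (- \<beta>) * (1 / (1 - \<omega> * p powr (- \<beta>))) = 1 / (p powr \<beta> - \<omega>)"
      by (simp only: P_def powr_minus)
    moreover have "suminf L = (1 / p) ^ m * (1 / p) * (p powr (- \<beta>) * (1 / (1 - \<omega> * p powr (- \<beta>))))"
      using Ls by (simp add: sums_iff)
    ultimately show ?thesis by simp
  qed
  have pos: "0 < real m + \<beta> * (real n + 1)" for n
    using \<beta> by (intro add_nonneg_pos mult_pos_pos) auto
  note ser = laplace_series[where f="\<lambda>n t. \<omega> ^ n * gamma_kernel (real m + \<beta> * (real n + 1)) t"
      and b=b and \<sigma>=\<sigma> and p=p and L=L]
  have 1: "continuous_on {0..} (\<lambda>t. \<omega> ^ n * gamma_kernel (real m + \<beta> * (real n + 1)) t)" for n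
    by (intro continuous_intros gamma_kernel_continuous pos)
  have 2: "\<bar>\<omega> ^ n * gamma_kernel (real m + \<beta> * (real n + 1)) t\<bar> \<le> b n * exp (\<sigma> * t)" if "0 \<le> t" for n t
  proof -
    have "\<bar>\<omega> ^ n * gamma_kernel (real m + \<beta> * (real n + 1)) t\<bar>
        = \<bar>\<omega>\<bar> ^ n * gamma_kernel (real m + \<beta> * (real n + 1)) t"
      using gamma_kernel_nonneg[OF less_imp_le[OF pos]] by (simp add: abs_mult power_abs)
    also have "\<dots> \<le> \<bar>\<omega>\<bar> ^ n * (\<sigma> powr - (real m + \<beta> * (real n + 1)) * exp (\<sigma> * t))"
      using gamma_kernel_bound[OF less_imp_le[OF pos] \<sigma>(1) that] by (intro mult_left_mono) auto
    also have "\<dots> = b n * exp (\<sigma> * t)"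
      unfolding ex[OF \<sigma>(1)] b_def by (simp add: power_mult_distrib)
    finally show ?thesis .
  qed
  have 3: "has_laplace (\<lambda>t. \<omega> ^ n * gamma_kernel (real m + \<beta> * (real n + 1)) t) p (L n)" for n
  proof -
    have "has_bochner_integral lborel (\<lambda>t. \<omega> ^ n * (indicator {0..} t * (exp (- p * t) * gamma_kernel (real m + \<beta> * (real n + 1)) t)))
        (\<omega> ^ n * p powr (- (real m + \<beta> * (real n + 1)) - 1))"
      using gamma_kernel_laplace[OF less_imp_le[OF pos] p0] unfolding has_laplace_def
      by (rule has_bochner_integral_mult_right)
    moreover have "\<omega> ^ n * p powr (- (real m + \<beta> * (real n + 1)) - 1) = L n"
      using p0 unfolding powr_diff ex[OF p0] by (simp add: L_def power_mult_distrib)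
    ultimately show ?thesis by (simp add: has_laplace_def mult_ac)
  qed
  note ser = ser[OF 1 2 sums_summable[OF bs] p 3]
  from ser show "continuous_on {0..} A"
    and "\<And>t. 0 \<le> t \<Longrightarrow> summable (\<lambda>n. \<omega> ^ n * gamma_kernel (real m + \<beta> * (real n + 1)) t)"
    and "\<And>t. 0 \<le> t \<Longrightarrow> \<bar>A t\<bar> \<le> (1 / \<sigma>) ^ m * C * exp (\<sigma> * t)"
    and "has_laplace A p ((1 / p) ^ m * (1 / (p * (p powr \<beta> - \<omega>))))"
    unfolding A_def bC Lv by auto
qed

lemma powr_exceeds:
  fixes \<beta> \<nu> \<omega> :: real
  assumes \<beta>: "0 < \<beta>" and \<nu>: "0 \<le> \<nu>"
  shows "\<exists>\<sigma>>\<nu>. \<bar>\<omega>\<bar> < \<sigma> powr \<beta>"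
proof (intro exI conjI)
  let ?\<sigma> = "max (\<nu> + 1) ((\<bar>\<omega>\<bar> + 1) powr (1 / \<beta>))"
  show "\<nu> < ?\<sigma>" by simp
  have "\<bar>\<omega>\<bar> < ((\<bar>\<omega>\<bar> + 1) powr (1 / \<beta>)) powr \<beta>" using \<beta> by (simp add: powr_powr)
  also have "\<dots> \<le> ?\<sigma> powr \<beta>" using \<beta> by (intro powr_mono2) auto
  finally show "\<bar>\<omega>\<bar> < ?\<sigma> powr \<beta>" .
qed

text \<open>The series of the main theorem, which is \<open>(1 - E e\<^sup>-\<^sup>a\<^sup>E) / a\<close> for \<open>\<omega> = \<nu>\<^sup>\<beta> - a\<close>.\<close>

definition tempered_series :: "real \<Rightarrow> real \<Rightarrow> real \<Rightarrow> real \<Rightarrow> real" where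
  "tempered_series \<beta> \<nu> \<omega> t = exp (- \<nu> * t) *
     (\<Sum>m. \<nu> ^ m * t powr (\<beta> + real m) * mittag_leffler \<beta> (\<beta> + real m + 1) (\<omega> * t powr \<beta>))"

text \<open>At \<open>t = 0\<close> both sides vanish because \<open>0 powr x = 0\<close>.\<close>

lemma mittag_leffler_kernel_series:
  assumes \<beta>: "0 < \<beta>" and t: "0 \<le> t"
  shows "t powr (\<beta> + real m) * mittag_leffler \<beta> (\<beta> + real m + 1) (\<omega> * t powr \<beta>) =
     (\<Sum>n. \<omega> ^ n * gamma_kernel (real m + \<beta> * (real n + 1)) t)"
proof (cases "t = 0")
  case True
  then show ?thesis using \<beta> by (simp add: gamma_kernel_def)
next
  case False
  then have t: "0 < t" using t by simp
  obtain \<sigma> where \<sigma>: "0 < \<sigma>" "\<bar>\<omega>\<bar> < \<sigma> powr \<beta>"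
    using powr_exceeds[OF \<beta>, of 0 \<omega>] by auto
  have eq: "\<omega> ^ n * gamma_kernel (real m + \<beta> * (real n + 1)) t =
     t powr (\<beta> + real m) * (pochhammer 1 n / Gamma (\<beta> * real n + (\<beta> + real m + 1)) * ((\<omega> * t powr \<beta>) ^ n / fact n))" for n
  proof -
    have "real m + \<beta> * (real n + 1) = (\<beta> + real m) + \<beta> * real n" by (simp add: algebra_simps)
    then have "t powr (real m + \<beta> * (real n + 1)) = t powr (\<beta> + real m) * (t powr \<beta>) ^ n"
      using t by (simp add: powr_add powr_powr[symmetric] powr_realpow)
    moreover have "Gamma (real m + \<beta> * (real n + 1) + 1) = Gamma (\<beta> * real n + (\<beta> + real m + 1))"
      by (simp add: algebra_simps)
    ultimately show ?thesis
      by (simp add: gamma_kernel_def pochhammer_fact[symmetric] power_mult_distrib)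
  qed
  have "summable (\<lambda>n. \<omega> ^ n * gamma_kernel (real m + \<beta> * (real n + 1)) t)"
    using stable_series_inner(2)[OF \<beta> \<sigma>, of "\<sigma> + 1"] t by simp
  then have "summable (\<lambda>n. pochhammer 1 n / Gamma (\<beta> * real n + (\<beta> + real m + 1)) * ((\<omega> * t powr \<beta>) ^ n / fact n))"
    unfolding eq using t by (subst (asm) summable_cmult_iff) simp
  then show ?thesis
    unfolding eq mittag_leffler_def mittag_leffler_gen_def by (rule suminf_mult[symmetric])
qed

text \<open>The factor \<open>e\<^sup>-\<^sup>\<nu>\<^sup>t\<close> shifts the transform to \<open>p = s + \<nu>\<close>, and the geometric series
  in \<open>\<nu> / p\<close> sums to \<open>p / (p - \<nu>) = p / s\<close>.\<close>

lemma tempered_series_laplace: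
  fixes \<beta> \<nu> \<omega> \<sigma> s :: real
  assumes \<beta>: "0 < \<beta>" and \<nu>: "0 < \<nu>" and \<sigma>: "\<nu> < \<sigma>" "\<bar>\<omega>\<bar> < \<sigma> powr \<beta>" and s: "\<sigma> < s + \<nu>"
  shows "continuous_on {0..} (tempered_series \<beta> \<nu> \<omega>)"
    and "has_laplace (tempered_series \<beta> \<nu> \<omega>) s (1 / (s * ((s + \<nu>) powr \<beta> - \<omega>)))"
    and "\<And>t. 0 \<le> t \<Longrightarrow> summable (\<lambda>m. \<nu> ^ m * t powr (\<beta> + real m) * mittag_leffler \<beta> (\<beta> + real m + 1) (\<omega> * t powr \<beta>))"
proof -
  define p where "p = s + \<nu>"
  have p: "\<sigma> < p" "0 < p" using \<sigma> \<nu> s by (auto simp: p_def)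
  have \<sigma>0: "0 < \<sigma>" using \<sigma> \<nu> by simp
  define A where "A = (\<lambda>m t. \<Sum>n. \<omega> ^ n * gamma_kernel (real m + \<beta> * (real n + 1)) t)"
  define C where "C = \<sigma> powr (- \<beta>) / (1 - \<bar>\<omega>\<bar> * \<sigma> powr (- \<beta>))"
  define K where "K = 1 / (p * (p powr \<beta> - \<omega>))"
  have bs: "summable (\<lambda>m. (\<nu> / \<sigma>) ^ m * C)"
    using \<sigma> \<nu> by (intro summable_mult2 summable_geometric) auto
  have Ls: "(\<lambda>m. (\<nu> / p) ^ m * K) sums ((1 / (1 - \<nu> / p)) * K)"
    using p \<sigma> \<nu> by (intro sums_mult2 geometric_sums) auto
  have 1: "continuous_on {0..} (\<lambda>t. \<nu> ^ m * A m t)" for m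
    using stable_series_inner(1)[OF \<beta> \<sigma>0 \<sigma>(2) p(1)] unfolding A_def by (intro continuous_intros)
  have 2: "\<bar>\<nu> ^ m * A m t\<bar> \<le> ((\<nu> / \<sigma>) ^ m * C) * exp (\<sigma> * t)" if t: "0 \<le> t" for m t
  proof -
    have "\<bar>\<nu> ^ m * A m t\<bar> \<le> \<nu> ^ m * ((1 / \<sigma>) ^ m * C * exp (\<sigma> * t))"
      using stable_series_inner(3)[OF \<beta> \<sigma>0 \<sigma>(2) p(1) t, of m] \<nu>
      unfolding A_def C_def abs_mult by (intro mult_mono) auto
    then show ?thesis by (simp add: power_divide)
  qed
  have 3: "has_laplace (\<lambda>t. \<nu> ^ m * A m t) p ((\<nu> / p) ^ m * K)" for m
  proof -
    have "has_bochner_integral lborel (\<lambda>t. \<nu> ^ m * (indicator {0..} t * (exp (- p * t) * A m t))) (\<nu> ^ m * ((1 / p) ^ m * K))"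
      using stable_series_inner(4)[OF \<beta> \<sigma>0 \<sigma>(2) p(1), of m]
      unfolding has_laplace_def A_def K_def by (rule has_bochner_integral_mult_right)
    then show ?thesis by (simp add: has_laplace_def mult_ac power_divide)
  qed
  note outer = laplace_series[OF 1 2 bs p(1) 3]
  have outer_summable: "summable (\<lambda>m. \<nu> ^ m * A m t)" if "0 \<le> t" for t
    by (rule outer(1)) (use that in auto)
  have S: "tempered_series \<beta> \<nu> \<omega> t = exp (- \<nu> * t) * (\<Sum>m. \<nu> ^ m * A m t)" if "0 \<le> t" for t
    unfolding tempered_series_def A_def mult.assoc mittag_leffler_kernel_series[OF \<beta> that] ..
  have "continuous_on {0..} (\<lambda>t. exp (- \<nu> * t) * (\<Sum>m. \<nu> ^ m * A m t))"
    by (intro continuous_intros outer(2)) auto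
  then show "continuous_on {0..} (tempered_series \<beta> \<nu> \<omega>)"
    by (rule continuous_on_eq) (simp add: S)
  show "summable (\<lambda>m. \<nu> ^ m * t powr (\<beta> + real m) * mittag_leffler \<beta> (\<beta> + real m + 1) (\<omega> * t powr \<beta>))"
    if t: "0 \<le> t" for t
    using outer_summable[OF t] unfolding A_def mult.assoc mittag_leffler_kernel_series[OF \<beta> t] by simp
  have "indicator {0..} t * (exp (- s * t) * tempered_series \<beta> \<nu> \<omega> t)
     = (indicator {0..} t * (exp (- p * t) * (\<Sum>m. \<nu> ^ m * A m t)) :: real)" for t
  proof (cases "0 \<le> t")
    case True
    have "exp (- s * t) * exp (- \<nu> * t) = exp (- p * t)"
      by (simp add: p_def exp_add[symmetric] algebra_simps)
    then show ?thesis using S[OF True] by (simp add: mult.assoc[symmetric])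
  qed simp
  note eq = this
  have "(1 / (1 - \<nu> / p)) * K = 1 / (s * ((s + \<nu>) powr \<beta> - \<omega>))"
  proof -
    have "0 < s" using s \<sigma> \<nu> by simp
    then have "1 / (1 - \<nu> / p) = p / s" using p by (simp add: p_def field_simps)
    then show ?thesis using p(2) by (simp add: K_def p_def)
  qed
  then have L: "(\<Sum>m. (\<nu> / p) ^ m * K) = 1 / (s * ((s + \<nu>) powr \<beta> - \<omega>))"
    using Ls by (simp add: sums_iff)
  show "has_laplace (tempered_series \<beta> \<nu> \<omega>) s (1 / (s * ((s + \<nu>) powr \<beta> - \<omega>)))"
    using outer(4) unfolding has_laplace_def eq L .
qed

lemma tempered_series_summable:
  assumes \<beta>: "0 < \<beta>" and \<nu>: "0 < \<nu>" and t: "0 \<le> t"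
  shows "summable (\<lambda>m. \<nu> ^ m * t powr (\<beta> + real m) * mittag_leffler \<beta> (\<beta> + real m + 1) (\<omega> * t powr \<beta>))"
proof -
  obtain \<sigma> where \<sigma>: "\<nu> < \<sigma>" "\<bar>\<omega>\<bar> < \<sigma> powr \<beta>"
    using powr_exceeds[OF \<beta>, of \<nu> \<omega>] \<nu> by auto
  show ?thesis using tempered_series_laplace(3)[OF \<beta> \<nu> \<sigma> _ t, of \<sigma>] \<nu> by simp
qed

text \<open>Transforms along an arithmetic progression suffice: they are the moments of
  \<open>e\<^sup>-\<^sup>p\<^sup>u H u\<close> with respect to \<open>x = e\<^sup>-\<^sup>u\<close>. By the Weierstrass theorem the integral against
  every continuous function of \<open>x\<close> vanishes, and a bump supported where \<open>H\<close> has constant sign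
  gives a contradiction.\<close>

lemma laplace_unique:
  fixes H :: "real \<Rightarrow> real"
  assumes cont: "\<And>t. 0 \<le> t \<Longrightarrow> continuous (at_right t) H"
    and L: "\<And>k::nat. has_laplace H (p + real k) 0"
    and t: "0 \<le> t"
  shows "H t = 0"
proof (rule ccontr)
  assume Ht: "H t \<noteq> 0"
  define h where "h = (\<lambda>u. indicator {0..} u * (exp (- p * u) * H u))"
  have h: "has_bochner_integral lborel (\<lambda>u. h u * exp (- u) ^ k) 0" for k :: nat
  proof -
    have "h u * exp (- u) ^ k = indicator {0..} u * (exp (- (p + real k) * u) * H u)" for u
      by (simp add: h_def exp_of_nat_mult[symmetric] exp_add[symmetric] algebra_simps)
    then show ?thesis using L[of k] by (simp add: has_laplace_def)
  qed
  have hi: "integrable lborel h" using h[of 0] by (simp add: has_bochner_integral_iff)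
  have hm [measurable]: "h \<in> borel_measurable borel" using hi by (auto dest: borel_measurable_integrable)
  have hz: "u < 0 \<Longrightarrow> h u = 0" for u by (simp add: h_def)
  have zero: "(LBINT u. h u * f (exp (- u))) = 0" if f: "continuous_on UNIV f" for f :: "real \<Rightarrow> real"
  proof -
    have fm [measurable]: "f \<in> borel_measurable borel" using f by (rule borel_measurable_continuous_onI)
    have "bounded (f ` {0..1})"
      by (intro compact_imp_bounded compact_continuous_image continuous_on_subset[OF f]) auto
    then obtain B where B: "\<And>x. x \<in> {0..1} \<Longrightarrow> \<bar>f x\<bar> \<le> B"
      unfolding bounded_iff by (metis imageI real_norm_def)
    have ifn: "integrable lborel (\<lambda>u. h u * f (exp (- u)))"
    proof (rule Bochner_Integration.integrable_bound)
      show "integrable lborel (\<lambda>u. B * h u)" using hi by simp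
      show "AE u in lborel. norm (h u * f (exp (- u))) \<le> norm (B * h u)"
      proof (rule AE_I2)
        fix u :: real
        show "norm (h u * f (exp (- u))) \<le> norm (B * h u)"
        proof (cases "u < 0")
          case False
          then have "\<bar>f (exp (- u))\<bar> \<le> B" by (intro B) auto
          then have "\<bar>f (exp (- u))\<bar> \<le> \<bar>B\<bar>" by simp
          from mult_left_mono[OF this, of "\<bar>h u\<bar>"] show ?thesis by (simp add: abs_mult mult.commute)
        qed (simp add: hz)
      qed
    qed measurable
    have "\<bar>LBINT u. h u * f (exp (- u))\<bar> \<le> e * (LBINT u. \<bar>h u\<bar>)" if e: "0 < e" for e
    proof -
      obtain g where g: "real_polynomial_function g" "\<And>x. x \<in> {0..1} \<Longrightarrow> \<bar>f x - g x\<bar> < e"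
        using Stone_Weierstrass_real_polynomial_function[OF compact_Icc continuous_on_subset[OF f] e, of 0 1] by blast
      obtain a n where ga: "g = (\<lambda>x. \<Sum>i\<le>n. a i * x ^ i)"
        using g(1) unfolding real_polynomial_function_iff_sum by blast
      have "has_bochner_integral lborel (\<lambda>u. \<Sum>i\<le>n. a i * (h u * exp (- u) ^ i)) (\<Sum>i\<le>n. a i * 0)"
        by (intro has_bochner_integral_sum has_bochner_integral_mult_right h)
      then have G: "has_bochner_integral lborel (\<lambda>u. h u * g (exp (- u))) 0"
        by (simp add: ga sum_distrib_left mult_ac)
      have "(LBINT u. h u * f (exp (- u))) = (LBINT u. h u * f (exp (- u)) - h u * g (exp (- u)))"
        using G ifn by (simp add: has_bochner_integral_iff)
      also have "\<bar>\<dots>\<bar> \<le> (LBINT u. e * \<bar>h u\<bar>)"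
      proof (rule integral_abs_bound_integral)
        fix u :: real
        show "\<bar>h u * f (exp (- u)) - h u * g (exp (- u))\<bar> \<le> e * \<bar>h u\<bar>"
        proof (cases "u < 0")
          case False
          then have "\<bar>f (exp (- u)) - g (exp (- u))\<bar> \<le> e" using g(2)[of "exp (- u)"] by auto
          then have "\<bar>h u\<bar> * \<bar>f (exp (- u)) - g (exp (- u))\<bar> \<le> \<bar>h u\<bar> * e" by (intro mult_left_mono) auto
          then show ?thesis by (simp add: abs_mult[symmetric] algebra_simps)
        qed (simp add: hz)
      qed (use ifn G hi in \<open>auto simp: has_bochner_integral_iff\<close>)
      finally show ?thesis by simp
    qed
    note small = this
    have "\<bar>LBINT u. h u * f (exp (- u))\<bar> \<le> 0 + e" if e: "0 < e" for e
    proof -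
      let ?I = "LBINT u. \<bar>h u\<bar>"
      have "e * (?I / (?I + 1)) \<le> e * 1"
        using e by (intro mult_left_mono divide_le_eq_1_pos[THEN iffD2] add_nonneg_pos) auto
      then have "e / (?I + 1) * ?I \<le> e" by simp
      moreover have "0 < e / (?I + 1)" using e by (intro divide_pos_pos add_nonneg_pos) auto
      ultimately show ?thesis using small[of "e / (?I + 1)"] by simp
    qed
    then have "\<bar>LBINT u. h u * f (exp (- u))\<bar> \<le> 0" by (rule field_le_epsilon)
    then show ?thesis by simp
  qed
  \<comment> \<open>By right continuity \<open>H\<close> keeps its sign on a small interval to the right of \<open>t\<close>.\<close>
  have "(H \<longlongrightarrow> H t) (at_right t)" using cont[OF t] by (simp add: continuous_within)
  then have "((\<lambda>u. H u * H t) \<longlongrightarrow> H t * H t) (at_right t)" by (intro tendsto_intros)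
  moreover have "0 < H t * H t" using Ht by (metis not_real_square_gt_zero)
  ultimately have "eventually (\<lambda>u. 0 < H u * H t) (at_right t)" by (rule order_tendstoD)
  then obtain d where d: "t < d" "\<And>u. t < u \<Longrightarrow> u < d \<Longrightarrow> 0 < H u * H t"
    unfolding eventually_at_right_field by blast
  \<comment> \<open>A bump in the variable \<open>x = exp (- u)\<close>, positive exactly for \<open>t < u < d\<close>.\<close>
  define f where "f = (\<lambda>x. max 0 (min (x - exp (- d)) (exp (- t) - x)))"
  have "(LBINT u. h u * f (exp (- u))) = 0"
    by (rule zero) (auto simp: f_def intro!: continuous_intros)
  then have "(LBINT u. H t * (h u * f (exp (- u)))) = 0" by simp
  have nn: "0 \<le> H t * (h u * f (exp (- u)))" for u
  proof (cases "t < u \<and> u < d")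
    case True
    then have "0 \<le> (H u * H t) * f (exp (- u))" using d(2)[of u] by (auto simp: f_def)
    then have "0 \<le> (indicator {0..} u * exp (- p * u)) * ((H u * H t) * f (exp (- u)))"
      by (rule mult_nonneg_nonneg[rotated]) auto
    also have "\<dots> = H t * (h u * f (exp (- u)))" by (simp add: h_def)
    finally show ?thesis .
  next
    case False
    then have "exp (- t) \<le> exp (- u) \<or> exp (- u) \<le> exp (- d)" by auto
    then have "f (exp (- u)) = 0" unfolding f_def by linarith
    then show ?thesis by simp
  qed
  have int: "integrable lborel (\<lambda>u. H t * (h u * f (exp (- u))))"
  proof (rule Bochner_Integration.integrable_bound)
    show "integrable lborel (\<lambda>u. H t * h u)" using hi by simp
    show "(\<lambda>u. H t * (h u * f (exp (- u)))) \<in> borel_measurable lborel" unfolding f_def by measurable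
    show "AE u in lborel. norm (H t * (h u * f (exp (- u)))) \<le> norm (H t * h u)"
    proof (rule AE_I2)
      fix u :: real
      have "exp (- t) \<le> 1" "0 < exp (- d)" "0 < exp (-u)" using t by auto
      then have "0 \<le> f (exp (- u)) \<and> f (exp (- u)) \<le> 1" unfolding f_def by linarith
      then show "norm (H t * (h u * f (exp (- u)))) \<le> norm (H t * h u)"
        by (simp add: abs_mult mult_left_le mult.assoc[symmetric])
    qed
  qed
  have "AE u in lborel. H t * (h u * f (exp (- u))) = 0"
    using integral_nonneg_eq_0_iff_AE[OF int AE_I2[OF nn]] \<open>(LBINT u. H t * (h u * f (exp (- u)))) = 0\<close> by simp
  then have "AE u in lborel. u \<notin> {t<..<d}"
  proof eventually_elim
    case (elim u)
    show ?case
    proof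
      assume u: "u \<in> {t<..<d}"
      then have "0 < H u * H t" "0 < f (exp (- u))" "0 \<le> u" using d(2)[of u] t by (auto simp: f_def)
      then show False using elim by (auto simp: h_def)
    qed
  qed
  then have "emeasure lborel {t<..<d} = 0"
    by (subst (asm) AE_iff_measurable[of "{t<..<d}"]) auto
  then show False using d(1) by simp
qed

section \<open>The inverse of a tempered stable subordinator\<close>

context tempered_stable_subordinator
begin

lemma D_le: "\<omega> \<in> space M \<Longrightarrow> 0 \<le> q \<Longrightarrow> q \<le> r \<Longrightarrow> D q \<omega> \<le> D r \<omega>"
  using D_mono[of \<omega>] by (auto simp: mono_on_def)

lemma D_nonneg: "\<omega> \<in> space M \<Longrightarrow> 0 \<le> r \<Longrightarrow> 0 \<le> D r \<omega>"
  using D_le[of \<omega> 0 r] D_zero[of \<omega>] by simp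

definition unbounded_path :: "'a \<Rightarrow> bool" where
  "unbounded_path \<omega> \<longleftrightarrow> (\<forall>t. \<exists>r\<ge>0. t < D r \<omega>)"

definition laplace_exponent :: "real \<Rightarrow> real" where
  "laplace_exponent s = (s + \<nu>) powr \<beta> - \<nu> powr \<beta>"

lemma laplace_exponent_pos: "0 < \<beta> \<Longrightarrow> 0 < \<nu> \<Longrightarrow> 0 < s \<Longrightarrow> 0 < laplace_exponent s"
  unfolding laplace_exponent_def by (simp add: powr_less_mono2)

lemma laplace_D:
  assumes "0 \<le> s" "0 \<le> r"
  shows "has_bochner_integral M (\<lambda>\<omega>. exp (- s * D r \<omega>)) (exp (- r * laplace_exponent s))"
proof -
  have [measurable]: "D r \<in> borel_measurable M" using assms by (intro D_measurable)
  have "integrable M (\<lambda>\<omega>. exp (- s * D r \<omega>))"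
    using D_nonneg assms by (intro integrable_const_bound[where B=1]) (auto intro!: AE_I2)
  then show ?thesis
    using laplace[OF assms] by (simp add: has_bochner_integral_iff laplace_exponent_def)
qed

text \<open>By the Laplace transform, \<open>E exp (- D k) = c\<^sup>k\<close> with \<open>c < 1\<close>, so staying below a fixed
  level at all integer times has probability zero.\<close>

lemma AE_unbounded_path:
  assumes \<beta>: "0 < \<beta>" and \<nu>: "0 < \<nu>"
  shows "AE \<omega> in M. unbounded_path \<omega>"
proof -
  have "AE \<omega> in M. \<exists>k::nat. real K < D (real k) \<omega>" for K :: nat
  proof -
    have [measurable]: "D (real k) \<in> borel_measurable M" for k :: nat by (intro D_measurable) simp
    define A where "A = {\<omega> \<in> space M. \<forall>k::nat. D (real k) \<omega> \<le> real K}"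
    have A [measurable]: "A \<in> sets M" unfolding A_def by measurable
    have "prob A * exp (- real K) \<le> exp (- laplace_exponent 1) ^ k" for k :: nat
    proof -
      have "(\<integral>\<omega>. indicator A \<omega> * exp (- real K) \<partial>M) \<le> (\<integral>\<omega>. exp (- 1 * D (real k) \<omega>) \<partial>M)"
      proof (rule integral_mono)
        show "integrable M (\<lambda>\<omega>. indicator A \<omega> * exp (- real K))"
          using A by (intro integrable_mult_left integrable_real_indicator) (auto simp: emeasure_eq_measure)
        show "integrable M (\<lambda>\<omega>. exp (- 1 * D (real k) \<omega>))"
          using laplace_D[of 1 "real k"] by (simp add: has_bochner_integral_iff)
      qed (auto simp: A_def indicator_def)
      also have "\<dots> = exp (- laplace_exponent 1) ^ k"
        using laplace_D[of 1 "real k"] by (simp add: has_bochner_integral_iff exp_of_nat_mult[symmetric])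
      finally show ?thesis using A by simp
    qed
    moreover have "(\<lambda>k. exp (- laplace_exponent 1) ^ k) \<longlonglongrightarrow> 0"
      using laplace_exponent_pos[OF \<beta> \<nu>, of 1] by (intro LIMSEQ_power_zero) simp
    ultimately have "prob A * exp (- real K) \<le> 0"
      by (intro LIMSEQ_le_const) auto
    then have "prob A = 0" by (simp add: mult_le_0_iff measure_le_0_iff)
    then have "AE \<omega> in M. \<omega> \<notin> A" using A by (simp add: prob_eq_0)
    then show ?thesis by (rule AE_mp) (auto simp: A_def not_le intro!: AE_I2)
  qed
  then have "AE \<omega> in M. \<forall>K::nat. \<exists>k::nat. real K < D (real k) \<omega>"
    by (subst AE_all_countable) auto
  then show ?thesis
  proof eventually_elim
    case (elim \<omega>)
    show ?case unfolding unbounded_path_def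
    proof
      fix t :: real
      obtain K :: nat where "t \<le> real K" using real_arch_simple by blast
      moreover obtain k :: nat where "real K < D (real k) \<omega>" using elim by blast
      ultimately show "\<exists>r\<ge>0. t < D r \<omega>" by (intro exI[of _ "real k"]) auto
    qed
  qed
qed

text \<open>Monotone paths allow the infimum to be tested at rational times only, which makes the
  first passage time jointly measurable. The second alternative is the value \<open>0\<close> on bounded paths.\<close>

lemma first_passage_less_iff:
  assumes \<omega>: "\<omega> \<in> space M"
  shows "first_passage D t \<omega> < r \<longleftrightarrow>
     (\<exists>q\<in>{q\<in>\<rat>. 0 \<le> q}. q < r \<and> t < D q \<omega>) \<or> (0 < r \<and> (\<forall>q\<in>{q\<in>\<rat>. 0 \<le> q}. D q \<omega> \<le> t))"
proof -
  let ?S = "{r. 0 \<le> r \<and> t < D r \<omega>}"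
  have rat: "\<exists>q\<in>{q\<in>\<rat>. 0 \<le> q}. q < y \<and> t < D q \<omega>" if x: "x \<in> ?S" "x < y" for x y
  proof -
    obtain q where q: "q \<in> \<rat>" "x < q" "q < y" using Rats_dense_in_real[OF x(2)] by blast
    then show ?thesis using x D_le[OF \<omega>, of x q] by (intro bexI[of _ q]) auto
  qed
  show ?thesis
  proof (cases "?S = {}")
    case True
    then have "\<not> (\<exists>r\<ge>0. t < D r \<omega>)" by blast
    then have f: "first_passage D t \<omega> = 0" and le: "\<And>q. 0 \<le> q \<Longrightarrow> D q \<omega> \<le> t"
      by (auto simp: first_passage_def not_less)
    have "\<not> (\<exists>q\<in>{q\<in>\<rat>. 0 \<le> q}. q < r \<and> t < D q \<omega>)" "\<forall>q\<in>{q\<in>\<rat>. 0 \<le> q}. D q \<omega> \<le> t"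
      using le by force+
    then show ?thesis unfolding f by metis
  next
    case False
    then obtain x where x: "x \<in> ?S" by blast
    have "\<not> (\<forall>q\<in>{q\<in>\<rat>. 0 \<le> q}. D q \<omega> \<le> t)" using rat[OF x, of "x + 1"] by (auto simp: not_le)
    moreover have "first_passage D t \<omega> = Inf ?S" using x by (auto simp: first_passage_def)
    moreover have "Inf ?S < r \<longleftrightarrow> (\<exists>y\<in>?S. y < r)"
      by (rule cInf_less_iff[OF False]) (auto intro: bdd_belowI[of _ 0])
    moreover have "(\<exists>y\<in>?S. y < r) \<longleftrightarrow> (\<exists>q\<in>{q\<in>\<rat>. 0 \<le> q}. q < r \<and> t < D q \<omega>)"
      using rat[of _ r] by blast
    ultimately show ?thesis by (simp only: simp_thms)
  qed
qed

lemma first_passage_jointly_measurable: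
  "(\<lambda>(t, \<omega>). first_passage D t \<omega>) \<in> borel_measurable (borel \<Otimes>\<^sub>M M)"
proof (rule borel_measurableI_less)
  fix r :: real
  have c: "countable {q\<in>\<rat>. (0::real) \<le> q}" using countable_rat by (rule countable_subset[rotated]) auto
  let ?Q = "{q\<in>\<rat>. (0::real) \<le> q}" and ?P = "borel \<Otimes>\<^sub>M M :: (real \<times> 'a) measure"
  define A where "A = (\<Union>q\<in>?Q. {x \<in> space ?P. q < r \<and> fst x < D q (snd x)})"
  define B where "B = (\<Union>q\<in>?Q. {x \<in> space ?P. fst x < D q (snd x)})"
  have S: "{x \<in> space ?P. fst x < D q (snd x)} \<in> sets ?P" if "0 \<le> q" for q
  proof -
    have [measurable]: "D q \<in> borel_measurable M" using that by (rule D_measurable)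
    show ?thesis by measurable
  qed
  have A: "A \<in> sets ?P"
    unfolding A_def
  proof (rule sets.countable_UN''[OF c])
    fix q assume "q \<in> ?Q"
    then show "{x \<in> space ?P. q < r \<and> fst x < D q (snd x)} \<in> sets ?P"
      using S[of q] by (cases "q < r") simp_all
  qed
  have B: "B \<in> sets ?P"
    unfolding B_def using S by (intro sets.countable_UN''[OF c]) simp
  define Z where "Z = A \<union> (if 0 < r then space ?P - B else {})"
  have C: "Z \<in> sets ?P"
    unfolding Z_def using sets.Un[OF A sets.compl_sets[OF B]] A by (cases "0 < r") simp_all
  have Zx: "x \<in> Z \<longleftrightarrow> first_passage D (fst x) (snd x) < r"
    if x: "x \<in> space ?P" for x
  proof -
    have \<omega>: "snd x \<in> space M" using x by (auto simp: space_pair_measure)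
    have "x \<in> A \<longleftrightarrow> (\<exists>q\<in>?Q. q < r \<and> fst x < D q (snd x))"
      using x unfolding A_def by blast
    moreover have "x \<in> B \<longleftrightarrow> \<not> (\<forall>q\<in>?Q. D q (snd x) \<le> fst x)"
      using x unfolding B_def not_le[symmetric] by blast
    ultimately show ?thesis
      unfolding first_passage_less_iff[OF \<omega>] Z_def using x by (cases "0 < r") (simp_all only: Un_iff Diff_iff if_True if_False simp_thms empty_iff)
  qed
  have "Z = {x \<in> space ?P. first_passage D (fst x) (snd x) < r}"
    using sets.sets_into_space[OF C] Zx by (intro set_eqI iffI) (auto simp only: mem_Collect_eq)
  with C show "{x \<in> space ?P. (case x of (t, \<omega>) \<Rightarrow> first_passage D t \<omega>) < r} \<in> sets ?P"
    unfolding case_prod_unfold by simp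
qed

lemma first_passage_measurable [measurable]: "first_passage D t \<in> borel_measurable M"
  using measurable_compose[OF measurable_Pair1' first_passage_jointly_measurable, of t] by simp

lemma first_passage_nonneg: "0 \<le> first_passage D t \<omega>"
  unfolding first_passage_def by (auto intro!: cInf_greatest)

lemma less_first_passage_imp: "0 \<le> r \<Longrightarrow> r < first_passage D t \<omega> \<Longrightarrow> D r \<omega> \<le> t"
proof (rule ccontr)
  assume r: "0 \<le> r" "r < first_passage D t \<omega>" "\<not> D r \<omega> \<le> t"
  then have "\<exists>r\<ge>0. t < D r \<omega>" by auto
  then have "first_passage D t \<omega> = Inf {r. 0 \<le> r \<and> t < D r \<omega>}"
    by (simp add: first_passage_def)
  also have "\<dots> \<le> r"
    using r by (intro cInf_lower) (auto intro: bdd_belowI[of _ 0])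
  finally show False using r by simp
qed

text \<open>Together with \<open>less_first_passage_imp\<close> this sandwiches the event \<open>r < E\<^sub>t\<close> between
  \<open>D\<^sub>r < t\<close> and \<open>D\<^sub>r \<le> t\<close>, which on a given path differ for a single \<open>t\<close> when \<open>r\<close> is fixed.\<close>

lemma less_first_passageI:
  assumes \<omega>: "\<omega> \<in> space M" and u: "unbounded_path \<omega>" and r: "0 \<le> r" "D r \<omega> < t"
  shows "r < first_passage D t \<omega>"
proof -
  have "((\<lambda>u. D u \<omega>) \<longlongrightarrow> D r \<omega>) (at_right r)"
    using D_right_continuous[OF \<omega> r(1)] by (simp add: continuous_within)
  then have "eventually (\<lambda>u. D u \<omega> < t) (at_right r)" using r(2) by (rule order_tendstoD)
  then obtain d where d: "r < d" "\<And>u. r < u \<Longrightarrow> u < d \<Longrightarrow> D u \<omega> < t"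
    unfolding eventually_at_right_field by blast
  have "first_passage D t \<omega> = Inf {r. 0 \<le> r \<and> t < D r \<omega>}"
    using u by (auto simp: first_passage_def unbounded_path_def)
  also have "d \<le> \<dots>"
  proof (rule cInf_greatest)
    show "{r. 0 \<le> r \<and> t < D r \<omega>} \<noteq> {}" using u by (auto simp: unbounded_path_def)
    fix x assume x: "x \<in> {r. 0 \<le> r \<and> t < D r \<omega>}"
    show "d \<le> x"
    proof (rule ccontr)
      assume "\<not> d \<le> x"
      then show False using x d(2)[of x] D_le[OF \<omega>, of x r] r by (cases "r < x") auto
    qed
  qed
  finally show ?thesis using d by simp
qed

lemma first_passage_mono:
  assumes "unbounded_path \<omega>" "t \<le> t'"
  shows "first_passage D t \<omega> \<le> first_passage D t' \<omega>"
proof -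
  have "Inf {r. 0 \<le> r \<and> t < D r \<omega>} \<le> Inf {r. 0 \<le> r \<and> t' < D r \<omega>}"
    using assms by (intro cInf_superset_mono) (auto simp: unbounded_path_def intro: bdd_belowI[of _ 0])
  then show ?thesis using assms by (auto simp: first_passage_def unbounded_path_def)
qed

lemma first_passage_right_continuous:
  assumes \<omega>: "\<omega> \<in> space M" and u: "unbounded_path \<omega>" and S: "\<And>n. t < S n" "S \<longlonglongrightarrow> t"
  shows "(\<lambda>n. first_passage D (S n) \<omega>) \<longlonglongrightarrow> first_passage D t \<omega>"
proof (rule order_tendstoI)
  fix a assume "a < first_passage D t \<omega>"
  then show "eventually (\<lambda>n. a < first_passage D (S n) \<omega>) sequentially"
    using first_passage_mono[OF u] S(1) by (intro always_eventually allI) (meson less_imp_le order_less_le_trans)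
next
  fix a assume a: "first_passage D t \<omega> < a"
  have nb: "\<not> (\<forall>q\<in>{q\<in>\<rat>. 0 \<le> q}. D q \<omega> \<le> t')" for t'
  proof -
    obtain r where r: "0 \<le> r" "t' < D r \<omega>" using u by (auto simp: unbounded_path_def)
    obtain q where "q \<in> \<rat>" "r < q" using Rats_dense_in_real[of r "r + 1"] by auto
    then show ?thesis using r D_le[OF \<omega>, of r q] by force
  qed
  then obtain q where q: "q \<in> \<rat>" "0 \<le> q" "q < a" "t < D q \<omega>"
    using a first_passage_less_iff[OF \<omega>, of t a] by auto
  have "eventually (\<lambda>n. S n < D q \<omega>) sequentially" using S(2) q(4) by (rule order_tendstoD)
  then show "eventually (\<lambda>n. first_passage D (S n) \<omega> < a) sequentially"
    by eventually_elim (use q first_passage_less_iff[OF \<omega>, of _ a] in auto)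
qed

definition passage_transform :: "real \<Rightarrow> real \<Rightarrow> real" where
  "passage_transform a t = expectation (\<lambda>\<omega>. 1 - exp (- a * first_passage D t \<omega>))"

lemma exp_passage_le_1: "0 \<le> a \<Longrightarrow> exp (- a * first_passage D t \<omega>) \<le> 1"
  using mult_nonneg_nonneg[OF _ first_passage_nonneg[of t \<omega>], of a] by simp

lemma exp_passage_integrable:
  assumes "0 \<le> a"
  shows "integrable M (\<lambda>\<omega>. exp (- a * first_passage D t \<omega>))"
proof (rule integrable_const_bound[where B=1])
  show "AE \<omega> in M. norm (exp (- a * first_passage D t \<omega>)) \<le> 1"
    using exp_passage_le_1[OF assms] by (intro AE_I2) (simp only: real_norm_def abs_exp_cancel)
qed measurable

lemma passage_transform_integrable:
  "0 \<le> a \<Longrightarrow> integrable M (\<lambda>\<omega>. 1 - exp (- a * first_passage D t \<omega>))"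
  by (intro Bochner_Integration.integrable_diff exp_passage_integrable) simp_all

lemma passage_transform_right_continuous:
  assumes \<beta>: "0 < \<beta>" and \<nu>: "0 < \<nu>" and a: "0 \<le> a"
  shows "continuous (at_right t) (passage_transform a)"
  unfolding continuous_within
proof (rule tendsto_at_right_sequentially[of t "t + 1"])
  fix S :: "nat \<Rightarrow> real"
  assume S: "\<And>n. t < S n" "S \<longlonglongrightarrow> t"
  show "(\<lambda>n. passage_transform a (S n)) \<longlonglongrightarrow> passage_transform a t"
    unfolding passage_transform_def
  proof (rule integral_dominated_convergence[where w="\<lambda>_. 1"])
    show "AE \<omega> in M. (\<lambda>n. 1 - exp (- a * first_passage D (S n) \<omega>)) \<longlonglongrightarrow> 1 - exp (- a * first_passage D t \<omega>)"
      using AE_unbounded_path[OF \<beta> \<nu>] AE_space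
    proof eventually_elim
      case (elim \<omega>)
      then show ?case by (intro tendsto_intros first_passage_right_continuous S)
    qed
    show "AE \<omega> in M. norm (1 - exp (- a * first_passage D (S n) \<omega>)) \<le> 1" for n
    proof (rule AE_I2)
      fix \<omega>
      show "norm (1 - exp (- a * first_passage D (S n) \<omega>)) \<le> 1"
        using exp_passage_le_1[OF a, of "S n" \<omega>] exp_gt_zero[of "- a * first_passage D (S n) \<omega>"]
        unfolding real_norm_def by linarith
    qed
  qed simp_all
qed simp

lemma one_minus_exp_nn_integral:
  fixes a x :: real
  assumes a: "0 < a" and x: "0 \<le> x"
  shows "(\<integral>\<^sup>+ r. ennreal (indicator {0..} r * (a * exp (- a * r))) * indicator {r. r < x} r \<partial>lborel) = ennreal (1 - exp (- a * x))"
proof -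
  have "(\<integral>\<^sup>+ r. ennreal (indicator {0..} r * (a * exp (- a * r))) * indicator {r. r < x} r \<partial>lborel)
      = (\<integral>\<^sup>+ r. ennreal (a * exp (- a * r)) * indicator {0..x} r \<partial>lborel)"
    using AE_lborel_singleton[of x] by (intro nn_integral_cong_AE) (auto elim!: eventually_mono simp: indicator_def)
  also have "\<dots> = ennreal ((- exp (- a * x)) - (- exp (- a * 0)))"
    using a x by (intro nn_integral_FTC_Icc) (auto intro!: derivative_eq_intros)
  finally show ?thesis by simp
qed

text \<open>Write \<open>1 - e\<^sup>-\<^sup>a\<^sup>E = \<integral> a e\<^sup>-\<^sup>a\<^sup>r 1(r < E) dr\<close> and integrate over \<open>t\<close> first:
  \<open>r < E\<^sub>t\<close> means \<open>t \<ge> D\<^sub>r\<close>, and what remains is the Laplace transform of \<open>D\<^sub>r\<close>, an exponential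
  in \<open>r\<close>.\<close>

lemma passage_transform_laplace:
  assumes \<beta>: "0 < \<beta>" and \<nu>: "0 < \<nu>" and a: "0 < a" and s: "0 < s"
  shows "has_laplace (passage_transform a) s (a / (s * (a + laplace_exponent s)))"
  unfolding has_laplace_def
proof (rule has_bochner_integral_nn_integral)
  interpret L: pair_sigma_finite lborel M ..
  define Ep where "Ep = (\<lambda>x. case x of (t, \<omega>) \<Rightarrow> first_passage D t \<omega>)"
  have [measurable]: "Ep \<in> borel_measurable (borel \<Otimes>\<^sub>M M)"
    unfolding Ep_def by (rule first_passage_jointly_measurable)
  have Ep: "Ep (t, \<omega>) = first_passage D t \<omega>" for t \<omega> by (simp add: Ep_def)
  define es where "es = (\<lambda>t. ennreal (indicator {0..} t * exp (- s * t)))"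
  define ea where "ea = (\<lambda>r. ennreal (indicator {0..} r * (a * exp (- a * r))))"
  \<comment> \<open>The integrand in \<open>t\<close>, \<open>r\<close> and \<open>\<omega>\<close>, whose three integrals are reordered below.\<close>
  define K where "K = (\<lambda>t r \<omega>. es t * (ea r * indicator {x. r < x} (Ep (t, \<omega>))))"
  have [measurable]: "es \<in> borel_measurable borel" "ea \<in> borel_measurable borel"
    unfolding es_def ea_def by measurable
  have ind: "indicator {x. r < x} y = (if r < y then 1 else 0 :: ennreal)" for r y :: real by simp
  have Km1: "(\<lambda>(r, \<omega>). K t r \<omega>) \<in> borel_measurable (lborel \<Otimes>\<^sub>M M)" for t
    unfolding K_def ind by measurable
  have Km2: "(\<lambda>(t, \<omega>). K t r \<omega>) \<in> borel_measurable (lborel \<Otimes>\<^sub>M M)" for r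
    unfolding K_def ind by measurable
  have Km3: "(\<lambda>(t, r). \<integral>\<^sup>+\<omega>. K t r \<omega> \<partial>M) \<in> borel_measurable (lborel \<Otimes>\<^sub>M lborel)"
    unfolding K_def ind by measurable
  have Gm: "passage_transform a \<in> borel_measurable borel"
    unfolding passage_transform_def Ep[symmetric] by measurable
  show "(\<lambda>t. indicator {0..} t * (exp (- s * t) * passage_transform a t)) \<in> borel_measurable lborel"
    using Gm by measurable
  have G0: "0 \<le> passage_transform a t" for t
    unfolding passage_transform_def using exp_passage_le_1[of a t] a by (intro integral_nonneg_AE AE_I2) simp
  then show "AE t in lborel. 0 \<le> indicator {0..} t * (exp (- s * t) * passage_transform a t)" by simp
  have e: "0 < laplace_exponent s" using \<beta> \<nu> s by (rule laplace_exponent_pos)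
  then show "0 \<le> a / (s * (a + laplace_exponent s))" using a s by simp
  have "(\<integral>\<^sup>+t. ennreal (indicator {0..} t * (exp (- s * t) * passage_transform a t)) \<partial>lborel)
     = (\<integral>\<^sup>+t. (\<integral>\<^sup>+\<omega>. (\<integral>\<^sup>+r. K t r \<omega> \<partial>lborel) \<partial>M) \<partial>lborel)"
  proof (intro nn_integral_cong)
    fix t :: real
    have "ennreal (passage_transform a t) = (\<integral>\<^sup>+\<omega>. ennreal (1 - exp (- a * first_passage D t \<omega>)) \<partial>M)"
      unfolding passage_transform_def using a exp_passage_le_1[of a t]
      by (intro nn_integral_eq_integral[symmetric] passage_transform_integrable AE_I2) simp_all
    also have "\<dots> = (\<integral>\<^sup>+\<omega>. (\<integral>\<^sup>+r. ea r * indicator {x. r < x} (Ep (t, \<omega>)) \<partial>lborel) \<partial>M)"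
      unfolding ea_def Ep using one_minus_exp_nn_integral[OF a first_passage_nonneg]
      by (intro nn_integral_cong) (simp add: indicator_def)
    finally have eq: "ennreal (passage_transform a t)
      = (\<integral>\<^sup>+\<omega>. (\<integral>\<^sup>+r. ea r * indicator {x. r < x} (Ep (t, \<omega>)) \<partial>lborel) \<partial>M)" .
    have "ennreal (indicator {0..} t * (exp (- s * t) * passage_transform a t))
      = es t * ennreal (passage_transform a t)"
      using G0[of t] by (simp add: es_def ennreal_mult[symmetric] mult.assoc)
    also have "\<dots> = es t * (\<integral>\<^sup>+\<omega>. (\<integral>\<^sup>+r. ea r * indicator {x. r < x} (Ep (t, \<omega>)) \<partial>lborel) \<partial>M)"
      unfolding eq ..
    also have "\<dots> = (\<integral>\<^sup>+\<omega>. es t * (\<integral>\<^sup>+r. ea r * indicator {x. r < x} (Ep (t, \<omega>)) \<partial>lborel) \<partial>M)"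
      unfolding ind by (rule nn_integral_cmult[symmetric]) measurable
    also have "\<dots> = (\<integral>\<^sup>+\<omega>. (\<integral>\<^sup>+r. K t r \<omega> \<partial>lborel) \<partial>M)"
      unfolding K_def ind by (intro nn_integral_cong nn_integral_cmult[symmetric]) measurable
    finally show "ennreal (indicator {0..} t * (exp (- s * t) * passage_transform a t))
      = (\<integral>\<^sup>+\<omega>. (\<integral>\<^sup>+r. K t r \<omega> \<partial>lborel) \<partial>M)" .
  qed
  also have "\<dots> = (\<integral>\<^sup>+t. (\<integral>\<^sup>+r. (\<integral>\<^sup>+\<omega>. K t r \<omega> \<partial>M) \<partial>lborel) \<partial>lborel)"
    by (intro nn_integral_cong L.Fubini'[OF Km1])
  also have "\<dots> = (\<integral>\<^sup>+r. (\<integral>\<^sup>+t. (\<integral>\<^sup>+\<omega>. K t r \<omega> \<partial>M) \<partial>lborel) \<partial>lborel)"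
    by (rule lborel_pair.Fubini'[OF Km3, symmetric])
  also have "\<dots> = (\<integral>\<^sup>+r. (\<integral>\<^sup>+\<omega>. (\<integral>\<^sup>+t. K t r \<omega> \<partial>lborel) \<partial>M) \<partial>lborel)"
    by (intro nn_integral_cong L.Fubini'[OF Km2, symmetric])
  also have "\<dots> = (\<integral>\<^sup>+r. ennreal (a / s * (indicator {0..} r * exp (- (a + laplace_exponent s) * r))) \<partial>lborel)"
  proof (intro nn_integral_cong)
    fix r :: real
    show "(\<integral>\<^sup>+\<omega>. (\<integral>\<^sup>+t. K t r \<omega> \<partial>lborel) \<partial>M) = ennreal (a / s * (indicator {0..} r * exp (- (a + laplace_exponent s) * r)))"
    proof (cases "0 \<le> r")
      case False
      then show ?thesis by (simp add: K_def ea_def)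
    next
      case r: True
      have [measurable]: "D r \<in> borel_measurable M" using r by (intro D_measurable)
      have "(\<integral>\<^sup>+\<omega>. (\<integral>\<^sup>+t. K t r \<omega> \<partial>lborel) \<partial>M) = (\<integral>\<^sup>+\<omega>. ennreal (a * exp (- a * r) / s) * ennreal (exp (- s * D r \<omega>)) \<partial>M)"
      proof (rule nn_integral_cong_AE, use AE_unbounded_path[OF \<beta> \<nu>] AE_space in eventually_elim)
        case (elim \<omega>)
        have "(\<integral>\<^sup>+t. K t r \<omega> \<partial>lborel) = (\<integral>\<^sup>+t. ea r * ennreal (indicator {D r \<omega>..} t * exp (- s * t)) \<partial>lborel)"
        proof (rule nn_integral_cong_AE, use AE_lborel_singleton[of "D r \<omega>"] in eventually_elim)
          case (elim t)
          have "0 \<le> D r \<omega>" using D_nonneg r \<open>\<omega> \<in> space M\<close> by simp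
          moreover have "r < first_passage D t \<omega> \<longleftrightarrow> D r \<omega> \<le> t"
            using elim less_first_passage_imp[OF r] less_first_passageI[OF \<open>\<omega> \<in> space M\<close> \<open>unbounded_path \<omega>\<close> r, of t]
            by (auto simp: order_le_less)
          ultimately show ?case by (auto simp: K_def Ep es_def indicator_def mult.commute)
        qed
        also have "\<dots> = ea r * (\<integral>\<^sup>+t. ennreal (indicator {D r \<omega>..} t * exp (- s * t)) \<partial>lborel)"
          by (rule nn_integral_cmult) measurable
        also have "(\<integral>\<^sup>+t. ennreal (indicator {D r \<omega>..} t * exp (- s * t)) \<partial>lborel) = ennreal (exp (- s * D r \<omega>) / s)"
          using exp_has_laplace[OF s D_nonneg[OF \<open>\<omega> \<in> space M\<close> r]]
          by (subst nn_integral_eq_integral) (auto simp: has_bochner_integral_iff)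
        also have "ea r * ennreal (exp (- s * D r \<omega>) / s) = ennreal (a * exp (- a * r) / s) * ennreal (exp (- s * D r \<omega>))"
          using r a s by (simp add: ea_def ennreal_mult[symmetric])
        finally show ?case .
      qed
      also have "\<dots> = ennreal (a * exp (- a * r) / s) * (\<integral>\<^sup>+\<omega>. ennreal (exp (- s * D r \<omega>)) \<partial>M)"
        by (rule nn_integral_cmult) measurable
      also have "(\<integral>\<^sup>+\<omega>. ennreal (exp (- s * D r \<omega>)) \<partial>M) = ennreal (exp (- r * laplace_exponent s))"
        using laplace_D[of s r] s r by (subst nn_integral_eq_integral) (auto simp: has_bochner_integral_iff)
      also have "ennreal (a * exp (- a * r) / s) * \<dots> = ennreal (a / s * (exp (- a * r) * exp (- r * laplace_exponent s)))"
        using a s by (simp add: ennreal_mult[symmetric])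
      also have "exp (- a * r) * exp (- r * laplace_exponent s) = exp (- (a + laplace_exponent s) * r)"
        by (simp add: exp_add[symmetric] algebra_simps)
      finally show ?thesis using r by simp
    qed
  qed
  also have "\<dots> = ennreal (a / s * (exp (- (a + laplace_exponent s) * 0) / (a + laplace_exponent s)))"
  proof (subst nn_integral_eq_integral)
    have H: "has_bochner_integral lborel (\<lambda>r. a / s * (indicator {0..} r * exp (- (a + laplace_exponent s) * r)))
      (a / s * (exp (- (a + laplace_exponent s) * 0) / (a + laplace_exponent s)))"
      using a e by (intro has_bochner_integral_mult_right exp_has_laplace) auto
    show "integrable lborel (\<lambda>r. a / s * (indicator {0..} r * exp (- (a + laplace_exponent s) * r)))"
      using H by (simp add: has_bochner_integral_iff)
    show "ennreal (\<integral>r. a / s * (indicator {0..} r * exp (- (a + laplace_exponent s) * r)) \<partial>lborel) =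
       ennreal (a / s * (exp (- (a + laplace_exponent s) * 0) / (a + laplace_exponent s)))"
      using H by (simp only: has_bochner_integral_iff)
  qed (use a s in auto)
  finally show "(\<integral>\<^sup>+t. ennreal (indicator {0..} t * (exp (- s * t) * passage_transform a t)) \<partial>lborel)
     = ennreal (a / (s * (a + laplace_exponent s)))" by simp
qed

text \<open>Both sides are right continuous and have the same Laplace transform for large \<open>s\<close>.\<close>

theorem first_passage_laplace:
  assumes \<beta>: "0 < \<beta>" and \<nu>: "0 < \<nu>" and a: "0 < a" and t: "0 \<le> t"
  shows "expectation (\<lambda>\<omega>. exp (- a * first_passage D t \<omega>)) = 1 - a * tempered_series \<beta> \<nu> (\<nu> powr \<beta> - a) t"
proof -
  let ?w = "\<nu> powr \<beta> - a"
  obtain \<sigma> where \<sigma>1: "\<nu> < \<sigma>" and w: "\<bar>?w\<bar> < \<sigma> powr \<beta>"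
    using powr_exceeds[OF \<beta>, of \<nu> ?w] \<nu> by auto
  with \<nu> have \<sigma>: "\<nu> < \<sigma>" "0 < \<sigma>" by auto
  define H where "H = (\<lambda>t. passage_transform a t - a * tempered_series \<beta> \<nu> ?w t)"
  have "H t = 0"
  proof (rule laplace_unique[of H "\<sigma> + 1", OF _ _ t])
    fix t :: real assume t: "0 \<le> t"
    have "continuous (at t within {0..}) (tempered_series \<beta> \<nu> ?w)"
      using tempered_series_laplace(1)[OF \<beta> \<nu> \<sigma>(1) w, of \<sigma>] \<nu> t by (auto simp: continuous_on_eq_continuous_within)
    then have "continuous (at_right t) (tempered_series \<beta> \<nu> ?w)"
      by (rule continuous_within_subset) (use t in auto)
    then show "continuous (at_right t) H"
      unfolding H_def using a by (intro continuous_intros passage_transform_right_continuous[OF \<beta> \<nu>]) auto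
  next
    fix k :: nat
    let ?s = "\<sigma> + 1 + real k"
    have s: "0 < ?s" "\<sigma> < ?s + \<nu>" using \<sigma> \<nu> by auto
    have "has_bochner_integral lborel
      (\<lambda>t. indicator {0..} t * (exp (- ?s * t) * passage_transform a t) - a * (indicator {0..} t * (exp (- ?s * t) * tempered_series \<beta> \<nu> ?w t)))
      (a / (?s * (a + laplace_exponent ?s)) - a * (1 / (?s * ((?s + \<nu>) powr \<beta> - ?w))))"
      using passage_transform_laplace[OF \<beta> \<nu> a s(1)] tempered_series_laplace(2)[OF \<beta> \<nu> \<sigma>(1) w s(2)]
      unfolding has_laplace_def by (intro has_bochner_integral_diff has_bochner_integral_mult_right)
    moreover have "a / (?s * (a + laplace_exponent ?s)) - a * (1 / (?s * ((?s + \<nu>) powr \<beta> - ?w))) = 0"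
      by (simp add: laplace_exponent_def algebra_simps)
    moreover have "indicator {0..} t * (exp (- ?s * t) * passage_transform a t) - a * (indicator {0..} t * (exp (- ?s * t) * tempered_series \<beta> \<nu> ?w t))
      = (indicator {0..} t * (exp (- ?s * t) * H t) :: real)" for t
      by (simp add: H_def algebra_simps)
    ultimately show "has_laplace H ?s 0"
      unfolding has_laplace_def by (simp only:)
  qed
  moreover have "integrable M (\<lambda>\<omega>. exp (- a * first_passage D t \<omega>))"
    using a by (intro exp_passage_integrable) simp
  then have "passage_transform a t = 1 - expectation (\<lambda>\<omega>. exp (- a * first_passage D t \<omega>))"
    by (simp add: passage_transform_def prob_space)
  ultimately show ?thesis by (simp add: H_def)
qed

end

section \<open>Counting paths and their Stieltjes measures\<close>

definition reached :: "(real \<Rightarrow> nat) \<Rightarrow> nat \<Rightarrow> bool" where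
  "reached n k \<longleftrightarrow> 1 \<le> k \<and> (\<exists>t\<ge>0. k \<le> n t)"

definition jump_time :: "(real \<Rightarrow> nat) \<Rightarrow> nat \<Rightarrow> real" where
  "jump_time n k = Inf {t. 0 \<le> t \<and> k \<le> n t}"

lemma counting_path_mono: "counting_path n \<Longrightarrow> 0 \<le> s \<Longrightarrow> s \<le> t \<Longrightarrow> n s \<le> n t"
  by (auto simp: counting_path_def mono_on_def)

lemma counting_path_eventually_const:
  assumes "counting_path n" "0 \<le> t"
  shows "\<exists>d>t. \<forall>u. t \<le> u \<and> u < d \<longrightarrow> n u = n t"
proof -
  have "((\<lambda>u. real (n u)) \<longlongrightarrow> real (n t)) (at_right t)"
    using assms by (simp add: counting_path_def continuous_within)
  then have "eventually (\<lambda>u. dist (real (n u)) (real (n t)) < 1) (at_right t)"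
    by (rule tendstoD) simp
  then obtain d where "t < d" "\<And>u. t < u \<Longrightarrow> u < d \<Longrightarrow> dist (real (n u)) (real (n t)) < 1"
    unfolding eventually_at_right_field by blast
  then show ?thesis
    by (intro exI[of _ d]) (force simp: dist_real_def order_le_less)
qed

text \<open>The infimum in the jump time is attained because a right continuous integer path is constant
  to the right of every time.\<close>

lemma le_counting_path_iff:
  assumes n: "counting_path n" and t: "0 \<le> t" and k: "1 \<le> k"
  shows "k \<le> n t \<longleftrightarrow> reached n k \<and> jump_time n k \<le> t"
proof
  assume "k \<le> n t"
  then show "reached n k \<and> jump_time n k \<le> t"
    using t k by (auto simp: reached_def jump_time_def intro!: cInf_lower bdd_belowI[of _ 0])
next
  assume r: "reached n k \<and> jump_time n k \<le> t"
  define S where "S = {t. 0 \<le> t \<and> k \<le> n t}"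
  have ne: "S \<noteq> {}" using r by (auto simp: S_def reached_def)
  have T0: "0 \<le> Inf S" using ne by (intro cInf_greatest) (auto simp: S_def)
  obtain d where d: "Inf S < d" "\<And>u. Inf S \<le> u \<Longrightarrow> u < d \<Longrightarrow> n u = n (Inf S)"
    using counting_path_eventually_const[OF n T0] by blast
  obtain s where s: "s \<in> S" "s < d" using cInf_lessD[OF ne d(1)] by blast
  have "Inf S \<le> s" using s by (intro cInf_lower) (auto simp: S_def intro: bdd_belowI[of _ 0])
  then have "k \<le> n (Inf S)" using d(2)[of s] s by (auto simp: S_def)
  also have "\<dots> \<le> n t" using r T0 by (intro counting_path_mono[OF n]) (auto simp: jump_time_def S_def)
  finally show "k \<le> n t" .
qed

lemma jump_time_nonneg: "reached n k \<Longrightarrow> 0 \<le> jump_time n k"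
  unfolding jump_time_def reached_def by (intro cInf_greatest) auto

text \<open>Jumps of height at most one make the path take every value, so just before the \<open>k\<close>-th
  jump it equals \<open>k - 1\<close>.\<close>

lemma at_jump_time:
  assumes n: "counting_path n" and k: "reached n k"
  shows "0 < jump_time n k" and "n (jump_time n k) = k"
    and "\<exists>s. 0 \<le> s \<and> s < jump_time n k \<and> (\<forall>q. s \<le> q \<and> q < jump_time n k \<longrightarrow> n q = k - 1)"
proof -
  let ?T = "jump_time n k"
  have k1: "1 \<le> k" using k by (simp add: reached_def)
  have T0: "0 \<le> ?T" by (rule jump_time_nonneg[OF k])
  have ge: "k \<le> n ?T" using le_counting_path_iff[OF n T0 k1] k by simp
  then show T: "0 < ?T" using T0 k1 n by (cases "?T = 0") (auto simp: counting_path_def)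
  have lt: "n q < k" if "0 \<le> q" "q < ?T" for q
    using le_counting_path_iff[OF n that(1) k1] that by auto
  obtain s where s: "0 \<le> s" "s < ?T" "n ?T \<le> n s + 1"
    using n T unfolding counting_path_def by (metis atLeastLessThan_iff)
  show "n ?T = k" using ge s lt[of s] by simp
  have "n q = k - 1" if "s \<le> q" "q < ?T" for q
    using lt[of q] counting_path_mono[OF n s(1) that(1)] that s ge by simp
  then show "\<exists>s. 0 \<le> s \<and> s < ?T \<and> (\<forall>q. s \<le> q \<and> q < ?T \<longrightarrow> n q = k - 1)"
    using s by blast
qed

lemma between_jump_times:
  assumes n: "counting_path n" and u: "0 < u" and "\<And>k. reached n k \<Longrightarrow> jump_time n k \<noteq> u"
  shows "\<exists>s. 0 \<le> s \<and> s < u \<and> (\<forall>q. s \<le> q \<and> q < u \<longrightarrow> n q = n u)"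
proof (cases "n u = 0")
  case True
  then show ?thesis using counting_path_mono[OF n, of _ u] u by (intro exI[of _ 0]) auto
next
  case False
  then have r: "reached n (n u)" "jump_time n (n u) \<le> u"
    using le_counting_path_iff[OF n, of u "n u"] u by auto
  have "n q = n u" if "jump_time n (n u) \<le> q" "q < u" for q
    using at_jump_time(2)[OF n r(1)] counting_path_mono[OF n jump_time_nonneg[OF r(1)] that(1)]
      counting_path_mono[OF n, of q u] that jump_time_nonneg[OF r(1)] by simp
  then show ?thesis
    using r assms(3)[OF r(1)] jump_time_nonneg[OF r(1)] by (intro exI[of _ "jump_time n (n u)"]) auto
qed

lemma suminf_jumps_upto:
  fixes g :: "nat \<Rightarrow> ennreal"
  assumes n: "counting_path n" and t: "0 \<le> t"
  shows "(\<Sum>k. if reached n k \<and> jump_time n k \<le> t then g k else 0) = (\<Sum>k=1..n t. g k)"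
proof -
  have iff: "reached n k \<and> jump_time n k \<le> t \<longleftrightarrow> k \<in> {1..n t}" for k
    using le_counting_path_iff[OF n t, of k] by (cases "1 \<le> k") (auto simp: reached_def)
  have "(\<Sum>k. if reached n k \<and> jump_time n k \<le> t then g k else 0)
     = (\<Sum>k=1..n t. if reached n k \<and> jump_time n k \<le> t then g k else 0)"
    by (rule suminf_finite) (auto simp: iff)
  also have "\<dots> = (\<Sum>k=1..n t. g k)"
    by (intro sum.cong) (auto simp: iff)
  finally show ?thesis .
qed

lemma nn_integral_jump_measure:
  fixes f :: "real \<Rightarrow> ennreal" and T :: "nat \<Rightarrow> real"
  assumes f: "f \<in> borel_measurable borel"
  shows "(\<integral>\<^sup>+u. f u \<partial>distr (density (count_space UNIV) w) borel T) = (\<Sum>k. w k * f (T k))"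
proof -
  have "(\<integral>\<^sup>+u. f u \<partial>distr (density (count_space UNIV) w) borel T)
      = (\<integral>\<^sup>+k. f (T k) \<partial>density (count_space UNIV) w)"
    using f by (intro nn_integral_distr) auto
  also have "\<dots> = (\<integral>\<^sup>+k. w k * f (T k) \<partial>count_space UNIV)"
    by (intro nn_integral_density) auto
  finally show ?thesis by (simp add: nn_integral_count_space_nat)
qed

text \<open>Both measures give an interval \<open>(a, b]\<close> the total weight of the jumps in it.\<close>

lemma stieltjes_jump_path:
  fixes x :: "nat \<Rightarrow> real"
  assumes n: "counting_path n" and x: "\<And>k. 1 \<le> k \<Longrightarrow> 0 \<le> x k"
  shows "stieltjes (\<lambda>u. \<Sum>i=1..n u. x i) =
    distr (density (count_space UNIV) (\<lambda>k. if reached n k then ennreal (x k) else 0)) borel (jump_time n)"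
    (is "?S = ?R")
proof -
  define G where "G = (\<lambda>u. \<Sum>i=1..n (max 0 u). x i)"
  have S: "?S = interval_measure G" by (simp add: stieltjes_def G_def)
  have monoG: "G a \<le> G b" if "a \<le> b" for a b
    using counting_path_mono[OF n, of "max 0 a" "max 0 b"] that x
    unfolding G_def by (intro sum_mono2) auto
  have contG: "continuous (at_right a) G" for a
  proof -
    obtain d where d: "max 0 a < d" "\<And>u. max 0 a \<le> u \<Longrightarrow> u < d \<Longrightarrow> n u = n (max 0 a)"
      using counting_path_eventually_const[OF n, of "max 0 a"] by auto
    have "eventually (\<lambda>u. G u = G a) (at_right a)"
    proof (rule eventually_mono)
      show "eventually (\<lambda>u. u \<in> {a<..<d}) (at_right a)"
        using d(1) by (intro eventually_at_right_real) simp
      fix u assume "u \<in> {a<..<d}"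
      then have "max 0 a \<le> max 0 u" "max 0 u < d" using d(1) by auto
      then show "G u = G a" using d(2) by (simp add: G_def)
    qed
    then show ?thesis
      unfolding continuous_within by (rule tendsto_eventually)
  qed
  have eS: "emeasure ?S {a<..b} = (if a \<le> b then ennreal (G b - G a) else 0)" for a b
    unfolding S using emeasure_interval_measure_Ioc_eq[of G a b, OF monoG contG] by simp
  have eR: "emeasure ?R {a<..b} = ennreal (G b - G a)" if ab: "a \<le> b" for a b
  proof -
    have "emeasure ?R {a<..b} = (\<integral>\<^sup>+u. indicator {a<..b} u \<partial>?R)" by simp
    also have "\<dots> = (\<Sum>k. (if reached n k then ennreal (x k) else 0) * indicator {a<..b} (jump_time n k))"
      by (rule nn_integral_jump_measure) simp
    also have "\<dots> = (\<Sum>k. if reached n k \<and> jump_time n k \<le> max 0 b then (if max 0 a < jump_time n k then ennreal (x k) else 0) else 0)"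
    proof (rule suminf_cong)
      fix k
      show "(if reached n k then ennreal (x k) else 0) * indicator {a<..b} (jump_time n k) =
        (if reached n k \<and> jump_time n k \<le> max 0 b then (if max 0 a < jump_time n k then ennreal (x k) else 0) else 0)"
      proof (cases "reached n k")
        case True
        then have "jump_time n k \<in> {a<..b} \<longleftrightarrow> jump_time n k \<le> max 0 b \<and> max 0 a < jump_time n k"
          using at_jump_time(1)[OF n True] by auto
        then show ?thesis using True by (simp add: indicator_def)
      qed simp
    qed
    also have "\<dots> = (\<Sum>k=1..n (max 0 b). if max 0 a < jump_time n k then ennreal (x k) else 0)"
      by (rule suminf_jumps_upto[OF n]) simp
    also have "\<dots> = (\<Sum>k\<in>{1..n (max 0 b)} - {1..n (max 0 a)}. ennreal (x k))"
    proof (rule sum.mono_neutral_cong_right)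
      have "max 0 a < jump_time n k \<longleftrightarrow> k \<notin> {1..n (max 0 a)}" if "k \<in> {1..n (max 0 b)}" for k
        using le_counting_path_iff[OF n, of "max 0 a" k] le_counting_path_iff[OF n, of "max 0 b" k] that by auto
      then show "\<forall>i\<in>{1..n (max 0 b)} - ({1..n (max 0 b)} - {1..n (max 0 a)}). (if max 0 a < jump_time n i then ennreal (x i) else 0) = 0"
        "\<And>k. k \<in> {1..n (max 0 b)} - {1..n (max 0 a)} \<Longrightarrow> (if max 0 a < jump_time n k then ennreal (x k) else 0) = ennreal (x k)"
        by auto
    qed auto
    also have "\<dots> = ennreal (\<Sum>k\<in>{1..n (max 0 b)} - {1..n (max 0 a)}. x k)"
      by (rule sum_ennreal) (use x in auto)
    also have "(\<Sum>k\<in>{1..n (max 0 b)} - {1..n (max 0 a)}. x k) = G b - G a"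
      unfolding G_def using counting_path_mono[OF n, of "max 0 a" "max 0 b"] ab
      by (subst sum_diff) auto
    finally show ?thesis .
  qed
  show ?thesis
  proof (rule measure_eqI_generator_eq[where \<Omega>=UNIV])
    fix X assume "X \<in> range (\<lambda>(a, b). {a<..b::real})"
    then obtain a b where X: "X = {a<..b}" by auto
    show "emeasure ?S X = emeasure ?R X"
    proof (cases "a \<le> b")
      case True
      then show ?thesis unfolding X eR[OF True] eS by simp
    qed (simp add: X)
  next
    show "(\<Union>i. {- real (i::nat)<..real i}) = UNIV" by (rule UN_Ioc_eq_UNIV)
  next
    show "sets ?S = sigma_sets UNIV (range (\<lambda>(a, b). {a<..b::real}))"
      unfolding S by (simp add: borel_sigma_sets_Ioc)
    show "sets ?R = sigma_sets UNIV (range (\<lambda>(a, b). {a<..b::real}))"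
      by (simp add: borel_sigma_sets_Ioc)
  next
    show "emeasure ?S {- real i<..real i} \<noteq> \<infinity>" for i :: nat
      unfolding eS by simp
  qed (auto simp: Int_stable_def)
qed

lemma nn_integral_stieltjes_jump_path:
  fixes x :: "nat \<Rightarrow> real" and f :: "real \<Rightarrow> ennreal"
  assumes n: "counting_path n" and x: "\<And>k. 1 \<le> k \<Longrightarrow> 0 \<le> x k" and f: "f \<in> borel_measurable borel"
  shows "(\<integral>\<^sup>+u. f u \<partial>stieltjes (\<lambda>u. \<Sum>i=1..n u. x i)) =
     (\<Sum>k. if reached n k then ennreal (x k) * f (jump_time n k) else 0)"
proof -
  have S: "stieltjes (\<lambda>u. \<Sum>i=1..n u. x i) =
    distr (density (count_space UNIV) (\<lambda>k. if reached n k then ennreal (x k) else 0)) borel (jump_time n)"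
    by (rule stieltjes_jump_path[OF n x])
  show ?thesis
    unfolding S nn_integral_jump_measure[OF f] by (intro suminf_cong) auto
qed

lemma set_integral_stieltjes_jump_path:
  fixes x :: "nat \<Rightarrow> real" and f :: "real \<Rightarrow> real"
  assumes n: "counting_path n" and x: "\<And>k. 1 \<le> k \<Longrightarrow> 0 \<le> x k"
    and f: "f \<in> borel_measurable borel" "\<And>u. 0 \<le> f u" and t: "0 \<le> t"
  shows "(LINT u:{0<..t}|stieltjes (\<lambda>u. \<Sum>i=1..n u. x i). f u) = (\<Sum>k=1..n t. x k * f (jump_time n k))"
proof -
  let ?S = "stieltjes (\<lambda>u. \<Sum>i=1..n u. x i)"
  have S: "sets ?S = sets borel" by (simp add: stieltjes_def)
  have fm: "(\<lambda>u. indicator {0<..t} u *\<^sub>R f u) \<in> borel_measurable borel"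
    using f(1) by measurable
  have "(LINT u:{0<..t}|?S. f u) = enn2real (\<integral>\<^sup>+u. ennreal (indicator {0<..t} u *\<^sub>R f u) \<partial>?S)"
    unfolding set_lebesgue_integral_def
  proof (rule integral_eq_nn_integral)
    show "(\<lambda>u. indicator {0<..t} u *\<^sub>R f u) \<in> borel_measurable ?S"
      using fm measurable_cong_sets[OF S refl] by blast
  qed (simp add: f(2))
  also have "(\<integral>\<^sup>+u. ennreal (indicator {0<..t} u *\<^sub>R f u) \<partial>?S)
     = (\<Sum>k. if reached n k then ennreal (x k) * ennreal (indicator {0<..t} (jump_time n k) *\<^sub>R f (jump_time n k)) else 0)"
    using fm by (intro nn_integral_stieltjes_jump_path[OF n x]) auto
  also have "\<dots> = (\<Sum>k. if reached n k \<and> jump_time n k \<le> t then ennreal (x k * f (jump_time n k)) else 0)"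
    using at_jump_time(1)[OF n] x f(2)
    by (intro suminf_cong) (auto simp: indicator_def ennreal_mult reached_def)
  also have "\<dots> = (\<Sum>k=1..n t. ennreal (x k * f (jump_time n k)))"
    by (rule suminf_jumps_upto[OF n t])
  also have "\<dots> = ennreal (\<Sum>k=1..n t. x k * f (jump_time n k))"
    using x f(2) by (intro sum_ennreal) auto
  also have "enn2real \<dots> = (\<Sum>k=1..n t. x k * f (jump_time n k))"
    using x f(2) by (intro enn2real_ennreal sum_nonneg) auto
  finally show ?thesis .
qed

section \<open>Compensation of the marked jumps\<close>

text \<open>Independence makes the joint law a product, and Fubini applies. The two spaces differ because
  the lemma serves for a random time and the whole history.\<close>

lemma (in prob_space) nn_integral_independent:
  fixes \<phi> :: "'b \<times> 'c \<Rightarrow> ennreal"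
  assumes X: "X \<in> M \<rightarrow>\<^sub>M S" and Y: "Y \<in> M \<rightarrow>\<^sub>M T"
    and indep: "\<And>E G. E \<in> sets S \<Longrightarrow> G \<in> sets T \<Longrightarrow>
      prob ((X -` E \<inter> space M) \<inter> (Y -` G \<inter> space M)) = prob (X -` E \<inter> space M) * prob (Y -` G \<inter> space M)"
    and \<phi>: "\<phi> \<in> borel_measurable (S \<Otimes>\<^sub>M T)"
  shows "(\<integral>\<^sup>+\<omega>. \<phi> (X \<omega>, Y \<omega>) \<partial>M) = (\<integral>\<^sup>+\<omega>'. (\<integral>\<^sup>+\<omega>. \<phi> (X \<omega>', Y \<omega>) \<partial>M) \<partial>M)"
proof -
  interpret DX: prob_space "distr M S X" using X by (rule prob_space_distr)
  interpret DY: prob_space "distr M T Y" using Y by (rule prob_space_distr)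
  have joint: "distr M S X \<Otimes>\<^sub>M distr M T Y = distr M (S \<Otimes>\<^sub>M T) (\<lambda>\<omega>. (X \<omega>, Y \<omega>))"
  proof (rule pair_measure_eqI)
    fix E G assume EG: "E \<in> sets (distr M S X)" "G \<in> sets (distr M T Y)"
    then have "emeasure (distr M S X) E * emeasure (distr M T Y) G
       = ennreal (prob (X -` E \<inter> space M) * prob (Y -` G \<inter> space M))"
      using X Y by (simp add: emeasure_distr emeasure_eq_measure ennreal_mult)
    also have "\<dots> = ennreal (prob ((X -` E \<inter> space M) \<inter> (Y -` G \<inter> space M)))"
      using indep EG by simp
    also have "(X -` E \<inter> space M) \<inter> (Y -` G \<inter> space M) = (\<lambda>\<omega>. (X \<omega>, Y \<omega>)) -` (E \<times> G) \<inter> space M" by auto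
    also have "ennreal (prob \<dots>) = emeasure (distr M (S \<Otimes>\<^sub>M T) (\<lambda>\<omega>. (X \<omega>, Y \<omega>))) (E \<times> G)"
      using X Y EG by (subst emeasure_distr) (auto simp: emeasure_eq_measure)
    finally show "emeasure (distr M S X) E * emeasure (distr M T Y) G
       = emeasure (distr M (S \<Otimes>\<^sub>M T) (\<lambda>\<omega>. (X \<omega>, Y \<omega>))) (E \<times> G)" .
  qed (unfold_locales, simp cong: sets_pair_measure_cong)
  have "(\<integral>\<^sup>+\<omega>. \<phi> (X \<omega>, Y \<omega>) \<partial>M) = (\<integral>\<^sup>+z. \<phi> z \<partial>(distr M S X \<Otimes>\<^sub>M distr M T Y))"
    unfolding joint using X Y \<phi> by (subst nn_integral_distr) auto
  also have "\<dots> = (\<integral>\<^sup>+x. (\<integral>\<^sup>+y. \<phi> (x, y) \<partial>distr M T Y) \<partial>distr M S X)"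
    by (rule DY.nn_integral_fst[symmetric]) (simp add: \<phi> cong: measurable_cong_sets)
  also have "\<dots> = (\<integral>\<^sup>+\<omega>'. (\<integral>\<^sup>+y. \<phi> (X \<omega>', y) \<partial>distr M T Y) \<partial>M)"
    using X \<phi> by (intro nn_integral_distr DY.borel_measurable_nn_integral) (simp_all add: case_prod_unfold cong: measurable_cong_sets)
  also have "\<dots> = (\<integral>\<^sup>+\<omega>'. (\<integral>\<^sup>+\<omega>. \<phi> (X \<omega>', Y \<omega>) \<partial>M) \<partial>M)"
    using \<phi> Y measurable_space[OF X] by (intro nn_integral_cong nn_integral_distr) auto
  finally show ?thesis .
qed

context hawkes_process
begin

abbreviation jumped :: "nat \<Rightarrow> 'a \<Rightarrow> bool" where
  "jumped k \<omega> \<equiv> reached (\<lambda>t. N t \<omega>) k"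

abbreviation jump :: "nat \<Rightarrow> 'a \<Rightarrow> real" where
  "jump k \<omega> \<equiv> jump_time (\<lambda>t. N t \<omega>) k"

abbreviation predictable :: "(real \<times> 'a) measure" where
  "predictable \<equiv> predictable_algebra M F"

lemma sets_F_subset: "A \<in> sets (F t) \<Longrightarrow> A \<subseteq> space M"
  using sets.sets_into_space[of A "F t"] space_F[of t] by simp

lemma sets_F_M: "A \<in> sets (F t) \<Longrightarrow> A \<in> sets M"
  using subalgebra_F[of t] by (auto simp: subalgebra_def)

lemma predictable_generators:
  "{{s<..t} \<times> A | s t A. 0 \<le> s \<and> s \<le> t \<and> A \<in> sets (F s)} \<subseteq> Pow ({0<..} \<times> space M)"
  using sets_F_subset by force

lemma space_predictable: "space predictable = {0<..} \<times> space M"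
  unfolding predictable_algebra_def by (rule space_measure_of[OF predictable_generators])

lemma predictable_generator:
  assumes "0 \<le> s" "s \<le> t" "A \<in> sets (F s)" shows "{s<..t} \<times> A \<in> sets predictable"
  unfolding predictable_algebra_def sets_measure_of[OF predictable_generators]
  using assms by (intro sigma_sets.Basic) blast

lemma predictable_ray:
  assumes "0 \<le> s" "A \<in> sets (F s)" shows "{s<..} \<times> A \<in> sets predictable"
proof -
  have "{s<..} \<times> A = (\<Union>n::nat. {s<..s + real n} \<times> A)"
  proof (intro set_eqI iffI)
    fix x assume x: "x \<in> {s<..} \<times> A"
    obtain n :: nat where "fst x - s \<le> real n" using real_arch_simple by blast
    then show "x \<in> (\<Union>n::nat. {s<..s + real n} \<times> A)"
      using x by (intro UN_I[of n]) (auto simp: mem_Times_iff)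
  qed auto
  also have "\<dots> \<in> sets predictable"
    using assms by (intro sets.countable_UN image_subsetI predictable_generator) auto
  finally show ?thesis .
qed

lemma measurable_fst_predictable [measurable]: "fst \<in> predictable \<rightarrow>\<^sub>M borel"
proof (rule borel_measurableI_greater)
  fix y :: real
  have "space M \<in> sets (F (max 0 y))" using space_F[of "max 0 y"] sets.top[of "F (max 0 y)"] by simp
  then have "{max 0 y<..} \<times> space M \<in> sets predictable" by (intro predictable_ray) auto
  also have "{max 0 y<..} \<times> space M = {x \<in> space predictable. y < fst x}"
    by (auto simp: space_predictable)
  finally show "{x \<in> space predictable. y < fst x} \<in> sets predictable" .
qed

text \<open>Rectangles over half lines generate these functions; countable suprema of them will give
  left limits.\<close>

lemma predictable_after:
  fixes Y :: "'a \<Rightarrow> ennreal"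
  assumes s: "0 \<le> s" and Y: "Y \<in> borel_measurable (F s)"
  shows "(\<lambda>x. if s < fst x then Y (snd x) else 0) \<in> borel_measurable predictable"
proof (rule borel_measurableI_greater)
  fix y :: ennreal
  have "{\<omega> \<in> space (F s). y < Y \<omega>} \<in> sets (F s)" using Y by measurable
  then have "{s<..} \<times> {\<omega> \<in> space (F s). y < Y \<omega>} \<in> sets predictable" using s by (intro predictable_ray)
  also have "{s<..} \<times> {\<omega> \<in> space (F s). y < Y \<omega>} = {x \<in> space predictable. y < (if s < fst x then Y (snd x) else 0)}"
    using s by (auto simp: space_predictable space_F split: if_splits)
  finally show "{x \<in> space predictable. y < (if s < fst x then Y (snd x) else 0)} \<in> sets predictable" .
qed

lemma predictable_initial:
  fixes Y :: "'a \<Rightarrow> ennreal"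
  assumes Y: "Y \<in> borel_measurable (F 0)"
  shows "(\<lambda>x. Y (snd x)) \<in> borel_measurable predictable"
  using predictable_after[OF order_refl Y]
  by (rule measurable_cong[THEN iffD1, rotated]) (auto simp: space_predictable)

lemma predictable_section:
  assumes \<omega>: "\<omega> \<in> space M"
  shows "(\<lambda>u. (u, \<omega>)) \<in> restrict_space borel {0<..} \<rightarrow>\<^sub>M predictable"
  unfolding predictable_algebra_def
proof (rule measurable_measure_of[OF predictable_generators])
  show "(\<lambda>u. (u, \<omega>)) \<in> space (restrict_space borel {0<..}) \<rightarrow> {0<..} \<times> space M"
    using \<omega> by (auto simp: space_restrict_space)
  fix y assume "y \<in> {{s<..t} \<times> A | s t A. 0 \<le> s \<and> s \<le> t \<and> A \<in> sets (F s)}"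
  then obtain s t A where y: "y = {s<..t} \<times> A" "0 \<le> s" by blast
  then have "(\<lambda>u. (u, \<omega>)) -` y \<inter> space (restrict_space borel {0<..}) = (if \<omega> \<in> A then {s<..t} else {})"
    by (auto simp: space_restrict_space)
  moreover have "(if \<omega> \<in> A then {s<..t} else {}) \<in> sets (restrict_space borel {0<..})"
    using y by (auto simp: sets_restrict_space_iff)
  ultimately show "(\<lambda>u. (u, \<omega>)) -` y \<inter> space (restrict_space borel {0<..}) \<in> sets (restrict_space borel {0<..})"
    by simp
qed

lemma strict_past_generators:
  "sets (F 0) \<union> {A \<inter> {\<omega>\<in>space M. N t \<omega> < n} | t A. 0 \<le> t \<and> A \<in> sets (F t)} \<subseteq> Pow (space M)"
  using sets_F_subset by blast

abbreviation past :: "nat \<Rightarrow> 'a measure" where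
  "past n \<equiv> sigma (space M) (strict_past M F N n)"

lemma strict_past_Pow: "strict_past M F N n \<subseteq> Pow (space M)"
  unfolding strict_past_def using sigma_sets_into_sp[OF strict_past_generators] by blast

lemma space_past: "space (past n) = space M"
  by (rule space_measure_of[OF strict_past_Pow])

lemma sets_past: "sets (past n) = strict_past M F N n"
  unfolding sets_measure_of[OF strict_past_Pow] unfolding strict_past_def
  by (rule sigma_sets_sigma_sets_eq[OF strict_past_generators])

lemma strict_past_events:
  assumes "1 \<le> n" shows "strict_past M F N n \<subseteq> sets M"
proof -
  have "indep_set (strict_past M F N n) (sets (vimage_algebra (space M) (\<xi> n) borel))"
    by (rule marks_unpredictable[OF assms])
  then show ?thesis by (rule indep_setD_ev1)
qed

lemma before_in_past:
  assumes "0 \<le> t" "A \<in> sets (F t)" shows "A \<inter> {\<omega>\<in>space M. N t \<omega> < n} \<in> sets (past n)"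
proof -
  have "A \<inter> {\<omega>\<in>space M. N t \<omega> < n} \<in> strict_past M F N n"
    unfolding strict_past_def using assms by (intro sigma_sets.Basic) blast
  then show ?thesis by (simp only: sets_past)
qed

lemma space_in_F: "space M \<in> sets (F t)"
  using space_F[of t] sets.top[of "F t"] by simp

lemma less_iff_jump:
  assumes "\<omega> \<in> space M" "0 \<le> t" "1 \<le> k"
  shows "N t \<omega> < k \<longleftrightarrow> \<not> (jumped k \<omega> \<and> jump k \<omega> \<le> t)"
  using le_counting_path_iff[OF N_counting[OF assms(1)] assms(2,3)] by auto

lemma jumped_in_past: "1 \<le> k \<Longrightarrow> {\<omega>\<in>space M. jumped k \<omega>} \<in> sets (past k)"
proof -
  assume k: "1 \<le> k"
  have "{\<omega>\<in>space M. jumped k \<omega>} = space (past k) - (\<Inter>n::nat. space M \<inter> {\<omega>\<in>space M. N (real n) \<omega> < k})"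
  proof (intro set_eqI iffI)
    fix \<omega> assume \<omega>: "\<omega> \<in> {\<omega>\<in>space M. jumped k \<omega>}"
    obtain n :: nat where "jump k \<omega> \<le> real n" using real_arch_simple by blast
    then show "\<omega> \<in> space (past k) - (\<Inter>n::nat. space M \<inter> {\<omega>\<in>space M. N (real n) \<omega> < k})"
      using \<omega> less_iff_jump[of \<omega> "real n" k] k by (auto simp: space_past)
  next
    fix \<omega> assume \<omega>: "\<omega> \<in> space (past k) - (\<Inter>n::nat. space M \<inter> {\<omega>\<in>space M. N (real n) \<omega> < k})"
    then show "\<omega> \<in> {\<omega>\<in>space M. jumped k \<omega>}"
      using less_iff_jump[of \<omega> _ k] k by (auto simp: space_past)
  qed
  also have "\<dots> \<in> sets (past k)"
    using before_in_past[OF _ space_in_F] by (intro sets.Diff sets.top sets.countable_INT) auto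
  finally show ?thesis .
qed

text \<open>The jump falls into \<open>(s, t]\<close> exactly if \<open>N s < k\<close> but not \<open>N t < k\<close>, and these are the
  events that generate the strict past.\<close>

lemma jump_predictable:
  assumes k: "1 \<le> k"
  shows "(\<lambda>\<omega>. (jump k \<omega>, \<omega>)) \<in> restrict_space (past k) {\<omega>. jumped k \<omega>} \<rightarrow>\<^sub>M predictable"
  unfolding predictable_algebra_def
proof (rule measurable_measure_of[OF predictable_generators])
  let ?R = "restrict_space (past k) {\<omega>. jumped k \<omega>}"
  have sp: "space ?R = {\<omega>\<in>space M. jumped k \<omega>}" by (auto simp: space_restrict_space space_past)
  show "(\<lambda>\<omega>. (jump k \<omega>, \<omega>)) \<in> space ?R \<rightarrow> {0<..} \<times> space M"
    using at_jump_time(1)[OF N_counting] by (auto simp: sp)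
  fix y assume "y \<in> {{s<..t} \<times> A | s t A. 0 \<le> s \<and> s \<le> t \<and> A \<in> sets (F s)}"
  then obtain s t A where y: "y = {s<..t} \<times> A" "0 \<le> s" "s \<le> t" "A \<in> sets (F s)" by blast
  have At: "A \<in> sets (F t)" using sets_F_mono[OF y(3)] y(4) by blast
  have Asp: "A \<subseteq> space M" by (rule sets_F_subset[OF At])
  have *: "(\<lambda>\<omega>. (jump k \<omega>, \<omega>)) -` y \<inter> space ?R
     = (A \<inter> {\<omega>\<in>space M. N s \<omega> < k}) - (A \<inter> {\<omega>\<in>space M. N t \<omega> < k})"
  proof (intro set_eqI)
    fix \<omega>
    show "\<omega> \<in> (\<lambda>\<omega>. (jump k \<omega>, \<omega>)) -` y \<inter> space ?R \<longleftrightarrow> \<omega> \<in> (A \<inter> {\<omega>\<in>space M. N s \<omega> < k}) - (A \<inter> {\<omega>\<in>space M. N t \<omega> < k})"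
    proof (cases "\<omega> \<in> A")
      case True
      then show ?thesis
        using less_iff_jump[of \<omega> s k] less_iff_jump[of \<omega> t k] k y(2,3) Asp
        by (auto simp: sp y(1))
    qed (auto simp: y(1))
  qed
  have "(A \<inter> {\<omega>\<in>space M. N s \<omega> < k}) - (A \<inter> {\<omega>\<in>space M. N t \<omega> < k}) \<in> sets (past k)"
    using y At by (intro sets.Diff before_in_past) auto
  moreover have "{\<omega>. jumped k \<omega>} \<inter> space (past k) \<in> sets (past k)"
    using jumped_in_past[OF k] by (simp add: space_past Collect_conj_eq Int_commute)
  ultimately show "(\<lambda>\<omega>. (jump k \<omega>, \<omega>)) -` y \<inter> space ?R \<in> sets ?R"
    using * by (subst sets_restrict_space_iff) (auto simp: sp space_past)
qed

lemma predictable_at_jump: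
  fixes C :: "real \<times> 'a \<Rightarrow> ennreal"
  assumes k: "1 \<le> k" and C: "C \<in> borel_measurable predictable"
  shows "(\<lambda>\<omega>. if jumped k \<omega> then C (jump k \<omega>, \<omega>) else 0) \<in> borel_measurable (past k)"
proof -
  have "{\<omega>. jumped k \<omega>} \<inter> space (past k) \<in> sets (past k)"
    using jumped_in_past[OF k] by (simp add: space_past Collect_conj_eq Int_commute)
  then have "(\<lambda>\<omega>. C (jump k \<omega>, \<omega>) * indicator {\<omega>. jumped k \<omega>} \<omega>) \<in> borel_measurable (past k)"
    using measurable_compose[OF jump_predictable[OF k] C]
    by (subst borel_measurable_restrict_space_iff_ennreal[symmetric]) auto
  then show ?thesis
    by (rule measurable_cong[THEN iffD1, rotated]) (auto simp: indicator_def)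
qed

lemma mark_measurable: "1 \<le> k \<Longrightarrow> \<xi> k \<in> borel_measurable M"
  using marks_indep by (auto simp: indep_vars_def)

text \<open>The value of a predictable process at the \<open>k\<close>-th jump belongs to the strict past, of which
  the mark is independent.\<close>

lemma expectation_at_jump_mark:
  fixes C :: "real \<times> 'a \<Rightarrow> ennreal" and g :: "real \<Rightarrow> ennreal"
  assumes k: "1 \<le> k" and C: "C \<in> borel_measurable predictable" and g: "g \<in> borel_measurable borel"
  shows "(\<integral>\<^sup>+\<omega>. (if jumped k \<omega> then C (jump k \<omega>, \<omega>) * g (\<xi> k \<omega>) else 0) \<partial>M)
    = (\<integral>\<^sup>+\<omega>. g (\<xi> 1 \<omega>) \<partial>M) * (\<integral>\<^sup>+\<omega>. (if jumped k \<omega> then C (jump k \<omega>, \<omega>) else 0) \<partial>M)"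
proof -
  let ?H = "\<lambda>\<omega>. if jumped k \<omega> then C (jump k \<omega>, \<omega>) else 0"
  have H: "?H \<in> borel_measurable (past k)" by (rule predictable_at_jump[OF k C])
  have \<xi>: "\<xi> k \<in> borel_measurable M" and \<xi>1: "\<xi> 1 \<in> borel_measurable M" using k by (auto intro: mark_measurable)
  have HM: "?H \<in> borel_measurable M"
    using H strict_past_events[OF k]
    by (intro measurableI) (auto simp: space_past sets_past dest!: measurable_sets)
  have "(\<integral>\<^sup>+\<omega>. ?H \<omega> * g (\<xi> k \<omega>) \<partial>M) = (\<integral>\<^sup>+\<omega>'. (\<integral>\<^sup>+\<omega>. ?H \<omega>' * g (\<xi> k \<omega>) \<partial>M) \<partial>M)"
  proof -
    have \<phi>: "(\<lambda>x. fst x * g (snd x)) \<in> borel_measurable (borel \<Otimes>\<^sub>M borel)" using g by measurable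
    show ?thesis
    proof (rule nn_integral_independent[OF HM \<xi> _ \<phi>, simplified])
      fix E :: "ennreal set" and G :: "real set" assume E: "E \<in> sets borel" and G: "G \<in> sets borel"
      have "?H -` E \<inter> space M \<in> strict_past M F N k"
        using measurable_sets[OF H E] by (simp add: space_past sets_past)
      moreover have "\<xi> k -` G \<inter> space M \<in> sets (vimage_algebra (space M) (\<xi> k) borel)"
        using G by (rule in_vimage_algebra)
      ultimately show "prob (?H -` E \<inter> space M \<inter> (\<xi> k -` G \<inter> space M)) = prob (?H -` E \<inter> space M) * prob (\<xi> k -` G \<inter> space M)"
        by (rule indep_setD[OF marks_unpredictable[OF k]])
    qed
  qed
  also have "\<dots> = (\<integral>\<^sup>+\<omega>'. ?H \<omega>' * (\<integral>\<^sup>+\<omega>. g (\<xi> k \<omega>) \<partial>M) \<partial>M)"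
    by (intro nn_integral_cong nn_integral_cmult measurable_compose[OF \<xi> g])
  also have "\<dots> = (\<integral>\<^sup>+\<omega>. ?H \<omega> \<partial>M) * (\<integral>\<^sup>+\<omega>. g (\<xi> k \<omega>) \<partial>M)"
    by (rule nn_integral_multc[OF HM])
  also have "(\<integral>\<^sup>+\<omega>. g (\<xi> k \<omega>) \<partial>M) = (\<integral>\<^sup>+x. g x \<partial>distr M borel (\<xi> k))"
    using \<xi> g by (intro nn_integral_distr[symmetric]) auto
  also have "\<dots> = (\<integral>\<^sup>+\<omega>. g (\<xi> 1 \<omega>) \<partial>M)"
    unfolding marks_ident[OF k] using \<xi>1 g by (intro nn_integral_distr) auto
  finally have "(\<integral>\<^sup>+\<omega>. ?H \<omega> * g (\<xi> k \<omega>) \<partial>M) = (\<integral>\<^sup>+\<omega>. g (\<xi> 1 \<omega>) \<partial>M) * (\<integral>\<^sup>+\<omega>. ?H \<omega> \<partial>M)"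
    by (simp only: mult.commute)
  moreover have "(\<integral>\<^sup>+\<omega>. (if jumped k \<omega> then C (jump k \<omega>, \<omega>) * g (\<xi> k \<omega>) else 0) \<partial>M)
      = (\<integral>\<^sup>+\<omega>. ?H \<omega> * g (\<xi> k \<omega>) \<partial>M)"
    by (intro nn_integral_cong) simp
  ultimately show ?thesis by (simp only:)
qed

text \<open>The defining property of the intensity, with the Stieltjes integral written as a sum over the
  jumps.\<close>

lemma compensator:
  fixes C :: "real \<times> 'a \<Rightarrow> ennreal"
  assumes C: "C \<in> borel_measurable predictable"
  shows "(\<integral>\<^sup>+\<omega>. (\<Sum>k. if jumped k \<omega> then C (jump k \<omega>, \<omega>) else 0) \<partial>M)
    = (\<integral>\<^sup>+\<omega>. (\<integral>\<^sup>+u\<in>{0<..}. C (u, \<omega>) * ennreal (lam u \<omega>) \<partial>lborel) \<partial>M)"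
proof -
  have "(\<integral>\<^sup>+\<omega>. (\<Sum>k. if jumped k \<omega> then C (jump k \<omega>, \<omega>) else 0) \<partial>M)
    = (\<integral>\<^sup>+\<omega>. (\<integral>\<^sup>+u\<in>{0<..}. C (u, \<omega>) \<partial>stieltjes (\<lambda>u. real (N u \<omega>))) \<partial>M)"
  proof (rule nn_integral_cong)
    fix \<omega> assume \<omega>: "\<omega> \<in> space M"
    have f: "(\<lambda>u. C (u, \<omega>) * indicator {0<..} u) \<in> borel_measurable borel"
      using measurable_compose[OF predictable_section[OF \<omega>] C]
      by (subst borel_measurable_restrict_space_iff_ennreal[symmetric]) auto
    have one: "(\<lambda>u. real (N u \<omega>)) = (\<lambda>u. \<Sum>i=1..N u \<omega>. 1)" by simp
    have "(\<integral>\<^sup>+u\<in>{0<..}. C (u, \<omega>) \<partial>stieltjes (\<lambda>u. real (N u \<omega>)))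
      = (\<Sum>k. if jumped k \<omega> then ennreal 1 * (C (jump k \<omega>, \<omega>) * indicator {0<..} (jump k \<omega>)) else 0)"
      unfolding one by (rule nn_integral_stieltjes_jump_path[OF N_counting[OF \<omega>] _ f]) simp
    also have "\<dots> = (\<Sum>k. if jumped k \<omega> then C (jump k \<omega>, \<omega>) else 0)"
      using at_jump_time(1)[OF N_counting[OF \<omega>]] by (intro suminf_cong) auto
    finally show "(\<Sum>k. if jumped k \<omega> then C (jump k \<omega>, \<omega>) else 0)
       = (\<integral>\<^sup>+u\<in>{0<..}. C (u, \<omega>) \<partial>stieltjes (\<lambda>u. real (N u \<omega>)))" ..
  qed
  also have "\<dots> = (\<integral>\<^sup>+\<omega>. (\<integral>\<^sup>+u\<in>{0<..}. C (u, \<omega>) * ennreal (lam u \<omega>) \<partial>lborel) \<partial>M)"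
    using intensity C unfolding stochastic_intensity_def by blast
  finally show ?thesis .
qed

lemma marked_jump_measurable:
  fixes C :: "real \<times> 'a \<Rightarrow> ennreal" and g :: "real \<Rightarrow> ennreal"
  assumes C: "C \<in> borel_measurable predictable" and g: "g \<in> borel_measurable borel"
  shows "(\<lambda>\<omega>. if jumped k \<omega> then C (jump k \<omega>, \<omega>) else 0) \<in> borel_measurable M"
    and "(\<lambda>\<omega>. if jumped k \<omega> then C (jump k \<omega>, \<omega>) * g (\<xi> k \<omega>) else 0) \<in> borel_measurable M"
proof -
  have past_M: "f \<in> borel_measurable M" if "1 \<le> k" "f \<in> borel_measurable (past k)" for f :: "'a \<Rightarrow> ennreal" and k
    using that(2) strict_past_events[OF that(1)]
    by (intro measurableI) (auto simp: space_past sets_past dest!: measurable_sets)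
  show Hm: "(\<lambda>\<omega>. if jumped k \<omega> then C (jump k \<omega>, \<omega>) else 0) \<in> borel_measurable M"
  proof (cases "1 \<le> k")
    case True
    show ?thesis by (rule past_M[OF True predictable_at_jump[OF True C]])
  qed (simp add: reached_def)
  show Gm: "(\<lambda>\<omega>. if jumped k \<omega> then C (jump k \<omega>, \<omega>) * g (\<xi> k \<omega>) else 0) \<in> borel_measurable M"
  proof (cases "1 \<le> k")
    case True
    have "(\<lambda>\<omega>. (if jumped k \<omega> then C (jump k \<omega>, \<omega>) else 0) * g (\<xi> k \<omega>)) \<in> borel_measurable M"
      using Hm mark_measurable[OF True] g by (intro borel_measurable_times_ennreal) auto
    then show ?thesis
      by (rule measurable_cong[THEN iffD1, rotated]) auto
  qed (simp add: reached_def)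
qed

lemma marked_compensator:
  fixes C :: "real \<times> 'a \<Rightarrow> ennreal" and g :: "real \<Rightarrow> ennreal"
  assumes C: "C \<in> borel_measurable predictable" and g: "g \<in> borel_measurable borel"
  shows "(\<integral>\<^sup>+\<omega>. (\<Sum>k. if jumped k \<omega> then C (jump k \<omega>, \<omega>) * g (\<xi> k \<omega>) else 0) \<partial>M)
    = (\<integral>\<^sup>+\<omega>. g (\<xi> 1 \<omega>) \<partial>M) * (\<integral>\<^sup>+\<omega>. (\<integral>\<^sup>+u\<in>{0<..}. C (u, \<omega>) * ennreal (lam u \<omega>) \<partial>lborel) \<partial>M)"
proof -
  note Hm = marked_jump_measurable(1)[OF C g] and Gm = marked_jump_measurable(2)[OF C g]
  have k: "(\<integral>\<^sup>+\<omega>. (if jumped k \<omega> then C (jump k \<omega>, \<omega>) * g (\<xi> k \<omega>) else 0) \<partial>M)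
    = (\<integral>\<^sup>+\<omega>. g (\<xi> 1 \<omega>) \<partial>M) * (\<integral>\<^sup>+\<omega>. (if jumped k \<omega> then C (jump k \<omega>, \<omega>) else 0) \<partial>M)" for k
    using expectation_at_jump_mark[OF _ C g, of k] by (cases "1 \<le> k") (auto simp: reached_def)
  have "(\<integral>\<^sup>+\<omega>. (\<Sum>k. if jumped k \<omega> then C (jump k \<omega>, \<omega>) * g (\<xi> k \<omega>) else 0) \<partial>M)
     = (\<Sum>k. (\<integral>\<^sup>+\<omega>. g (\<xi> 1 \<omega>) \<partial>M) * (\<integral>\<^sup>+\<omega>. (if jumped k \<omega> then C (jump k \<omega>, \<omega>) else 0) \<partial>M))"
    unfolding k[symmetric] by (rule nn_integral_suminf[OF Gm])
  also have "\<dots> = (\<integral>\<^sup>+\<omega>. g (\<xi> 1 \<omega>) \<partial>M) * (\<Sum>k. \<integral>\<^sup>+\<omega>. (if jumped k \<omega> then C (jump k \<omega>, \<omega>) else 0) \<partial>M)"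
    by (rule ennreal_suminf_cmult)
  also have "(\<Sum>k. \<integral>\<^sup>+\<omega>. (if jumped k \<omega> then C (jump k \<omega>, \<omega>) else 0) \<partial>M)
    = (\<integral>\<^sup>+\<omega>. (\<Sum>k. if jumped k \<omega> then C (jump k \<omega>, \<omega>) else 0) \<partial>M)"
    by (rule nn_integral_suminf[OF Hm, symmetric])
  finally show ?thesis unfolding compensator[OF C] .
qed

end

section \<open>Pure jump form of the intensity\<close>

context hawkes_process
begin

lemma lam_nonneg: "0 \<le> t \<Longrightarrow> \<omega> \<in> space M \<Longrightarrow> 0 \<le> lam t \<omega>"
  using intensity by (simp add: stochastic_intensity_def)

lemma lam_progressive:
  "0 \<le> t \<Longrightarrow> (\<lambda>(u, \<omega>). lam u \<omega>) \<in> borel_measurable (restrict_space borel {0..t} \<Otimes>\<^sub>M F t)"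
  using intensity by (simp add: stochastic_intensity_def)

lemma lam_adapted:
  assumes t: "0 \<le> t" shows "lam t \<in> borel_measurable (F t)"
proof -
  have "(\<lambda>\<omega>. (t, \<omega>)) \<in> F t \<rightarrow>\<^sub>M restrict_space borel {0..t} \<Otimes>\<^sub>M F t"
    using t by (intro measurable_Pair1') (simp add: space_restrict_space)
  from measurable_compose[OF this lam_progressive[OF t]] show ?thesis by simp
qed

definition history_algebra :: "'a measure" where
  "history_algebra = sigma (space M) (\<Union>t\<in>{0..}. sets (F t))"

lemma history_generators: "(\<Union>t\<in>{0..}. sets (F t)) \<subseteq> Pow (space M)"
  using sets_F_subset by blast

lemma space_history_algebra: "space history_algebra = space M"
  unfolding history_algebra_def by (rule space_measure_of[OF history_generators])

lemma sets_history_algebra: "sets history_algebra = history M F"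
  unfolding history_algebra_def history_def by (rule sets_measure_of[OF history_generators])

lemma F_in_history: "0 \<le> t \<Longrightarrow> A \<in> sets (F t) \<Longrightarrow> A \<in> sets history_algebra"
  unfolding sets_history_algebra history_def by (intro sigma_sets.Basic) auto

lemma history_events: "A \<in> sets history_algebra \<Longrightarrow> A \<in> sets M"
  using sets.sigma_sets_subset[of "\<Union>t\<in>{0..}. sets (F t)" M] sets_F_M
  unfolding sets_history_algebra history_def by blast

text \<open>Progressive measurability is local in time; the intervals \<open>[0, n]\<close> are glued together.\<close>

lemma lam_history_measurable:
  "(\<lambda>x. lam (max 0 (fst x)) (snd x)) \<in> borel_measurable (borel \<Otimes>\<^sub>M history_algebra)"
proof (rule measurable_piecewise_restrict[where C="range (\<lambda>n::nat. {x. max 0 (fst x) \<le> real n})"])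
  let ?P = "borel \<Otimes>\<^sub>M history_algebra :: (real \<times> 'a) measure"
  show "space ?P \<subseteq> \<Union> (range (\<lambda>n::nat. {x. max 0 (fst x) \<le> real n}))"
    using real_arch_simple by blast
  fix \<Omega> assume "\<Omega> \<in> range (\<lambda>n::nat. {x :: real \<times> 'a. max 0 (fst x) \<le> real n})"
  then obtain n :: nat where \<Omega>: "\<Omega> = {x. max 0 (fst x) \<le> real n}" by blast
  have "{x \<in> space ?P. max 0 (fst x) \<le> real n} \<in> sets ?P" by measurable
  then show "\<Omega> \<inter> space ?P \<in> sets ?P" by (simp add: \<Omega> Collect_conj_eq Int_commute)
  let ?R = "restrict_space ?P \<Omega>"
  have 1: "(\<lambda>x. max 0 (fst x)) \<in> ?R \<rightarrow>\<^sub>M restrict_space borel {0..real n}"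
    by (intro measurable_restrict_space2 measurable_restrict_space1) (auto simp: space_restrict_space \<Omega>)
  have "(\<lambda>x. x) \<in> history_algebra \<rightarrow>\<^sub>M F (real n)"
    by (rule measurableI) (auto simp: space_history_algebra space_F Int_absorb2 sets_F_subset intro!: F_in_history[of "real n"])
  then have 2: "snd \<in> ?R \<rightarrow>\<^sub>M F (real n)"
    by (intro measurable_restrict_space1 measurable_compose[OF measurable_snd])
  show "(\<lambda>x. lam (max 0 (fst x)) (snd x)) \<in> borel_measurable ?R"
    using measurable_compose[OF measurable_Pair[OF 1 2] lam_progressive] by simp
qed simp

lemma history_measurable_id: "(\<lambda>x. x) \<in> M \<rightarrow>\<^sub>M history_algebra"
  by (rule measurableI)
    (auto simp: space_history_algebra history_events Int_absorb2 dest!: history_events sets.sets_into_space)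

lemma lam_jointly_measurable:
  "(\<lambda>x. lam (max 0 (fst x)) (snd x)) \<in> borel_measurable (borel \<Otimes>\<^sub>M M)"
proof -
  from history_measurable_id have "(\<lambda>x. (fst x, snd x)) \<in> borel \<Otimes>\<^sub>M M \<rightarrow>\<^sub>M (borel :: real measure) \<Otimes>\<^sub>M history_algebra"
    by (intro measurable_Pair measurable_compose[OF measurable_snd] measurable_fst)
  from measurable_compose[OF this lam_history_measurable] show ?thesis by simp
qed

text \<open>The process \<open>Z\<close>: it increases by \<open>jump_size\<close> at each jump and is constant in between. The
  final summand \<open>\<theta>\<close> makes it start at \<open>\<lambda>\<^sub>0\<close>, hence nonnegative.\<close>

definition accum :: "real \<Rightarrow> 'a \<Rightarrow> real" where
  "accum t \<omega> = exp (\<kappa> * t) * (lam t \<omega> - \<theta>) + \<theta>"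

definition jump_size :: "nat \<Rightarrow> 'a \<Rightarrow> real" where
  "jump_size k \<omega> = \<eta> * exp (\<kappa> * jump k \<omega>) * \<xi> k \<omega>"

definition accum_after :: "nat \<Rightarrow> 'a \<Rightarrow> real" where
  "accum_after j \<omega> = lam 0 \<omega> + (\<Sum>i=1..j. jump_size i \<omega>)"

lemma jump_size_pos: "1 \<le> k \<Longrightarrow> \<omega> \<in> space M \<Longrightarrow> 0 < jump_size k \<omega>"
  using marks_pos eta_pos by (simp add: jump_size_def)

lemma accum_after_mono:
  assumes "\<omega> \<in> space M" "i \<le> j" shows "accum_after i \<omega> \<le> accum_after j \<omega>"
  unfolding accum_after_def
  using assms jump_size_pos[OF _ assms(1)]
  by (intro add_left_mono sum_mono2) (auto intro: less_imp_le)

lemma accum_after_nonneg: "\<omega> \<in> space M \<Longrightarrow> 0 \<le> accum_after j \<omega>"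
  using accum_after_mono[of \<omega> 0 j] lam_nonneg[of 0 \<omega>] by (simp add: accum_after_def)

lemma accum_after_Suc: "1 \<le> k \<Longrightarrow> accum_after k \<omega> = accum_after (k - 1) \<omega> + jump_size k \<omega>"
  by (cases k) (auto simp: accum_after_def)

text \<open>The dynamics with starting time \<open>0\<close>, multiplied by \<open>e\<^sup>\<kappa>\<^sup>t\<close>.\<close>

lemma accum_eq:
  assumes \<omega>: "\<omega> \<in> space M" and t: "0 \<le> t"
  shows "accum t \<omega> = accum_after (N t \<omega>) \<omega>"
proof -
  have "(LINT u:{0<..t}|stieltjes (\<lambda>u. marked_sum N \<xi> u \<omega>). exp (- \<kappa> * (t - u)))
     = (\<Sum>k=1..N t \<omega>. \<xi> k \<omega> * exp (- \<kappa> * (t - jump k \<omega>)))"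
    unfolding marked_sum_def
    using marks_pos \<omega>
    by (intro set_integral_stieltjes_jump_path N_counting[OF \<omega>] t) (auto intro: less_imp_le)
  then have "lam t \<omega> = \<theta> + exp (- \<kappa> * t) * (lam 0 \<omega> - \<theta>) + \<eta> * (\<Sum>k=1..N t \<omega>. \<xi> k \<omega> * exp (- \<kappa> * (t - jump k \<omega>)))"
    using dynamics[OF order_refl t \<omega>] by simp
  then have "lam t \<omega> - \<theta> = exp (- \<kappa> * t) * (lam 0 \<omega> - \<theta>) + \<eta> * (\<Sum>k=1..N t \<omega>. \<xi> k \<omega> * exp (- \<kappa> * (t - jump k \<omega>)))"
    by simp
  then have "accum t \<omega> = exp (\<kappa> * t) * (exp (- \<kappa> * t) * (lam 0 \<omega> - \<theta>)) + exp (\<kappa> * t) * (\<eta> * (\<Sum>k=1..N t \<omega>. \<xi> k \<omega> * exp (- \<kappa> * (t - jump k \<omega>)))) + \<theta>"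
    by (simp only: accum_def distrib_left)
  also have "exp (\<kappa> * t) * (exp (- \<kappa> * t) * (lam 0 \<omega> - \<theta>)) = lam 0 \<omega> - \<theta>"
    by (simp add: mult.assoc[symmetric] exp_add[symmetric])
  also have "exp (\<kappa> * t) * (\<eta> * (\<Sum>k=1..N t \<omega>. \<xi> k \<omega> * exp (- \<kappa> * (t - jump k \<omega>)))) = (\<Sum>k=1..N t \<omega>. jump_size k \<omega>)"
    unfolding sum_distrib_left
  proof (rule sum.cong[OF refl])
    fix k
    have "exp (\<kappa> * t) * exp (- \<kappa> * (t - jump k \<omega>)) = exp (\<kappa> * jump k \<omega>)"
      by (simp add: exp_add[symmetric] algebra_simps)
    then show "exp (\<kappa> * t) * (\<eta> * (\<xi> k \<omega> * exp (- \<kappa> * (t - jump k \<omega>)))) = jump_size k \<omega>"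
      unfolding jump_size_def by (metis mult.assoc mult.commute)
  qed
  finally show ?thesis by (simp add: accum_after_def)
qed

lemma accum_nonneg: "\<omega> \<in> space M \<Longrightarrow> 0 \<le> t \<Longrightarrow> 0 \<le> accum t \<omega>"
  by (simp add: accum_eq accum_after_nonneg)

lemma exp_lam_eq: "exp (\<kappa> * t) * lam t \<omega> = accum t \<omega> + \<theta> * (exp (\<kappa> * t) - 1)"
  by (simp add: accum_def algebra_simps)

lemma lam_le_accum:
  assumes "\<omega> \<in> space M" "0 \<le> t" shows "lam t \<omega> \<le> \<theta> + accum t \<omega>"
proof -
  have "lam t \<omega> = exp (- \<kappa> * t) * (exp (\<kappa> * t) * lam t \<omega>)"
    by (simp add: mult.assoc[symmetric] exp_add[symmetric])
  also have "\<dots> = exp (- \<kappa> * t) * accum t \<omega> + \<theta> * (1 - exp (- \<kappa> * t))"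
    unfolding exp_lam_eq by (simp add: algebra_simps mult.assoc[symmetric] exp_add[symmetric])
  also have "\<dots> \<le> 1 * accum t \<omega> + \<theta> * 1"
    using accum_nonneg[OF assms] theta_nonneg kappa_pos assms(2)
    by (intro add_mono mult_right_mono mult_left_mono) auto
  finally show ?thesis by simp
qed

text \<open>For the increasing process \<open>Z\<close> this supremum is the left limit; a supremum over countably
  many times is visibly predictable.\<close>

definition accum_left :: "real \<times> 'a \<Rightarrow> ennreal" where
  "accum_left x = (SUP q\<in>{q\<in>\<rat>. 0 \<le> q}. if q < fst x then ennreal (accum q (snd x)) else 0)"

lemma accum_left_predictable: "accum_left \<in> borel_measurable predictable"
  unfolding accum_left_def
proof (rule borel_measurable_SUP)
  show "countable {q\<in>\<rat>. (0::real) \<le> q}" using countable_rat by (rule countable_subset[rotated]) auto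
  fix q :: real assume "q \<in> {q\<in>\<rat>. 0 \<le> q}"
  then have q: "0 \<le> q" by simp
  have [measurable]: "lam q \<in> borel_measurable (F q)" by (rule lam_adapted[OF q])
  have "(\<lambda>\<omega>. ennreal (accum q \<omega>)) \<in> borel_measurable (F q)"
    unfolding accum_def by measurable
  from predictable_after[OF q this]
  show "(\<lambda>x. if q < fst x then ennreal (accum q (snd x)) else 0) \<in> borel_measurable predictable" .
qed

lemma accum_left_eq:
  assumes \<omega>: "\<omega> \<in> space M" and s: "0 \<le> s" "s < u" and j: "\<And>q. s \<le> q \<Longrightarrow> q < u \<Longrightarrow> N q \<omega> = j"
  shows "accum_left (u, \<omega>) = ennreal (accum_after j \<omega>)"
proof (rule antisym)
  show "accum_left (u, \<omega>) \<le> ennreal (accum_after j \<omega>)"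
    unfolding accum_left_def
  proof (rule SUP_least)
    fix q :: real assume "q \<in> {q\<in>\<rat>. 0 \<le> q}"
    then have q: "0 \<le> q" by simp
    show "(if q < fst (u, \<omega>) then ennreal (accum q (snd (u, \<omega>))) else 0) \<le> ennreal (accum_after j \<omega>)"
    proof (cases "q < u")
      case True
      have "N q \<omega> \<le> N (max q s) \<omega>" using q by (intro counting_path_mono[OF N_counting[OF \<omega>]]) auto
      also have "\<dots> = j" using True s by (intro j) auto
      finally show ?thesis
        using True accum_after_mono[OF \<omega>] by (simp add: accum_eq[OF \<omega> q] ennreal_leI)
    qed simp
  qed
  obtain q where q: "q \<in> \<rat>" "s < q" "q < u" using Rats_dense_in_real[OF s(2)] by blast
  show "ennreal (accum_after j \<omega>) \<le> accum_left (u, \<omega>)"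
    unfolding accum_left_def
    using q s j[of q] accum_eq[OF \<omega>, of q] by (intro SUP_upper2[of q]) auto
qed

lemma accum_left_at_jump:
  assumes "\<omega> \<in> space M" "jumped k \<omega>"
  shows "accum_left (jump k \<omega>, \<omega>) = ennreal (accum_after (k - 1) \<omega>)"
  using at_jump_time(3)[OF N_counting[OF assms(1)] assms(2)] accum_left_eq[OF assms(1)] by metis

text \<open>Only the countably many jump times are exceptional, so in integrals over time the left limit
  may be replaced by the process itself.\<close>

lemma accum_left_AE:
  assumes \<omega>: "\<omega> \<in> space M"
  shows "AE u in lborel. 0 < u \<longrightarrow> accum_left (u, \<omega>) = ennreal (accum u \<omega>)"
proof -
  have "countable ((\<lambda>k. jump k \<omega>) ` {k. jumped k \<omega>})" by (intro countable_image) simp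
  then have "AE u in lborel. u \<notin> (\<lambda>k. jump k \<omega>) ` {k. jumped k \<omega>}"
    by (intro AE_not_in countable_imp_null_set_lborel)
  then show ?thesis
  proof eventually_elim
    case (elim u)
    show ?case
    proof
      assume u: "0 < u"
      obtain s where "0 \<le> s" "s < u" "\<And>q. s \<le> q \<Longrightarrow> q < u \<Longrightarrow> N q \<omega> = N u \<omega>"
        using between_jump_times[OF N_counting[OF \<omega>] u] elim by blast
      from accum_left_eq[OF \<omega> this] show "accum_left (u, \<omega>) = ennreal (accum u \<omega>)"
        using accum_eq[OF \<omega>, of u] u by simp
    qed
  qed
qed

lemma accum_jointly_measurable:
  "(\<lambda>x. accum (max 0 (fst x)) (snd x)) \<in> borel_measurable (borel \<Otimes>\<^sub>M M)"
  unfolding accum_def using lam_jointly_measurable by measurable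

lemma state_predictable:
  fixes h :: "real \<times> real \<Rightarrow> ennreal"
  assumes h: "h \<in> borel_measurable (borel \<Otimes>\<^sub>M borel)"
  shows "(\<lambda>x. h (fst x, enn2real (accum_left x))) \<in> borel_measurable predictable"
proof (rule measurable_compose[OF _ h])
  show "(\<lambda>x. (fst x, enn2real (accum_left x))) \<in> predictable \<rightarrow>\<^sub>M borel \<Otimes>\<^sub>M borel"
    using accum_left_predictable by measurable
qed

lemma state_jump_sum_measurable:
  fixes h :: "real \<times> real \<Rightarrow> ennreal" and g :: "real \<Rightarrow> ennreal"
  assumes h: "h \<in> borel_measurable (borel \<Otimes>\<^sub>M borel)" and g: "g \<in> borel_measurable borel"
  shows "(\<lambda>\<omega>. \<Sum>k. if jumped k \<omega> then h (jump k \<omega>, accum_after (k - 1) \<omega>) * g (\<xi> k \<omega>) else 0) \<in> borel_measurable M"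
proof -
  have "(\<lambda>\<omega>. \<Sum>k. if jumped k \<omega> then h (fst (jump k \<omega>, \<omega>), enn2real (accum_left (jump k \<omega>, \<omega>))) * g (\<xi> k \<omega>) else 0) \<in> borel_measurable M"
    by (intro borel_measurable_suminf_order marked_jump_measurable(2)[OF state_predictable[OF h] g])
  then show ?thesis
  proof (rule measurable_cong[THEN iffD1, rotated])
    fix \<omega> assume \<omega>: "\<omega> \<in> space M"
    show "(\<Sum>k. if jumped k \<omega> then h (fst (jump k \<omega>, \<omega>), enn2real (accum_left (jump k \<omega>, \<omega>))) * g (\<xi> k \<omega>) else 0)
      = (\<Sum>k. if jumped k \<omega> then h (jump k \<omega>, accum_after (k - 1) \<omega>) * g (\<xi> k \<omega>) else 0)"
      using accum_left_at_jump[OF \<omega>] accum_after_nonneg[OF \<omega>] by (intro suminf_cong) auto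
  qed
qed

lemma state_integrand_measurable:
  fixes h :: "real \<times> real \<Rightarrow> ennreal"
  assumes A: "A \<in> sets (F 0)" and h: "h \<in> borel_measurable (borel \<Otimes>\<^sub>M borel)"
  shows "(\<lambda>x. indicator {0<..} (fst x) * (indicator A (snd x) * (h (fst x, accum (max 0 (fst x)) (snd x)) * ennreal (lam (max 0 (fst x)) (snd x)))))
       \<in> borel_measurable (borel \<Otimes>\<^sub>M M)"
proof -
  have [measurable]: "A \<in> sets M" by (rule sets_F_M[OF A])
  note [measurable] = lam_jointly_measurable accum_jointly_measurable
  have "(\<lambda>x. (fst x, accum (max 0 (fst x)) (snd x))) \<in> borel \<Otimes>\<^sub>M M \<rightarrow>\<^sub>M borel \<Otimes>\<^sub>M borel"
    by measurable
  from measurable_compose[OF this h]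
  have [measurable]: "(\<lambda>x. h (fst x, accum (max 0 (fst x)) (snd x))) \<in> borel_measurable (borel \<Otimes>\<^sub>M M)" by simp
  show ?thesis by measurable
qed

lemma state_integral_measurable:
  fixes h :: "real \<times> real \<Rightarrow> ennreal"
  assumes A: "A \<in> sets (F 0)" and h: "h \<in> borel_measurable (borel \<Otimes>\<^sub>M borel)"
  shows "(\<lambda>u. (\<integral>\<^sup>+\<omega>\<in>A. h (u, accum u \<omega>) * ennreal (lam u \<omega>) \<partial>M) * indicator {0<..} u) \<in> borel_measurable borel"
proof -
  have "(\<lambda>u. (\<integral>\<^sup>+\<omega>. indicator {0<..} u * (indicator A \<omega> * (h (u, accum (max 0 u) \<omega>) * ennreal (lam (max 0 u) \<omega>))) \<partial>M)) \<in> borel_measurable borel"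
    using state_integrand_measurable[OF A h]
    by (intro borel_measurable_nn_integral) (simp add: case_prod_unfold)
  also have "(\<lambda>u. (\<integral>\<^sup>+\<omega>. indicator {0<..} u * (indicator A \<omega> * (h (u, accum (max 0 u) \<omega>) * ennreal (lam (max 0 u) \<omega>))) \<partial>M))
     = (\<lambda>u. (\<integral>\<^sup>+\<omega>\<in>A. h (u, accum u \<omega>) * ennreal (lam u \<omega>) \<partial>M) * indicator {0<..} u)"
  proof (rule ext)
    fix u :: real
    show "(\<integral>\<^sup>+\<omega>. indicator {0<..} u * (indicator A \<omega> * (h (u, accum (max 0 u) \<omega>) * ennreal (lam (max 0 u) \<omega>))) \<partial>M)
      = (\<integral>\<^sup>+\<omega>\<in>A. h (u, accum u \<omega>) * ennreal (lam u \<omega>) \<partial>M) * indicator {0<..} u"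
      by (cases "0 < u") (simp_all add: max_def mult_ac)
  qed
  finally show ?thesis .
qed

text \<open>The predictable process \<open>h(u, Z(u-))\<close> is compensated. On the right, \<open>Z(u-)\<close> has become
  \<open>Z\<^sub>u\<close> and expectation and time integral have been exchanged.\<close>

lemma state_compensator:
  fixes h :: "real \<times> real \<Rightarrow> ennreal" and g :: "real \<Rightarrow> ennreal"
  assumes A: "A \<in> sets (F 0)" and h: "h \<in> borel_measurable (borel \<Otimes>\<^sub>M borel)" and g: "g \<in> borel_measurable borel"
  shows "(\<integral>\<^sup>+\<omega>\<in>A. (\<Sum>k. if jumped k \<omega> then h (jump k \<omega>, accum_after (k - 1) \<omega>) * g (\<xi> k \<omega>) else 0) \<partial>M)
    = (\<integral>\<^sup>+\<omega>. g (\<xi> 1 \<omega>) \<partial>M) * (\<integral>\<^sup>+u\<in>{0<..}. (\<integral>\<^sup>+\<omega>\<in>A. h (u, accum u \<omega>) * ennreal (lam u \<omega>) \<partial>M) \<partial>lborel)"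
proof -
  interpret L: pair_sigma_finite lborel M ..
  \<comment> \<open>The left limit is a finite number wherever it is evaluated, so it may be read as a real.\<close>
  define C where "C = (\<lambda>x. indicator A (snd x) * h (fst x, enn2real (accum_left x)))"
  have [measurable]: "A \<in> sets M" by (rule sets_F_M[OF A])
  have "(\<lambda>x. indicator A (snd x) :: ennreal) \<in> borel_measurable predictable"
    using A by (intro predictable_initial) simp
  then have C: "C \<in> borel_measurable predictable"
    unfolding C_def by (intro borel_measurable_times_ennreal state_predictable[OF h])
  have "(\<integral>\<^sup>+\<omega>\<in>A. (\<Sum>k. if jumped k \<omega> then h (jump k \<omega>, accum_after (k - 1) \<omega>) * g (\<xi> k \<omega>) else 0) \<partial>M)
    = (\<integral>\<^sup>+\<omega>. (\<Sum>k. if jumped k \<omega> then C (jump k \<omega>, \<omega>) * g (\<xi> k \<omega>) else 0) \<partial>M)"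
  proof (rule nn_integral_cong)
    fix \<omega> assume \<omega>: "\<omega> \<in> space M"
    have "(\<Sum>k. if jumped k \<omega> then C (jump k \<omega>, \<omega>) * g (\<xi> k \<omega>) else 0)
       = (\<Sum>k. indicator A \<omega> * (if jumped k \<omega> then h (jump k \<omega>, accum_after (k - 1) \<omega>) * g (\<xi> k \<omega>) else 0))"
      using accum_left_at_jump[OF \<omega>] accum_after_nonneg[OF \<omega>]
      by (intro suminf_cong) (auto simp: C_def mult.assoc)
    then show "(\<Sum>k. if jumped k \<omega> then h (jump k \<omega>, accum_after (k - 1) \<omega>) * g (\<xi> k \<omega>) else 0) * indicator A \<omega>
       = (\<Sum>k. if jumped k \<omega> then C (jump k \<omega>, \<omega>) * g (\<xi> k \<omega>) else 0)"
      by (simp add: mult.commute)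
  qed
  also have "\<dots> = (\<integral>\<^sup>+\<omega>. g (\<xi> 1 \<omega>) \<partial>M) * (\<integral>\<^sup>+\<omega>. (\<integral>\<^sup>+u\<in>{0<..}. C (u, \<omega>) * ennreal (lam u \<omega>) \<partial>lborel) \<partial>M)"
    by (rule marked_compensator[OF C g])
  also have "(\<integral>\<^sup>+\<omega>. (\<integral>\<^sup>+u\<in>{0<..}. C (u, \<omega>) * ennreal (lam u \<omega>) \<partial>lborel) \<partial>M)
     = (\<integral>\<^sup>+\<omega>. (\<integral>\<^sup>+u. indicator {0<..} u * (indicator A \<omega> * (h (u, accum (max 0 u) \<omega>) * ennreal (lam (max 0 u) \<omega>))) \<partial>lborel) \<partial>M)"
  proof (rule nn_integral_cong)
    fix \<omega> assume \<omega>: "\<omega> \<in> space M"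
    show "(\<integral>\<^sup>+u\<in>{0<..}. C (u, \<omega>) * ennreal (lam u \<omega>) \<partial>lborel)
      = (\<integral>\<^sup>+u. indicator {0<..} u * (indicator A \<omega> * (h (u, accum (max 0 u) \<omega>) * ennreal (lam (max 0 u) \<omega>))) \<partial>lborel)"
    proof (rule nn_integral_cong_AE, use accum_left_AE[OF \<omega>] in eventually_elim)
      case (elim u)
      show ?case
      proof (cases "0 < u")
        case True
        then show ?thesis using elim accum_nonneg[OF \<omega>, of u] by (simp add: C_def max_def mult_ac)
      qed simp
    qed
  qed
  also have "\<dots> = (\<integral>\<^sup>+u. (\<integral>\<^sup>+\<omega>. indicator {0<..} u * (indicator A \<omega> * (h (u, accum (max 0 u) \<omega>) * ennreal (lam (max 0 u) \<omega>))) \<partial>M) \<partial>lborel)"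
    using state_integrand_measurable[OF A h]
    by (intro L.Fubini') (simp add: case_prod_unfold cong: measurable_cong_sets)
  also have "\<dots> = (\<integral>\<^sup>+u\<in>{0<..}. (\<integral>\<^sup>+\<omega>\<in>A. h (u, accum u \<omega>) * ennreal (lam u \<omega>) \<partial>M) \<partial>lborel)"
  proof (intro nn_integral_cong)
    fix u :: real
    show "(\<integral>\<^sup>+\<omega>. indicator {0<..} u * (indicator A \<omega> * (h (u, accum (max 0 u) \<omega>) * ennreal (lam (max 0 u) \<omega>))) \<partial>M)
      = (\<integral>\<^sup>+\<omega>\<in>A. h (u, accum u \<omega>) * ennreal (lam u \<omega>) \<partial>M) * indicator {0<..} u"
      by (cases "0 < u") (simp_all add: max_def mult_ac)
  qed
  finally show ?thesis .
qed

lemma mark_moments: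
  shows "(\<integral>\<^sup>+\<omega>. ennreal (\<xi> 1 \<omega>) \<partial>M) = ennreal \<mu>"
    and "(\<integral>\<^sup>+\<omega>. ennreal ((\<xi> 1 \<omega>)\<^sup>2) \<partial>M) = ennreal (\<psi>\<^sup>2 + \<mu>\<^sup>2)"
    and "0 \<le> \<mu>"
proof -
  have m: "\<xi> 1 \<in> borel_measurable M" by (rule mark_measurable) simp
  have i: "integrable M (\<xi> 1)" by (rule square_integrable_imp_integrable[OF m marks_square_integrable])
  show "0 \<le> \<mu>"
    unfolding marks_mean[symmetric] using marks_pos[of 1] by (intro integral_nonneg_AE AE_I2) (auto intro: less_imp_le)
  show "(\<integral>\<^sup>+\<omega>. ennreal (\<xi> 1 \<omega>) \<partial>M) = ennreal \<mu>"
    unfolding marks_mean[symmetric] using marks_pos[of 1] by (intro nn_integral_eq_integral i AE_I2) (auto intro: less_imp_le)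
  have "expectation (\<lambda>\<omega>. (\<xi> 1 \<omega>)\<^sup>2) = \<psi>\<^sup>2 + \<mu>\<^sup>2"
    using variance_eq[OF i marks_square_integrable] marks_variance marks_mean by simp
  then show "(\<integral>\<^sup>+\<omega>. ennreal ((\<xi> 1 \<omega>)\<^sup>2) \<partial>M) = ennreal (\<psi>\<^sup>2 + \<mu>\<^sup>2)"
    using nn_integral_eq_integral[OF marks_square_integrable] by simp
qed

end

section \<open>Finiteness of the second moment\<close>

text \<open>A Gronwall inequality without integrals: with \<open>W = sup f(u) e\<^sup>-\<^sup>c\<^sup>u\<close> the step gives
  \<open>W \<le> a + W / 2\<close>. Boundedness of \<open>f\<close> is essential, for it makes \<open>W\<close> finite.\<close>

lemma gronwall_sup:
  fixes f :: "real \<Rightarrow> real"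
  assumes c: "0 \<le> c" and a: "0 \<le> a"
    and bdd: "\<And>t. 0 \<le> t \<Longrightarrow> t \<le> T \<Longrightarrow> f t \<le> B"
    and step: "\<And>W t. 0 \<le> W \<Longrightarrow> 0 \<le> t \<Longrightarrow> t \<le> T \<Longrightarrow> (\<And>u. 0 \<le> u \<Longrightarrow> u \<le> t \<Longrightarrow> f u \<le> W * exp (c * u))
      \<Longrightarrow> f t \<le> a + W / 2 * exp (c * t)"
    and t: "0 \<le> t" "t \<le> T"
  shows "f t \<le> 2 * a * exp (c * t)"
proof -
  define g where "g = (\<lambda>u. f u * exp (- c * u))"
  define W where "W = max 0 (SUP u\<in>{0..T}. g u)"
  have ne: "{0..T} \<noteq> {}" using t by auto
  have gB: "g u \<le> max 0 B" if "u \<in> {0..T}" for u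
  proof -
    have "g u \<le> max 0 B * exp (- c * u)"
      unfolding g_def using bdd[of u] that by (intro mult_right_mono) auto
    also have "\<dots> \<le> max 0 B * 1" using c that by (intro mult_left_mono) auto
    finally show ?thesis by simp
  qed
  have bd: "bdd_above (g ` {0..T})" by (rule bdd_aboveI2[OF gB])
  have fW: "f u \<le> W * exp (c * u)" if "u \<in> {0..T}" for u
  proof -
    have "g u \<le> W" using cSUP_upper[OF that bd] by (simp add: W_def)
    then have "g u * exp (c * u) \<le> W * exp (c * u)" by (intro mult_right_mono) auto
    then show ?thesis by (simp add: g_def mult.assoc exp_add[symmetric])
  qed
  have "g u \<le> a + W / 2" if u: "u \<in> {0..T}" for u
  proof -
    have "f u \<le> a + W / 2 * exp (c * u)"
      using u fW by (intro step) (auto simp: W_def)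
    then have "g u \<le> (a + W / 2 * exp (c * u)) * exp (- c * u)" unfolding g_def by (intro mult_right_mono) auto
    also have "\<dots> = a * exp (- c * u) + W / 2"
      by (simp add: algebra_simps exp_add[symmetric])
    also have "\<dots> \<le> a * 1 + W / 2" using a c u by (intro add_mono mult_left_mono) auto
    finally show ?thesis by simp
  qed
  then have "(SUP u\<in>{0..T}. g u) \<le> a + W / 2" by (intro cSUP_least ne)
  moreover have "0 \<le> W" by (simp add: W_def)
  ultimately have "W \<le> a + W / 2" using a by (simp add: W_def)
  then have "W \<le> 2 * a" by simp
  then have "W * exp (c * t) \<le> 2 * a * exp (c * t)" by (intro mult_right_mono) auto
  with fW[of t] t show ?thesis by (auto intro: order_trans)
qed

lemma has_bochner_integral_exp:
  fixes c t :: real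
  assumes "0 < c" "0 \<le> t"
  shows "has_bochner_integral lborel (\<lambda>u. exp (c * u) * indicator {0..t} u) ((exp (c * t) - 1) / c)"
proof -
  have "has_bochner_integral lborel (\<lambda>u. exp (c * u) * indicator {0..t} u) (exp (c * t) / c - exp (c * 0) / c)"
    using assms by (intro has_bochner_integral_FTC_Icc_real) (auto intro!: derivative_eq_intros)
  then show ?thesis by (simp add: diff_divide_distrib)
qed

text \<open>The difference \<open>d\<close> of two solutions satisfies \<open>d(t) = \<alpha> \<integral> d\<close> over \<open>[0, t]\<close>, hence
  vanishes by the Gronwall inequality with constant zero.\<close>

lemma linear_volterra_unique:
  fixes x y f :: "real \<Rightarrow> real"
  assumes \<alpha>: "0 \<le> \<alpha>"
    and x: "\<And>t. 0 \<le> t \<Longrightarrow> t \<le> T \<Longrightarrow>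
        has_bochner_integral lborel (\<lambda>u. (\<alpha> * x u + f u) * indicator {0..t} u) (x t - x 0)"
    and bdd: "\<And>t. 0 \<le> t \<Longrightarrow> t \<le> T \<Longrightarrow> \<bar>x t\<bar> \<le> B"
    and y: "\<And>t. (y has_real_derivative \<alpha> * y t + f t) (at t)"
    and f: "\<And>t. isCont f t"
    and 0: "y 0 = x 0" and t: "0 \<le> t" "t \<le> T"
  shows "x t = y t"
proof -
  have cy: "isCont y t" for t using y by (rule DERIV_isCont)
  define d where "d = (\<lambda>t. x t - y t)"
  have d: "has_bochner_integral lborel (\<lambda>u. \<alpha> * d u * indicator {0..t} u) (d t)" if "0 \<le> t" "t \<le> T" for t
  proof -
    have "has_bochner_integral lborel (\<lambda>u. (\<alpha> * y u + f u) * indicator {0..t} u) (y t - y 0)"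
      using that y cy f by (intro has_bochner_integral_FTC_Icc_real) auto
    from has_bochner_integral_diff[OF x[OF that] this]
    show ?thesis using 0 by (simp add: d_def algebra_simps)
  qed
  have "bounded (y ` {0..T})"
    using cy by (intro compact_imp_bounded compact_continuous_image) (auto intro: continuous_at_imp_continuous_on)
  then obtain By where By: "\<And>u. u \<in> {0..T} \<Longrightarrow> \<bar>y u\<bar> \<le> By"
    unfolding bounded_iff by (metis imageI real_norm_def)
  define c where "c = 2 * \<alpha> + 1"
  have "\<bar>d t\<bar> \<le> 2 * 0 * exp (c * t)"
  proof (rule gronwall_sup[where B="B + By" and T=T])
    show "\<bar>d t\<bar> \<le> B + By" if "0 \<le> t" "t \<le> T" for t
      using bdd[OF that] By[of t] that by (simp add: d_def)
    fix W t assume W: "0 \<le> W" and t: "0 \<le> t" "t \<le> T" and dW: "\<And>u. 0 \<le> u \<Longrightarrow> u \<le> t \<Longrightarrow> \<bar>d u\<bar> \<le> W * exp (c * u)"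
    have c0: "0 < c" using \<alpha> by (simp add: c_def)
    have e: "has_bochner_integral lborel (\<lambda>u. \<alpha> * W * (exp (c * u) * indicator {0..t} u)) (\<alpha> * W * ((exp (c * t) - 1) / c))"
      by (intro has_bochner_integral_mult_right has_bochner_integral_exp c0 t)
    have "\<bar>d t\<bar> = \<bar>LBINT u. \<alpha> * d u * indicator {0..t} u\<bar>"
      using d[OF t] by (simp add: has_bochner_integral_iff)
    also have "\<dots> \<le> (LBINT u. \<alpha> * W * (exp (c * u) * indicator {0..t} u))"
    proof (rule integral_abs_bound_integral)
      fix u :: real
      show "\<bar>\<alpha> * d u * indicator {0..t} u\<bar> \<le> \<alpha> * W * (exp (c * u) * indicator {0..t} u)"
        using dW[of u] \<alpha> by (auto simp: indicator_def abs_mult mult.assoc intro!: mult_left_mono)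
    qed (use d[OF t] e in \<open>simp_all only: has_bochner_integral_iff\<close>)
    also have "\<dots> = W * (\<alpha> * ((exp (c * t) - 1) / c))" using e by (simp add: has_bochner_integral_iff)
    also have "\<dots> \<le> W * (1 / 2 * exp (c * t))"
    proof (rule mult_left_mono[OF _ W])
      have "\<alpha> / c \<le> 1 / 2" using \<alpha> by (simp add: c_def field_simps)
      moreover have "0 \<le> exp (c * t) - 1" using c0 t by simp
      ultimately have "\<alpha> / c * (exp (c * t) - 1) \<le> 1 / 2 * (exp (c * t) - 1)" by (rule mult_right_mono)
      also have "\<dots> \<le> 1 / 2 * exp (c * t)" by simp
      finally show "\<alpha> * ((exp (c * t) - 1) / c) \<le> 1 / 2 * exp (c * t)" by simp
    qed
    finally show "\<bar>d t\<bar> \<le> 0 + W / 2 * exp (c * t)" by simp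
  qed (use t \<alpha> in \<open>auto simp: c_def\<close>)
  then show ?thesis by (simp add: d_def)
qed

context hawkes_process
begin

lemma sum_jumps_upto:
  fixes f :: "nat \<Rightarrow> ennreal"
  assumes "\<omega> \<in> space M" "0 \<le> t"
  shows "(\<Sum>k=1..N t \<omega>. f k) = (\<Sum>k. if jumped k \<omega> then indicator {..t} (jump k \<omega>) * f k else 0)"
  unfolding suminf_jumps_upto[OF N_counting[OF assms(1)] assms(2), symmetric]
  by (intro suminf_cong) (auto simp: indicator_def)

lemma lam_measurable: "0 \<le> t \<Longrightarrow> lam t \<in> borel_measurable M"
  using lam_adapted subalgebra_F measurable_from_subalg by blast

lemma accum_measurable: "0 \<le> t \<Longrightarrow> accum t \<in> borel_measurable M"
  unfolding accum_def using lam_measurable[of t] by measurable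

lemma initial_le_accum: "\<omega> \<in> space M \<Longrightarrow> 0 \<le> t \<Longrightarrow> lam 0 \<omega> \<le> accum t \<omega>"
  using accum_after_mono[of \<omega> 0 "N t \<omega>"] by (simp add: accum_eq) (simp add: accum_after_def)

text \<open>The increments of \<open>Z\<close> are compensated with \<open>h(u, z) = \<eta> e\<^sup>\<kappa>\<^sup>u\<close> and \<open>g(x) = x\<close>.\<close>

lemma first_increment:
  assumes A: "A \<in> sets (F 0)" and t: "0 \<le> t"
  shows "(\<integral>\<^sup>+\<omega>\<in>A. ennreal (accum t \<omega> - lam 0 \<omega>) \<partial>M)
    = (\<integral>\<^sup>+u\<in>{0..t}. (\<integral>\<^sup>+\<omega>\<in>A. ennreal (\<eta> * \<mu> * (exp (\<kappa> * u) * lam u \<omega>)) \<partial>M) \<partial>lborel)"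
proof -
  define h where "h = (\<lambda>x::real \<times> real. indicator {..t} (fst x) * ennreal (\<eta> * exp (\<kappa> * fst x)))"
  have hm: "h \<in> borel_measurable (borel \<Otimes>\<^sub>M borel)" unfolding h_def by measurable
  have [measurable]: "A \<in> sets M" by (rule sets_F_M[OF A])
  have "(\<integral>\<^sup>+\<omega>\<in>A. ennreal (accum t \<omega> - lam 0 \<omega>) \<partial>M)
     = (\<integral>\<^sup>+\<omega>\<in>A. (\<Sum>k. if jumped k \<omega> then h (jump k \<omega>, accum_after (k - 1) \<omega>) * ennreal (\<xi> k \<omega>) else 0) \<partial>M)"
  proof (rule nn_integral_cong)
    fix \<omega> assume \<omega>: "\<omega> \<in> space M"
    have "ennreal (accum t \<omega> - lam 0 \<omega>) = (\<Sum>k=1..N t \<omega>. ennreal (jump_size k \<omega>))"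
      unfolding accum_eq[OF \<omega> t] accum_after_def
      using jump_size_pos[OF _ \<omega>] by (subst sum_ennreal) (auto intro: less_imp_le)
    also have "\<dots> = (\<Sum>k. if jumped k \<omega> then h (jump k \<omega>, accum_after (k - 1) \<omega>) * ennreal (\<xi> k \<omega>) else 0)"
      unfolding sum_jumps_upto[OF \<omega> t]
    proof (rule suminf_cong)
      fix k
      show "(if jumped k \<omega> then indicator {..t} (jump k \<omega>) * ennreal (jump_size k \<omega>) else 0) =
         (if jumped k \<omega> then h (jump k \<omega>, accum_after (k - 1) \<omega>) * ennreal (\<xi> k \<omega>) else 0)"
        using marks_pos[OF _ \<omega>, of k] eta_pos
        by (auto simp: h_def jump_size_def reached_def ennreal_mult mult.assoc less_imp_le)
    qed
    finally show "ennreal (accum t \<omega> - lam 0 \<omega>) * indicator A \<omega> =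
      (\<Sum>k. if jumped k \<omega> then h (jump k \<omega>, accum_after (k - 1) \<omega>) * ennreal (\<xi> k \<omega>) else 0) * indicator A \<omega>" by simp
  qed
  also have "\<dots> = ennreal \<mu> * (\<integral>\<^sup>+u\<in>{0<..}. (\<integral>\<^sup>+\<omega>\<in>A. h (u, accum u \<omega>) * ennreal (lam u \<omega>) \<partial>M) \<partial>lborel)"
    unfolding mark_moments(1)[symmetric] by (rule state_compensator[OF A hm]) simp
  also have "\<dots> = (\<integral>\<^sup>+u. ennreal \<mu> * ((\<integral>\<^sup>+\<omega>\<in>A. h (u, accum u \<omega>) * ennreal (lam u \<omega>) \<partial>M) * indicator {0<..} u) \<partial>lborel)"
    using state_integral_measurable[OF A hm] by (intro nn_integral_cmult[symmetric]) simp
  also have "\<dots> = (\<integral>\<^sup>+u\<in>{0..t}. (\<integral>\<^sup>+\<omega>\<in>A. ennreal (\<eta> * \<mu> * (exp (\<kappa> * u) * lam u \<omega>)) \<partial>M) \<partial>lborel)"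
  proof (rule nn_integral_cong_AE, use AE_lborel_singleton[of 0] in eventually_elim)
    case (elim u)
    show ?case
    proof (cases "0 < u \<and> u \<le> t")
      case True
      then have u: "0 \<le> u" by simp
      note [measurable] = lam_measurable[OF u] accum_measurable[OF u]
      have "ennreal \<mu> * (\<integral>\<^sup>+\<omega>\<in>A. h (u, accum u \<omega>) * ennreal (lam u \<omega>) \<partial>M)
         = (\<integral>\<^sup>+\<omega>. ennreal \<mu> * (h (u, accum u \<omega>) * ennreal (lam u \<omega>) * indicator A \<omega>) \<partial>M)"
        unfolding h_def by (intro nn_integral_cmult[symmetric]) measurable
      also have "\<dots> = (\<integral>\<^sup>+\<omega>\<in>A. ennreal (\<eta> * \<mu> * (exp (\<kappa> * u) * lam u \<omega>)) \<partial>M)"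
      proof (rule nn_integral_cong)
        fix \<omega> assume \<omega>: "\<omega> \<in> space M"
        have "ennreal \<mu> * (ennreal (\<eta> * exp (\<kappa> * u)) * ennreal (lam u \<omega>)) = ennreal (\<eta> * \<mu> * (exp (\<kappa> * u) * lam u \<omega>))"
          using mark_moments(3) eta_pos lam_nonneg[OF u \<omega>] by (simp add: ennreal_mult[symmetric] mult_ac)
        then show "ennreal \<mu> * (h (u, accum u \<omega>) * ennreal (lam u \<omega>) * indicator A \<omega>) = ennreal (\<eta> * \<mu> * (exp (\<kappa> * u) * lam u \<omega>)) * indicator A \<omega>"
          using True by (simp add: h_def mult.assoc[symmetric])
      qed
      finally show ?thesis using True by (simp add: indicator_def)
    next
      case False
      then show ?thesis using elim by (auto simp: h_def indicator_def)
    qed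
  qed
  finally show ?thesis .
qed

text \<open>Compensator density of \<open>(1 + Z)\<^sup>2\<close>. The square of \<open>1 + Z\<close> rather than of \<open>Z\<close> is used
  because it dominates \<open>Z\<close> and \<open>\<lambda>\<close>, so one Gronwall bound serves both moments.\<close>

definition square_drift :: "real \<Rightarrow> 'a \<Rightarrow> real" where
  "square_drift u \<omega> = (2 * \<eta> * \<mu> * (1 + accum u \<omega>) + \<eta>\<^sup>2 * (\<psi>\<^sup>2 + \<mu>\<^sup>2) * exp (\<kappa> * u)) * (exp (\<kappa> * u) * lam u \<omega>)"

text \<open>The increments of \<open>(1 + Z)\<^sup>2\<close> at jumps that start in the set \<open>S\<close>. The set is either
  everything or \<open>{..K}\<close>, which stops the process when it passes the level \<open>K\<close>.\<close>

definition square_jumps :: "real set \<Rightarrow> real \<Rightarrow> 'a \<Rightarrow> ennreal" where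
  "square_jumps S t \<omega> = (\<Sum>k=1..N t \<omega>. indicator S (accum_after (k - 1) \<omega>) *
     ennreal (2 * (1 + accum_after (k - 1) \<omega>) * jump_size k \<omega> + (jump_size k \<omega>)\<^sup>2))"

definition cross_weight :: "real set \<Rightarrow> real \<Rightarrow> real \<times> real \<Rightarrow> ennreal" where
  "cross_weight S t x = indicator {..t} (fst x) * (indicator S (snd x) * ennreal (2 * (1 + snd x) * (\<eta> * exp (\<kappa> * fst x))))"

definition quadratic_weight :: "real set \<Rightarrow> real \<Rightarrow> real \<times> real \<Rightarrow> ennreal" where
  "quadratic_weight S t x = indicator {..t} (fst x) * (indicator S (snd x) * ennreal ((\<eta> * exp (\<kappa> * fst x))\<^sup>2))"

definition cross_jumps :: "real set \<Rightarrow> real \<Rightarrow> 'a \<Rightarrow> ennreal" where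
  "cross_jumps S t \<omega> = (\<Sum>k. if jumped k \<omega> then cross_weight S t (jump k \<omega>, accum_after (k - 1) \<omega>) * ennreal (\<xi> k \<omega>) else 0)"

definition quadratic_jumps :: "real set \<Rightarrow> real \<Rightarrow> 'a \<Rightarrow> ennreal" where
  "quadratic_jumps S t \<omega> = (\<Sum>k. if jumped k \<omega> then quadratic_weight S t (jump k \<omega>, accum_after (k - 1) \<omega>) * ennreal ((\<xi> k \<omega>)\<^sup>2) else 0)"

lemma weights_measurable [measurable]:
  assumes [measurable]: "S \<in> sets borel"
  shows "cross_weight S t \<in> borel_measurable (borel \<Otimes>\<^sub>M borel)"
    and "quadratic_weight S t \<in> borel_measurable (borel \<Otimes>\<^sub>M borel)"
  unfolding cross_weight_def quadratic_weight_def by measurable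

lemma jump_sums_measurable [measurable]:
  assumes "S \<in> sets borel"
  shows "cross_jumps S t \<in> borel_measurable M" and "quadratic_jumps S t \<in> borel_measurable M"
  unfolding cross_jumps_def quadratic_jumps_def
  using state_jump_sum_measurable[OF weights_measurable(1)[OF assms], of ennreal]
    state_jump_sum_measurable[OF weights_measurable(2)[OF assms], of "\<lambda>x. ennreal (x\<^sup>2)"] by simp_all

text \<open>Each increment \<open>2 (1 + z) J + J\<^sup>2\<close> splits into a part linear and a part quadratic in the
  mark, to which \<open>state_compensator\<close> applies separately.\<close>

lemma square_jumps_eq:
  assumes \<omega>: "\<omega> \<in> space M" and t: "0 \<le> t"
  shows "square_jumps S t \<omega> = cross_jumps S t \<omega> + quadratic_jumps S t \<omega>"
proof -
  have "square_jumps S t \<omega> = (\<Sum>k. (if jumped k \<omega> then cross_weight S t (jump k \<omega>, accum_after (k - 1) \<omega>) * ennreal (\<xi> k \<omega>) else 0)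
      + (if jumped k \<omega> then quadratic_weight S t (jump k \<omega>, accum_after (k - 1) \<omega>) * ennreal ((\<xi> k \<omega>)\<^sup>2) else 0))"
    unfolding square_jumps_def sum_jumps_upto[OF \<omega> t]
  proof (rule suminf_cong)
    fix k
    show "(if jumped k \<omega> then indicator {..t} (jump k \<omega>) * (indicator S (accum_after (k - 1) \<omega>) *
        ennreal (2 * (1 + accum_after (k - 1) \<omega>) * jump_size k \<omega> + (jump_size k \<omega>)\<^sup>2)) else 0) =
       (if jumped k \<omega> then cross_weight S t (jump k \<omega>, accum_after (k - 1) \<omega>) * ennreal (\<xi> k \<omega>) else 0)
      + (if jumped k \<omega> then quadratic_weight S t (jump k \<omega>, accum_after (k - 1) \<omega>) * ennreal ((\<xi> k \<omega>)\<^sup>2) else 0)"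
    proof (cases "jumped k \<omega>")
      case True
      then have x: "0 < \<xi> k \<omega>" using marks_pos[OF _ \<omega>, of k] by (simp add: reached_def)
      have z: "0 \<le> accum_after (k - 1) \<omega>" by (rule accum_after_nonneg[OF \<omega>])
      have "ennreal (2 * (1 + accum_after (k - 1) \<omega>) * jump_size k \<omega> + (jump_size k \<omega>)\<^sup>2)
        = ennreal (2 * (1 + accum_after (k - 1) \<omega>) * (\<eta> * exp (\<kappa> * jump k \<omega>))) * ennreal (\<xi> k \<omega>)
         + ennreal ((\<eta> * exp (\<kappa> * jump k \<omega>))\<^sup>2) * ennreal ((\<xi> k \<omega>)\<^sup>2)"
        using x z eta_pos
        by (simp add: jump_size_def ennreal_mult[symmetric] ennreal_plus[symmetric] power_mult_distrib mult_ac del: ennreal_plus)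
      then show ?thesis using True by (simp add: cross_weight_def quadratic_weight_def distrib_left mult.assoc)
    qed simp
  qed
  also have "\<dots> = cross_jumps S t \<omega> + quadratic_jumps S t \<omega>" unfolding cross_jumps_def quadratic_jumps_def by (rule suminf_add[symmetric]) simp_all
  finally show ?thesis .
qed

lemma square_jumps_measurable:
  assumes t: "0 \<le> t" and S: "S \<in> sets borel"
  shows "square_jumps S t \<in> borel_measurable M"
proof -
  have "(\<lambda>\<omega>. cross_jumps S t \<omega> + quadratic_jumps S t \<omega>) \<in> borel_measurable M"
    using jump_sums_measurable[OF S] by (intro borel_measurable_add)
  then show ?thesis
    by (rule measurable_cong[THEN iffD1, rotated]) (simp add: square_jumps_eq t)
qed

lemma square_increment:
  assumes A: "A \<in> sets (F 0)" and t: "0 \<le> t" and S [measurable]: "S \<in> sets borel"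
  shows "(\<integral>\<^sup>+\<omega>\<in>A. square_jumps S t \<omega> \<partial>M)
    = (\<integral>\<^sup>+u\<in>{0..t}. (\<integral>\<^sup>+\<omega>\<in>A. indicator S (accum u \<omega>) * ennreal (square_drift u \<omega>) \<partial>M) \<partial>lborel)"
proof -
  note h1m = weights_measurable(1)[OF S] and h2m = weights_measurable(2)[OF S]
  note [measurable] = jump_sums_measurable[OF S]
  have [measurable]: "A \<in> sets M" by (rule sets_F_M[OF A])
  define I1 where "I1 = (\<lambda>u. (\<integral>\<^sup>+\<omega>\<in>A. cross_weight S t (u, accum u \<omega>) * ennreal (lam u \<omega>) \<partial>M) * indicator {0<..} u)"
  define I2 where "I2 = (\<lambda>u. (\<integral>\<^sup>+\<omega>\<in>A. quadratic_weight S t (u, accum u \<omega>) * ennreal (lam u \<omega>) \<partial>M) * indicator {0<..} u)"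
  have [measurable]: "I1 \<in> borel_measurable borel" "I2 \<in> borel_measurable borel"
    unfolding I1_def I2_def by (rule state_integral_measurable[OF A] h1m h2m)+
  have "(\<integral>\<^sup>+\<omega>\<in>A. square_jumps S t \<omega> \<partial>M) = (\<integral>\<^sup>+\<omega>. cross_jumps S t \<omega> * indicator A \<omega> + quadratic_jumps S t \<omega> * indicator A \<omega> \<partial>M)"
  proof (rule nn_integral_cong)
    fix \<omega> assume \<omega>: "\<omega> \<in> space M"
    have "square_jumps S t \<omega> = cross_jumps S t \<omega> + quadratic_jumps S t \<omega>" by (rule square_jumps_eq[OF \<omega> t])
    then show "square_jumps S t \<omega> * indicator A \<omega> = cross_jumps S t \<omega> * indicator A \<omega> + quadratic_jumps S t \<omega> * indicator A \<omega>"
      by (simp add: distrib_right)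
  qed
  also have "\<dots> = (\<integral>\<^sup>+\<omega>\<in>A. cross_jumps S t \<omega> \<partial>M) + (\<integral>\<^sup>+\<omega>\<in>A. quadratic_jumps S t \<omega> \<partial>M)"
    by (rule nn_integral_add) measurable
  also have "(\<integral>\<^sup>+\<omega>\<in>A. cross_jumps S t \<omega> \<partial>M) = ennreal \<mu> * (\<integral>\<^sup>+u. I1 u \<partial>lborel)"
    unfolding mark_moments(1)[symmetric] cross_jumps_def I1_def by (rule state_compensator[OF A h1m]) simp
  also have "(\<integral>\<^sup>+\<omega>\<in>A. quadratic_jumps S t \<omega> \<partial>M) = ennreal (\<psi>\<^sup>2 + \<mu>\<^sup>2) * (\<integral>\<^sup>+u. I2 u \<partial>lborel)"
    unfolding mark_moments(2)[symmetric] quadratic_jumps_def I2_def by (rule state_compensator[OF A h2m, of "\<lambda>x. ennreal (x\<^sup>2)"]) simp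
  also have "ennreal \<mu> * (\<integral>\<^sup>+u. I1 u \<partial>lborel) + ennreal (\<psi>\<^sup>2 + \<mu>\<^sup>2) * (\<integral>\<^sup>+u. I2 u \<partial>lborel)
     = (\<integral>\<^sup>+u. ennreal \<mu> * I1 u + ennreal (\<psi>\<^sup>2 + \<mu>\<^sup>2) * I2 u \<partial>lborel)"
    by (simp add: nn_integral_add nn_integral_cmult)
  also have "\<dots> = (\<integral>\<^sup>+u\<in>{0..t}. (\<integral>\<^sup>+\<omega>\<in>A. indicator S (accum u \<omega>) * ennreal (square_drift u \<omega>) \<partial>M) \<partial>lborel)"
  proof (rule nn_integral_cong_AE, use AE_lborel_singleton[of 0] in eventually_elim)
    case (elim u)
    show ?case
    proof (cases "0 < u \<and> u \<le> t")
      case True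
      then have u: "0 \<le> u" by simp
      note [measurable] = lam_measurable[OF u] accum_measurable[OF u]
      have "ennreal \<mu> * I1 u + ennreal (\<psi>\<^sup>2 + \<mu>\<^sup>2) * I2 u
        = (\<integral>\<^sup>+\<omega>. ennreal \<mu> * (cross_weight S t (u, accum u \<omega>) * ennreal (lam u \<omega>) * indicator A \<omega>)
            + ennreal (\<psi>\<^sup>2 + \<mu>\<^sup>2) * (quadratic_weight S t (u, accum u \<omega>) * ennreal (lam u \<omega>) * indicator A \<omega>) \<partial>M)"
        unfolding I1_def I2_def cross_weight_def quadratic_weight_def using True by (simp add: nn_integral_add nn_integral_cmult)
      also have "\<dots> = (\<integral>\<^sup>+\<omega>\<in>A. indicator S (accum u \<omega>) * ennreal (square_drift u \<omega>) \<partial>M)"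
      proof (rule nn_integral_cong)
        fix \<omega> assume \<omega>: "\<omega> \<in> space M"
        have "ennreal (square_drift u \<omega>) = ennreal \<mu> * (ennreal (2 * (1 + accum u \<omega>) * (\<eta> * exp (\<kappa> * u))) * ennreal (lam u \<omega>))
            + ennreal (\<psi>\<^sup>2 + \<mu>\<^sup>2) * (ennreal ((\<eta> * exp (\<kappa> * u))\<^sup>2) * ennreal (lam u \<omega>))"
        proof -
          have "square_drift u \<omega> = \<mu> * (2 * (1 + accum u \<omega>) * (\<eta> * exp (\<kappa> * u)) * lam u \<omega>) + (\<psi>\<^sup>2 + \<mu>\<^sup>2) * ((\<eta> * exp (\<kappa> * u))\<^sup>2 * lam u \<omega>)"
            by (simp add: square_drift_def algebra_simps power2_eq_square)
          then show ?thesis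
            using mark_moments(3) eta_pos lam_nonneg[OF u \<omega>] accum_nonneg[OF \<omega> u]
            by (simp add: ennreal_mult[symmetric] ennreal_plus[symmetric] del: ennreal_plus)
        qed
        then show "ennreal \<mu> * (cross_weight S t (u, accum u \<omega>) * ennreal (lam u \<omega>) * indicator A \<omega>)
            + ennreal (\<psi>\<^sup>2 + \<mu>\<^sup>2) * (quadratic_weight S t (u, accum u \<omega>) * ennreal (lam u \<omega>) * indicator A \<omega>)
           = indicator S (accum u \<omega>) * ennreal (square_drift u \<omega>) * indicator A \<omega>"
          using True by (auto simp: cross_weight_def quadratic_weight_def indicator_def)
      qed
      finally show ?thesis using True by (simp add: indicator_def)
    next
      case False
      then show ?thesis using elim by (auto simp: I1_def I2_def cross_weight_def quadratic_weight_def indicator_def)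
    qed
  qed
  finally show ?thesis .
qed

lemma square_accum_after:
  "(1 + accum_after n \<omega>)\<^sup>2 = (1 + lam 0 \<omega>)\<^sup>2 +
     (\<Sum>k=1..n. 2 * (1 + accum_after (k - 1) \<omega>) * jump_size k \<omega> + (jump_size k \<omega>)\<^sup>2)"
proof (induction n)
  case (Suc n)
  have "(1 + accum_after (Suc n) \<omega>)\<^sup>2 = (1 + accum_after n \<omega>)\<^sup>2 + (2 * (1 + accum_after n \<omega>) * jump_size (Suc n) \<omega> + (jump_size (Suc n) \<omega>)\<^sup>2)"
    using accum_after_Suc[of "Suc n" \<omega>] by (simp add: power2_eq_square algebra_simps)
  then show ?case unfolding Suc.IH by simp
qed (simp add: accum_after_def)

lemma square_accum_eq:
  assumes \<omega>: "\<omega> \<in> space M" and t: "0 \<le> t"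
  shows "ennreal ((1 + accum t \<omega>)\<^sup>2 - (1 + lam 0 \<omega>)\<^sup>2) = square_jumps UNIV t \<omega>"
proof -
  let ?f = "\<lambda>k. 2 * (1 + accum_after (k - 1) \<omega>) * jump_size k \<omega> + (jump_size k \<omega>)\<^sup>2"
  have nn: "0 \<le> ?f k" if "k \<in> {1..N t \<omega>}" for k
    using jump_size_pos[OF _ \<omega>, of k] accum_after_nonneg[OF \<omega>, of "k - 1"] that by simp
  have "square_jumps UNIV t \<omega> = (\<Sum>k=1..N t \<omega>. ennreal (?f k))" by (simp add: square_jumps_def)
  also have "\<dots> = ennreal (\<Sum>k=1..N t \<omega>. ?f k)" by (rule sum_ennreal[OF nn])
  finally show ?thesis unfolding accum_eq[OF \<omega> t] square_accum_after by simp
qed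

text \<open>As \<open>Z\<close> increases, it lies in \<open>{..K}\<close> before every jump if it does so at the end; on the
  truncation event no increment is lost.\<close>

lemma square_accum_le:
  assumes \<omega>: "\<omega> \<in> space M" and t: "0 \<le> t"
  shows "indicator {..K} (accum t \<omega>) * ennreal ((1 + accum t \<omega>)\<^sup>2) \<le> ennreal ((1 + lam 0 \<omega>)\<^sup>2) + square_jumps {..K} t \<omega>"
proof (cases "accum t \<omega> \<le> K")
  case True
  have "square_jumps {..K} t \<omega> = square_jumps UNIV t \<omega>"
    unfolding square_jumps_def
  proof (rule sum.cong[OF refl])
    fix k assume "k \<in> {1..N t \<omega>}"
    then have "k - 1 \<le> N t \<omega>" by (auto intro: order_trans[OF diff_le_self])
    then have "accum_after (k - 1) \<omega> \<le> K"
      using accum_after_mono[OF \<omega>, of "k - 1" "N t \<omega>"] True by (simp add: accum_eq[OF \<omega> t])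
    then show "indicator {..K} (accum_after (k - 1) \<omega>) * ennreal (2 * (1 + accum_after (k - 1) \<omega>) * jump_size k \<omega> + (jump_size k \<omega>)\<^sup>2)
      = indicator UNIV (accum_after (k - 1) \<omega>) * ennreal (2 * (1 + accum_after (k - 1) \<omega>) * jump_size k \<omega> + (jump_size k \<omega>)\<^sup>2)"
      by simp
  qed
  then have J: "square_jumps {..K} t \<omega> = ennreal ((1 + accum t \<omega>)\<^sup>2 - (1 + lam 0 \<omega>)\<^sup>2)"
    using square_accum_eq[OF \<omega> t] by simp
  have "(1 + lam 0 \<omega>)\<^sup>2 \<le> (1 + accum t \<omega>)\<^sup>2"
    using initial_le_accum[OF \<omega> t] lam_nonneg[OF order_refl \<omega>] by (intro power_mono) auto
  then show ?thesis
    unfolding J using True by (simp add: ennreal_plus[symmetric] del: ennreal_plus)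
qed simp

lemma square_drift_le:
  assumes \<omega>: "\<omega> \<in> space M" and u: "0 \<le> u" "u \<le> T"
  shows "square_drift u \<omega> \<le> (2 * \<eta> * \<mu> + \<eta>\<^sup>2 * (\<psi>\<^sup>2 + \<mu>\<^sup>2) * exp (\<kappa> * T)) * (exp (\<kappa> * T) * (1 + \<theta>)) * (1 + accum u \<omega>)\<^sup>2"
proof -
  let ?z = "1 + accum u \<omega>" and ?r = "\<eta>\<^sup>2 * (\<psi>\<^sup>2 + \<mu>\<^sup>2)"
  have z: "1 \<le> ?z" using accum_nonneg[OF \<omega> u(1)] by simp
  have e: "exp (\<kappa> * u) \<le> exp (\<kappa> * T)" using kappa_pos u by simp
  have am: "0 \<le> 2 * \<eta> * \<mu>" using eta_pos mark_moments(3) by simp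
  have "?r * exp (\<kappa> * u) \<le> ?r * exp (\<kappa> * T) * ?z"
    using mult_mono[OF mult_left_mono[OF e, of ?r] z] by simp
  then have 1: "2 * \<eta> * \<mu> * ?z + ?r * exp (\<kappa> * u) \<le> (2 * \<eta> * \<mu> + ?r * exp (\<kappa> * T)) * ?z"
    by (simp add: distrib_right)
  have "lam u \<omega> \<le> (1 + \<theta>) * ?z"
    using lam_le_accum[OF \<omega> u(1)] theta_nonneg z mult_left_mono[OF z, of \<theta>] by (simp add: distrib_right)
  then have 2: "exp (\<kappa> * u) * lam u \<omega> \<le> exp (\<kappa> * T) * ((1 + \<theta>) * ?z)"
    using e lam_nonneg[OF u(1) \<omega>] by (intro mult_mono) auto
  have "square_drift u \<omega> \<le> ((2 * \<eta> * \<mu> + ?r * exp (\<kappa> * T)) * ?z) * (exp (\<kappa> * T) * ((1 + \<theta>) * ?z))"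
    unfolding square_drift_def
  proof (rule mult_mono[OF 1 2])
    have "0 \<le> 2 * \<eta> * \<mu> + ?r * exp (\<kappa> * T)" using am by (intro add_nonneg_nonneg) simp_all
    then show "0 \<le> (2 * \<eta> * \<mu> + ?r * exp (\<kappa> * T)) * ?z" using z by (intro mult_nonneg_nonneg) simp_all
    show "0 \<le> exp (\<kappa> * u) * lam u \<omega>" using lam_nonneg[OF u(1) \<omega>] by simp
  qed
  then show ?thesis by (simp add: power2_eq_square mult_ac)
qed

text \<open>For fixed \<open>K\<close> the truncated expectation is bounded, so the Gronwall inequality applies; its
  bound does not depend on \<open>K\<close> and survives monotone convergence.\<close>

lemma square_accum_finite:
  assumes A: "A \<in> sets (F 0)" and K0: "\<And>\<omega>. \<omega> \<in> A \<Longrightarrow> lam 0 \<omega> \<le> K0" and T: "0 \<le> T"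
  shows "\<exists>B. \<forall>t\<in>{0..T}. (\<integral>\<^sup>+\<omega>\<in>A. ennreal ((1 + accum t \<omega>)\<^sup>2) \<partial>M) \<le> ennreal B"
proof -
  have AM [measurable]: "A \<in> sets M" by (rule sets_F_M[OF A])
  define a where "a = (1 + \<bar>K0\<bar>)\<^sup>2"
  define b where "b = (2 * \<eta> * \<mu> + \<eta>\<^sup>2 * (\<psi>\<^sup>2 + \<mu>\<^sup>2) * exp (\<kappa> * T)) * (exp (\<kappa> * T) * (1 + \<theta>))"
  have b0: "0 \<le> b" unfolding b_def using eta_pos mark_moments(3) theta_nonneg by simp
  \<comment> \<open>With rate \<open>c \<ge> 2 b\<close> the integral term contributes at most half of the supremum.\<close>
  define c where "c = 2 * b + 1"
  have c0: "0 < c" using b0 by (simp add: c_def)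
  define I where "I = (\<lambda>K t. \<integral>\<^sup>+\<omega>\<in>A. indicator {..K} (accum t \<omega>) * ennreal ((1 + accum t \<omega>)\<^sup>2) \<partial>M)"
  have main: "I K t \<le> ennreal (2 * a * exp (c * T))" if t: "0 \<le> t" "t \<le> T" for K t
  proof -
    have IB: "I K t \<le> ennreal ((1 + \<bar>K\<bar>)\<^sup>2)" if "0 \<le> t" for t
    proof -
      have "I K t \<le> (\<integral>\<^sup>+\<omega>. ennreal ((1 + \<bar>K\<bar>)\<^sup>2) \<partial>M)"
        unfolding I_def
      proof (rule nn_integral_mono)
        fix \<omega> assume \<omega>: "\<omega> \<in> space M"
        show "indicator {..K} (accum t \<omega>) * ennreal ((1 + accum t \<omega>)\<^sup>2) * indicator A \<omega> \<le> ennreal ((1 + \<bar>K\<bar>)\<^sup>2)"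
          using accum_nonneg[OF \<omega> that] by (auto simp: indicator_def intro!: ennreal_leI power_mono)
      qed
      also have "\<dots> = ennreal ((1 + \<bar>K\<bar>)\<^sup>2)" by (simp add: emeasure_space_1)
      finally show ?thesis .
    qed
    have Ireal: "ennreal (enn2real (I K t)) = I K t" if "0 \<le> t" for t
      by (rule ennreal_enn2real) (rule order.strict_trans1[OF IB[OF that] ennreal_less_top])
    have "enn2real (I K t) \<le> 2 * a * exp (c * t)"
    proof (rule gronwall_sup[where T=T and B="(1 + \<bar>K\<bar>)\<^sup>2"])
      show "enn2real (I K t) \<le> (1 + \<bar>K\<bar>)\<^sup>2" if "0 \<le> t" for t
        using enn2real_mono[OF IB[OF that]] by simp
      fix W t assume W: "0 \<le> W" and t: "0 \<le> t" "t \<le> T"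
        and hyp: "\<And>u. 0 \<le> u \<Longrightarrow> u \<le> t \<Longrightarrow> enn2real (I K u) \<le> W * exp (c * u)"
      have "I K t \<le> (\<integral>\<^sup>+\<omega>\<in>A. ennreal a + square_jumps {..K} t \<omega> \<partial>M)"
        unfolding I_def
      proof (rule nn_integral_mono)
        fix \<omega> assume \<omega>: "\<omega> \<in> space M"
        show "indicator {..K} (accum t \<omega>) * ennreal ((1 + accum t \<omega>)\<^sup>2) * indicator A \<omega> \<le> (ennreal a + square_jumps {..K} t \<omega>) * indicator A \<omega>"
        proof (cases "\<omega> \<in> A")
          case True
          have "(1 + lam 0 \<omega>)\<^sup>2 \<le> a"
            unfolding a_def using K0[OF True] lam_nonneg[OF order_refl \<omega>] by (intro power_mono) auto
          then have "ennreal ((1 + lam 0 \<omega>)\<^sup>2) + square_jumps {..K} t \<omega> \<le> ennreal a + square_jumps {..K} t \<omega>"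
            by (intro add_right_mono ennreal_leI)
          from order_trans[OF square_accum_le[OF \<omega> t(1)] this] show ?thesis using True by simp
        qed simp
      qed
      also have "\<dots> \<le> ennreal a + (\<integral>\<^sup>+\<omega>\<in>A. square_jumps {..K} t \<omega> \<partial>M)"
      proof -
        have "(\<integral>\<^sup>+\<omega>\<in>A. ennreal a + square_jumps {..K} t \<omega> \<partial>M) = (\<integral>\<^sup>+\<omega>. ennreal a * indicator A \<omega> + square_jumps {..K} t \<omega> * indicator A \<omega> \<partial>M)"
          by (simp add: distrib_right)
        also have "\<dots> \<le> (\<integral>\<^sup>+\<omega>. ennreal a + square_jumps {..K} t \<omega> * indicator A \<omega> \<partial>M)"
          by (intro nn_integral_mono add_right_mono) (auto simp: indicator_def)
        also have "\<dots> = ennreal a + (\<integral>\<^sup>+\<omega>\<in>A. square_jumps {..K} t \<omega> \<partial>M)"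
          using square_jumps_measurable[OF t(1), of "{..K}"] by (subst nn_integral_add) (auto simp: emeasure_space_1)
        finally show ?thesis .
      qed
      also have "(\<integral>\<^sup>+\<omega>\<in>A. square_jumps {..K} t \<omega> \<partial>M) = (\<integral>\<^sup>+u\<in>{0..t}. (\<integral>\<^sup>+\<omega>\<in>A. indicator {..K} (accum u \<omega>) * ennreal (square_drift u \<omega>) \<partial>M) \<partial>lborel)"
        by (rule square_increment[OF A t(1)]) simp
      also have "\<dots> \<le> (\<integral>\<^sup>+u. ennreal (b * W * (exp (c * u) * indicator {0..t} u)) \<partial>lborel)"
      proof (rule nn_integral_mono)
        fix u :: real
        show "(\<integral>\<^sup>+\<omega>\<in>A. indicator {..K} (accum u \<omega>) * ennreal (square_drift u \<omega>) \<partial>M) * indicator {0..t} u \<le> ennreal (b * W * (exp (c * u) * indicator {0..t} u))"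
        proof (cases "u \<in> {0..t}")
          case True
          then have u: "0 \<le> u" "u \<le> t" "u \<le> T" using t by auto
          note [measurable] = accum_measurable[OF u(1)]
          have "(\<integral>\<^sup>+\<omega>\<in>A. indicator {..K} (accum u \<omega>) * ennreal (square_drift u \<omega>) \<partial>M)
             \<le> (\<integral>\<^sup>+\<omega>. ennreal b * (indicator {..K} (accum u \<omega>) * ennreal ((1 + accum u \<omega>)\<^sup>2) * indicator A \<omega>) \<partial>M)"
          proof (rule nn_integral_mono)
            fix \<omega> assume \<omega>: "\<omega> \<in> space M"
            have "ennreal (square_drift u \<omega>) \<le> ennreal b * ennreal ((1 + accum u \<omega>)\<^sup>2)"
              using square_drift_le[OF \<omega> u(1,3)] b0 by (simp add: ennreal_mult[symmetric] b_def ennreal_leI)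
            then show "indicator {..K} (accum u \<omega>) * ennreal (square_drift u \<omega>) * indicator A \<omega>
              \<le> ennreal b * (indicator {..K} (accum u \<omega>) * ennreal ((1 + accum u \<omega>)\<^sup>2) * indicator A \<omega>)"
              by (auto simp: indicator_def)
          qed
          also have "\<dots> = ennreal b * I K u" unfolding I_def by (intro nn_integral_cmult) measurable
          also have "\<dots> \<le> ennreal b * ennreal (W * exp (c * u))"
            using hyp[OF u(1,2)] by (subst Ireal[OF u(1), symmetric]) (intro mult_left_mono ennreal_leI, auto)
          also have "\<dots> = ennreal (b * W * exp (c * u))" using b0 W by (simp add: ennreal_mult[symmetric] mult.assoc)
          finally show ?thesis using True by simp
        qed simp
      qed
      also have "\<dots> = ennreal (b * W * ((exp (c * t) - 1) / c))"
      proof -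
        have e: "has_bochner_integral lborel (\<lambda>u. b * W * (exp (c * u) * indicator {0..t} u)) (b * W * ((exp (c * t) - 1) / c))"
          by (intro has_bochner_integral_mult_right has_bochner_integral_exp c0 t)
        then show ?thesis
          using b0 W by (subst nn_integral_eq_integral) (auto simp: has_bochner_integral_iff intro!: AE_I2)
      qed
      finally have "I K t \<le> ennreal (a + b * W * ((exp (c * t) - 1) / c))"
        using b0 W c0 t by (simp add: ennreal_plus[symmetric] a_def add_mono del: ennreal_plus)
      then have "enn2real (I K t) \<le> a + b * W * ((exp (c * t) - 1) / c)"
        using b0 W c0 t by (subst (asm) Ireal[OF t(1), symmetric], subst (asm) ennreal_le_iff)
          (auto simp: a_def intro!: add_nonneg_nonneg mult_nonneg_nonneg divide_nonneg_nonneg)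
      also have "b * W * ((exp (c * t) - 1) / c) = W * (b / c * (exp (c * t) - 1))" by simp
      also have "\<dots> \<le> W * (1 / 2 * exp (c * t))"
      proof (rule mult_left_mono[OF _ W])
        have "b / c \<le> 1 / 2" using b0 by (simp add: c_def field_simps)
        moreover have "0 \<le> exp (c * t) - 1" using c0 t by simp
        ultimately have "b / c * (exp (c * t) - 1) \<le> 1 / 2 * (exp (c * t) - 1)" by (rule mult_right_mono)
        also have "\<dots> \<le> 1 / 2 * exp (c * t)" by simp
        finally show "b / c * (exp (c * t) - 1) \<le> 1 / 2 * exp (c * t)" .
      qed
      finally show "enn2real (I K t) \<le> a + W / 2 * exp (c * t)" by simp
    qed (use t c0 in \<open>auto simp: a_def\<close>)
    also have "\<dots> \<le> 2 * a * exp (c * T)" using t c0 by (intro mult_left_mono) (auto simp: a_def)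
    finally show ?thesis
      by (subst Ireal[OF t(1), symmetric]) (rule ennreal_leI)
  qed
  have "(\<integral>\<^sup>+\<omega>\<in>A. ennreal ((1 + accum t \<omega>)\<^sup>2) \<partial>M) \<le> ennreal (2 * a * exp (c * T))" if t: "t \<in> {0..T}" for t
  proof -
    have t0: "0 \<le> t" using t by simp
    note [measurable] = accum_measurable[OF t0]
    have "(\<integral>\<^sup>+\<omega>\<in>A. ennreal ((1 + accum t \<omega>)\<^sup>2) \<partial>M)
       = (\<integral>\<^sup>+\<omega>. (SUP n::nat. indicator {..real n} (accum t \<omega>) * ennreal ((1 + accum t \<omega>)\<^sup>2) * indicator A \<omega>) \<partial>M)"
    proof (rule nn_integral_cong, rule antisym)
      fix \<omega>
      obtain n :: nat where "accum t \<omega> \<le> real n" using real_arch_simple by blast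
      then show "ennreal ((1 + accum t \<omega>)\<^sup>2) * indicator A \<omega> \<le> (SUP n::nat. indicator {..real n} (accum t \<omega>) * ennreal ((1 + accum t \<omega>)\<^sup>2) * indicator A \<omega>)"
        by (intro SUP_upper2[of n]) auto
      show "(SUP n::nat. indicator {..real n} (accum t \<omega>) * ennreal ((1 + accum t \<omega>)\<^sup>2) * indicator A \<omega>) \<le> ennreal ((1 + accum t \<omega>)\<^sup>2) * indicator A \<omega>"
        by (rule SUP_least) (auto simp: indicator_def)
    qed
    also have "\<dots> = (SUP n::nat. I (real n) t)"
      unfolding I_def
      by (rule nn_integral_monotone_convergence_SUP) (auto simp: incseq_def le_fun_def indicator_def)
    also have "\<dots> \<le> ennreal (2 * a * exp (c * T))" using main t by (intro SUP_least) auto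
    finally show ?thesis .
  qed
  then show ?thesis by blast
qed

end

section \<open>Moments of the intensity at a fixed time\<close>

context hawkes_process
begin

text \<open>Expectation over the event \<open>A\<close>, not divided by its probability.\<close>

definition avg :: "'a set \<Rightarrow> ('a \<Rightarrow> real) \<Rightarrow> real" where
  "avg A f = (\<integral>\<omega>. indicator A \<omega> * f \<omega> \<partial>M)"

context
  fixes A :: "'a set" and K0 :: real
  assumes A: "A \<in> sets (F 0)" and bounded_start: "\<And>\<omega>. \<omega> \<in> A \<Longrightarrow> lam 0 \<omega> \<le> K0"
begin

lemma A_event [measurable]: "A \<in> sets M"
  by (rule sets_F_M[OF A])

lemma A_integrable [simp]: "integrable M (indicator A :: 'a \<Rightarrow> real)"
  by (rule integrable_real_indicator) (simp_all add: emeasure_eq_measure)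

lemma square_integrable:
  assumes t: "0 \<le> t"
  shows "integrable M (\<lambda>\<omega>. indicator A \<omega> * (1 + accum t \<omega>)\<^sup>2)"
proof (rule integrableI_nonneg)
  note [measurable] = accum_measurable[OF t]
  show "(\<lambda>\<omega>. indicator A \<omega> * (1 + accum t \<omega>)\<^sup>2) \<in> borel_measurable M" by measurable
  obtain B where "\<forall>s\<in>{0..t}. (\<integral>\<^sup>+\<omega>\<in>A. ennreal ((1 + accum s \<omega>)\<^sup>2) \<partial>M) \<le> ennreal B"
    using square_accum_finite[OF A bounded_start t] by blast
  then have B: "(\<integral>\<^sup>+\<omega>\<in>A. ennreal ((1 + accum t \<omega>)\<^sup>2) \<partial>M) \<le> ennreal B"
    using t by simp
  have "(\<integral>\<^sup>+\<omega>. ennreal (indicator A \<omega> * (1 + accum t \<omega>)\<^sup>2) \<partial>M) = (\<integral>\<^sup>+\<omega>\<in>A. ennreal ((1 + accum t \<omega>)\<^sup>2) \<partial>M)"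
    by (intro nn_integral_cong) (simp add: indicator_def)
  also have "\<dots> < \<infinity>" using B by (auto intro: order.strict_trans1)
  finally show "(\<integral>\<^sup>+\<omega>. ennreal (indicator A \<omega> * (1 + accum t \<omega>)\<^sup>2) \<partial>M) < \<infinity>" .
qed simp

lemma accum_integrable:
  assumes t: "0 \<le> t"
  shows "integrable M (\<lambda>\<omega>. indicator A \<omega> * accum t \<omega>)"
proof (rule Bochner_Integration.integrable_bound[OF square_integrable[OF t]])
  note [measurable] = accum_measurable[OF t]
  show "(\<lambda>\<omega>. indicator A \<omega> * accum t \<omega>) \<in> borel_measurable M" by measurable
  show "AE \<omega> in M. norm (indicator A \<omega> * accum t \<omega>) \<le> norm (indicator A \<omega> * (1 + accum t \<omega>)\<^sup>2)"
  proof (rule AE_I2)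
    fix \<omega> assume \<omega>: "\<omega> \<in> space M"
    have "accum t \<omega> \<le> (1 + accum t \<omega>)\<^sup>2"
      using accum_nonneg[OF \<omega> t] by (simp add: power2_eq_square algebra_simps)
    then show "norm (indicator A \<omega> * accum t \<omega>) \<le> norm (indicator A \<omega> * (1 + accum t \<omega>)\<^sup>2)"
      using accum_nonneg[OF \<omega> t] by (simp add: indicator_def)
  qed
qed

lemma avg_mono:
  assumes "integrable M (\<lambda>\<omega>. indicator A \<omega> * f \<omega>)" "integrable M (\<lambda>\<omega>. indicator A \<omega> * g \<omega>)"
    and "\<And>\<omega>. \<omega> \<in> space M \<Longrightarrow> f \<omega> \<le> g \<omega>"
  shows "avg A f \<le> avg A g"
  unfolding avg_def using assms by (intro integral_mono) (auto simp: indicator_def)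

lemma nn_integral_avg:
  assumes "integrable M (\<lambda>\<omega>. indicator A \<omega> * f \<omega>)" "\<And>\<omega>. \<omega> \<in> space M \<Longrightarrow> 0 \<le> f \<omega>"
  shows "(\<integral>\<^sup>+\<omega>\<in>A. ennreal (f \<omega>) \<partial>M) = ennreal (avg A f)"
proof -
  have "(\<integral>\<^sup>+\<omega>\<in>A. ennreal (f \<omega>) \<partial>M) = (\<integral>\<^sup>+\<omega>. ennreal (indicator A \<omega> * f \<omega>) \<partial>M)"
    by (intro nn_integral_cong) (simp add: indicator_def)
  also have "\<dots> = ennreal (avg A f)"
    unfolding avg_def using assms by (intro nn_integral_eq_integral AE_I2) auto
  finally show ?thesis .
qed

lemma avg_square_bounded:
  assumes T: "0 \<le> T"
  shows "\<exists>B. \<forall>t\<in>{0..T}. avg A (\<lambda>\<omega>. (1 + accum t \<omega>)\<^sup>2) \<le> B"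
proof -
  obtain B where B: "\<And>t. t \<in> {0..T} \<Longrightarrow> (\<integral>\<^sup>+\<omega>\<in>A. ennreal ((1 + accum t \<omega>)\<^sup>2) \<partial>M) \<le> ennreal B"
    using square_accum_finite[OF A bounded_start T] by blast
  have "avg A (\<lambda>\<omega>. (1 + accum t \<omega>)\<^sup>2) \<le> max 0 B" if "t \<in> {0..T}" for t
  proof -
    have "ennreal (avg A (\<lambda>\<omega>. (1 + accum t \<omega>)\<^sup>2)) \<le> ennreal B"
      using B[OF that] nn_integral_avg[OF square_integrable, of t] that by simp
    also have "\<dots> \<le> ennreal (max 0 B)" by (rule ennreal_leI) simp
    finally have "ennreal (avg A (\<lambda>\<omega>. (1 + accum t \<omega>)\<^sup>2)) \<le> ennreal (max 0 B)" .
    then show ?thesis by (subst (asm) ennreal_le_iff) simp_all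
  qed
  then show ?thesis by blast
qed

lemma avg_accum_nonneg: "0 \<le> t \<Longrightarrow> 0 \<le> avg A (accum t)"
  unfolding avg_def by (intro integral_nonneg_AE AE_I2) (simp add: accum_nonneg)

lemma avg_square_nonneg: "0 \<le> avg A (\<lambda>\<omega>. (1 + accum t \<omega>)\<^sup>2)"
  unfolding avg_def by (intro integral_nonneg_AE AE_I2) simp

lemma avg_accum_le_square:
  assumes t: "0 \<le> t" shows "avg A (accum t) \<le> avg A (\<lambda>\<omega>. (1 + accum t \<omega>)\<^sup>2)"
proof (rule avg_mono[OF accum_integrable[OF t] square_integrable[OF t]])
  fix \<omega> assume \<omega>: "\<omega> \<in> space M"
  show "accum t \<omega> \<le> (1 + accum t \<omega>)\<^sup>2"
    using accum_nonneg[OF \<omega> t] by (simp add: power2_eq_square algebra_simps)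
qed

lemma accum_0: "accum 0 = lam 0"
  by (rule ext) (simp add: accum_def)

lemma avg_measurable:
  assumes g: "g \<in> borel_measurable borel"
  shows "(\<lambda>u. avg A (\<lambda>\<omega>. g (accum u \<omega>)) * indicator {0..t} u) \<in> borel_measurable borel"
proof -
  note [measurable] = g accum_jointly_measurable
  have "(\<lambda>u. (\<integral>\<omega>. indicator A \<omega> * g (accum (max 0 u) \<omega>) \<partial>M)) \<in> borel_measurable borel"
  proof (rule borel_measurable_lebesgue_integral)
    have "(\<lambda>x. indicator A (snd x) * g (accum (max 0 (fst x)) (snd x))) \<in> borel_measurable (borel \<Otimes>\<^sub>M M)"
      by measurable
    then show "(\<lambda>(u, \<omega>). indicator A \<omega> * g (accum (max 0 u) \<omega>)) \<in> borel_measurable (borel \<Otimes>\<^sub>M M)"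
      by (simp add: case_prod_unfold)
  qed
  then have "(\<lambda>u. avg A (\<lambda>\<omega>. g (accum (max 0 u) \<omega>)) * indicator {0..t} u) \<in> borel_measurable borel"
    unfolding avg_def by measurable
  also have "(\<lambda>u. avg A (\<lambda>\<omega>. g (accum (max 0 u) \<omega>)) * indicator {0..t} u) = (\<lambda>u. avg A (\<lambda>\<omega>. g (accum u \<omega>)) * indicator {0..t} u)"
    by (rule ext) (simp add: indicator_def max_def)
  finally show ?thesis .
qed

text \<open>From \<open>first_increment\<close>, with \<open>e\<^sup>\<kappa>\<^sup>u \<lambda>\<^sub>u = Z\<^sub>u + \<theta> (e\<^sup>\<kappa>\<^sup>u - 1)\<close>.\<close>

lemma first_equation:
  assumes t: "0 \<le> t"
  shows "has_bochner_integral lborel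
    (\<lambda>u. (\<eta> * \<mu> * avg A (accum u) + \<eta> * \<mu> * (\<theta> * (exp (\<kappa> * u) - 1)) * prob A) * indicator {0..t} u)
    (avg A (accum t) - avg A (accum 0))"
proof (rule has_bochner_integral_nn_integral)
  let ?G = "\<lambda>u. \<eta> * \<mu> * avg A (accum u) + \<eta> * \<mu> * (\<theta> * (exp (\<kappa> * u) - 1)) * prob A"
  have G0: "0 \<le> ?G u" if "0 \<le> u" for u
    using that eta_pos mark_moments(3) theta_nonneg kappa_pos avg_accum_nonneg[OF that]
    by (intro add_nonneg_nonneg mult_nonneg_nonneg) auto
  have meas: "(\<lambda>u. avg A (accum u) * indicator {0..t} u) \<in> borel_measurable borel"
    using avg_measurable[of "\<lambda>z. z"] by simp
  have "(\<lambda>u. \<eta> * \<mu> * (avg A (accum u) * indicator {0..t} u) + \<eta> * \<mu> * (\<theta> * (exp (\<kappa> * u) - 1)) * prob A * indicator {0..t} u) \<in> borel_measurable borel"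
    using meas by measurable
  then show "(\<lambda>u. ?G u * indicator {0..t} u) \<in> borel_measurable lborel"
    by (simp add: distrib_right mult.assoc)
  show "AE u in lborel. 0 \<le> ?G u * indicator {0..t} u"
    using G0 by (intro AE_I2) (simp add: indicator_def)
  show "0 \<le> avg A (accum t) - avg A (accum 0)"
    using avg_mono[OF accum_integrable[OF order_refl] accum_integrable[OF t]] initial_le_accum[OF _ t]
    by (simp add: accum_0)
  have "(\<integral>\<^sup>+u. ennreal (?G u * indicator {0..t} u) \<partial>lborel)
     = (\<integral>\<^sup>+u\<in>{0..t}. (\<integral>\<^sup>+\<omega>\<in>A. ennreal (\<eta> * \<mu> * (exp (\<kappa> * u) * lam u \<omega>)) \<partial>M) \<partial>lborel)"
  proof (rule nn_integral_cong)
    fix u :: real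
    show "ennreal (?G u * indicator {0..t} u) = (\<integral>\<^sup>+\<omega>\<in>A. ennreal (\<eta> * \<mu> * (exp (\<kappa> * u) * lam u \<omega>)) \<partial>M) * indicator {0..t} u"
    proof (cases "u \<in> {0..t}")
      case True
      then have u: "0 \<le> u" by simp
      have eq: "indicator A \<omega> * (\<eta> * \<mu> * (exp (\<kappa> * u) * lam u \<omega>))
        = \<eta> * \<mu> * (indicator A \<omega> * accum u \<omega>) + \<eta> * \<mu> * (\<theta> * (exp (\<kappa> * u) - 1)) * indicator A \<omega>" for \<omega>
        unfolding exp_lam_eq by (simp add: algebra_simps)
      have "(\<integral>\<^sup>+\<omega>\<in>A. ennreal (\<eta> * \<mu> * (exp (\<kappa> * u) * lam u \<omega>)) \<partial>M) = ennreal (avg A (\<lambda>\<omega>. \<eta> * \<mu> * (exp (\<kappa> * u) * lam u \<omega>)))"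
      proof (rule nn_integral_avg)
        show "integrable M (\<lambda>\<omega>. indicator A \<omega> * (\<eta> * \<mu> * (exp (\<kappa> * u) * lam u \<omega>)))"
          unfolding eq using accum_integrable[OF u] by (intro Bochner_Integration.integrable_add integrable_mult_right) simp_all
        show "0 \<le> \<eta> * \<mu> * (exp (\<kappa> * u) * lam u \<omega>)" if "\<omega> \<in> space M" for \<omega>
          using eta_pos mark_moments(3) lam_nonneg[OF u that] by simp
      qed
      also have "avg A (\<lambda>\<omega>. \<eta> * \<mu> * (exp (\<kappa> * u) * lam u \<omega>)) = ?G u"
        unfolding avg_def eq using accum_integrable[OF u] by simp
      finally show ?thesis using True by simp
    qed simp
  qed
  also have "\<dots> = (\<integral>\<^sup>+\<omega>\<in>A. ennreal (accum t \<omega> - lam 0 \<omega>) \<partial>M)"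
    by (rule first_increment[OF A t, symmetric])
  also have "\<dots> = ennreal (avg A (\<lambda>\<omega>. accum t \<omega> - lam 0 \<omega>))"
  proof (rule nn_integral_avg)
    show "integrable M (\<lambda>\<omega>. indicator A \<omega> * (accum t \<omega> - lam 0 \<omega>))"
      using accum_integrable[OF t] accum_integrable[OF order_refl] by (simp add: right_diff_distrib accum_0)
  qed (use initial_le_accum[OF _ t] in simp)
  also have "avg A (\<lambda>\<omega>. accum t \<omega> - lam 0 \<omega>) = avg A (accum t) - avg A (accum 0)"
    unfolding avg_def using accum_integrable[OF t] accum_integrable[OF order_refl]
    by (simp add: right_diff_distrib accum_0)
  finally show "(\<integral>\<^sup>+u. ennreal (?G u * indicator {0..t} u) \<partial>lborel) = ennreal (avg A (accum t) - avg A (accum 0))" .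
qed

text \<open>The part of the averaged \<open>square_drift\<close> that depends on the first moment \<open>m\<close> only.\<close>

definition square_forcing :: "real \<Rightarrow> real \<Rightarrow> real" where
  "square_forcing m u = 2 * \<eta> * \<mu> * (\<theta> * (exp (\<kappa> * u) - 1) - 1) * (prob A + m)
     + \<eta>\<^sup>2 * (\<psi>\<^sup>2 + \<mu>\<^sup>2) * exp (\<kappa> * u) * (m + \<theta> * (exp (\<kappa> * u) - 1) * prob A)"

lemma avg_square_drift:
  assumes u: "0 \<le> u"
  shows "integrable M (\<lambda>\<omega>. indicator A \<omega> * square_drift u \<omega>)"
    and "avg A (square_drift u) = 2 * \<eta> * \<mu> * avg A (\<lambda>\<omega>. (1 + accum u \<omega>)\<^sup>2) + square_forcing (avg A (accum u)) u"
proof -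
  let ?\<tau> = "\<theta> * (exp (\<kappa> * u) - 1)" and ?r = "\<eta>\<^sup>2 * (\<psi>\<^sup>2 + \<mu>\<^sup>2)"
  let ?b = "2 * \<eta> * \<mu> * (?\<tau> - 1) + ?r * exp (\<kappa> * u)"
  let ?c = "2 * \<eta> * \<mu> * (?\<tau> - 1) + ?r * exp (\<kappa> * u) * ?\<tau>"
  have eq: "indicator A \<omega> * square_drift u \<omega> = 2 * \<eta> * \<mu> * (indicator A \<omega> * (1 + accum u \<omega>)\<^sup>2)
     + (?b * (indicator A \<omega> * accum u \<omega>) + ?c * indicator A \<omega>)" for \<omega>
    unfolding square_drift_def exp_lam_eq by (simp add: algebra_simps power2_eq_square)
  have i1: "integrable M (\<lambda>\<omega>. 2 * \<eta> * \<mu> * (indicator A \<omega> * (1 + accum u \<omega>)\<^sup>2))"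
    by (intro integrable_mult_right square_integrable[OF u])
  have i2: "integrable M (\<lambda>\<omega>. ?b * (indicator A \<omega> * accum u \<omega>))"
    by (intro integrable_mult_right accum_integrable[OF u])
  have i3: "integrable M (\<lambda>\<omega>. ?c * indicator A \<omega> :: real)"
    by (intro integrable_mult_right integrable_real_indicator) (simp_all add: emeasure_eq_measure)
  note i = i1 i2 i3
  show "integrable M (\<lambda>\<omega>. indicator A \<omega> * square_drift u \<omega>)"
    unfolding eq by (intro Bochner_Integration.integrable_add i)
  have "avg A (square_drift u) = 2 * \<eta> * \<mu> * avg A (\<lambda>\<omega>. (1 + accum u \<omega>)\<^sup>2) + (?b * avg A (accum u) + ?c * prob A)"
    unfolding avg_def eq
    by (subst Bochner_Integration.integral_add[OF i(1) Bochner_Integration.integrable_add[OF i(2,3)]],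
        subst Bochner_Integration.integral_add[OF i(2,3)]) simp
  also have "?b * avg A (accum u) + ?c * prob A = square_forcing (avg A (accum u)) u"
    by (simp add: square_forcing_def algebra_simps)
  finally show "avg A (square_drift u) = 2 * \<eta> * \<mu> * avg A (\<lambda>\<omega>. (1 + accum u \<omega>)\<^sup>2) + square_forcing (avg A (accum u)) u" .
qed

lemma second_equation:
  assumes t: "0 \<le> t"
  shows "has_bochner_integral lborel
    (\<lambda>u. (2 * \<eta> * \<mu> * avg A (\<lambda>\<omega>. (1 + accum u \<omega>)\<^sup>2) + square_forcing (avg A (accum u)) u) * indicator {0..t} u)
    (avg A (\<lambda>\<omega>. (1 + accum t \<omega>)\<^sup>2) - avg A (\<lambda>\<omega>. (1 + accum 0 \<omega>)\<^sup>2))"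
proof (rule has_bochner_integral_nn_integral)
  let ?G = "\<lambda>u. 2 * \<eta> * \<mu> * avg A (\<lambda>\<omega>. (1 + accum u \<omega>)\<^sup>2) + square_forcing (avg A (accum u)) u"
  have drift0: "0 \<le> square_drift u \<omega>" if "0 \<le> u" "\<omega> \<in> space M" for u \<omega>
    unfolding square_drift_def using that eta_pos mark_moments(3) accum_nonneg[of \<omega> u] lam_nonneg[of u \<omega>]
    by (intro mult_nonneg_nonneg add_nonneg_nonneg) auto
  have G0: "0 \<le> ?G u" if "0 \<le> u" for u
    unfolding avg_square_drift(2)[OF that, symmetric] unfolding avg_def
    using drift0[OF that] by (intro integral_nonneg_AE AE_I2) simp
  have meas: "(\<lambda>u. avg A (accum u) * indicator {0..t} u) \<in> borel_measurable borel"
    "(\<lambda>u. avg A (\<lambda>\<omega>. (1 + accum u \<omega>)\<^sup>2) * indicator {0..t} u) \<in> borel_measurable borel"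
    using avg_measurable[of "\<lambda>z. z"] avg_measurable[of "\<lambda>z. (1 + z)\<^sup>2"] by simp_all
  have "(\<lambda>u. 2 * \<eta> * \<mu> * (avg A (\<lambda>\<omega>. (1 + accum u \<omega>)\<^sup>2) * indicator {0..t} u)
       + square_forcing (avg A (accum u) * indicator {0..t} u) u * indicator {0..t} u) \<in> borel_measurable borel"
    unfolding square_forcing_def using meas by measurable
  also have "(\<lambda>u. 2 * \<eta> * \<mu> * (avg A (\<lambda>\<omega>. (1 + accum u \<omega>)\<^sup>2) * indicator {0..t} u)
       + square_forcing (avg A (accum u) * indicator {0..t} u) u * indicator {0..t} u) = (\<lambda>u. ?G u * indicator {0..t} u)"
    by (rule ext) (simp add: indicator_def)
  finally show "(\<lambda>u. ?G u * indicator {0..t} u) \<in> borel_measurable lborel" by simp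
  show "AE u in lborel. 0 \<le> ?G u * indicator {0..t} u"
    using G0 by (intro AE_I2) (simp add: indicator_def)
  have le: "(1 + lam 0 \<omega>)\<^sup>2 \<le> (1 + accum t \<omega>)\<^sup>2" if "\<omega> \<in> space M" for \<omega>
    using initial_le_accum[OF that t] lam_nonneg[OF order_refl that] by (intro power_mono) auto
  show "0 \<le> avg A (\<lambda>\<omega>. (1 + accum t \<omega>)\<^sup>2) - avg A (\<lambda>\<omega>. (1 + accum 0 \<omega>)\<^sup>2)"
    using avg_mono[OF square_integrable[OF order_refl] square_integrable[OF t]] le by (simp add: accum_0)
  have "(\<integral>\<^sup>+u. ennreal (?G u * indicator {0..t} u) \<partial>lborel)
     = (\<integral>\<^sup>+u\<in>{0..t}. (\<integral>\<^sup>+\<omega>\<in>A. indicator UNIV (accum u \<omega>) * ennreal (square_drift u \<omega>) \<partial>M) \<partial>lborel)"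
  proof (rule nn_integral_cong)
    fix u :: real
    show "ennreal (?G u * indicator {0..t} u) = (\<integral>\<^sup>+\<omega>\<in>A. indicator UNIV (accum u \<omega>) * ennreal (square_drift u \<omega>) \<partial>M) * indicator {0..t} u"
    proof (cases "u \<in> {0..t}")
      case True
      then have u: "0 \<le> u" by simp
      have "(\<integral>\<^sup>+\<omega>\<in>A. ennreal (square_drift u \<omega>) \<partial>M) = ennreal (avg A (square_drift u))"
        by (rule nn_integral_avg[OF avg_square_drift(1)[OF u] drift0[OF u]])
      then show ?thesis using True by (simp add: avg_square_drift(2)[OF u])
    qed simp
  qed
  also have "\<dots> = (\<integral>\<^sup>+\<omega>\<in>A. square_jumps UNIV t \<omega> \<partial>M)"
    by (rule square_increment[OF A t, symmetric]) simp
  also have "\<dots> = (\<integral>\<^sup>+\<omega>\<in>A. ennreal ((1 + accum t \<omega>)\<^sup>2 - (1 + lam 0 \<omega>)\<^sup>2) \<partial>M)"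
    by (intro nn_integral_cong) (simp add: square_accum_eq[OF _ t])
  also have "\<dots> = ennreal (avg A (\<lambda>\<omega>. (1 + accum t \<omega>)\<^sup>2 - (1 + lam 0 \<omega>)\<^sup>2))"
  proof (rule nn_integral_avg)
    show "integrable M (\<lambda>\<omega>. indicator A \<omega> * ((1 + accum t \<omega>)\<^sup>2 - (1 + lam 0 \<omega>)\<^sup>2))"
      using square_integrable[OF t] square_integrable[OF order_refl] by (simp add: right_diff_distrib accum_0)
  qed (use le in simp)
  also have "avg A (\<lambda>\<omega>. (1 + accum t \<omega>)\<^sup>2 - (1 + lam 0 \<omega>)\<^sup>2) = avg A (\<lambda>\<omega>. (1 + accum t \<omega>)\<^sup>2) - avg A (\<lambda>\<omega>. (1 + accum 0 \<omega>)\<^sup>2)"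
    unfolding avg_def using square_integrable[OF t] square_integrable[OF order_refl]
    by (simp add: right_diff_distrib accum_0)
  finally show "(\<integral>\<^sup>+u. ennreal (?G u * indicator {0..t} u) \<partial>lborel) = ennreal (avg A (\<lambda>\<omega>. (1 + accum t \<omega>)\<^sup>2) - avg A (\<lambda>\<omega>. (1 + accum 0 \<omega>)\<^sup>2))" .
qed

lemma avg_accum_explicit:
  fixes \<gamma> c :: real
  assumes \<gamma>: "\<gamma> = \<kappa> - \<eta> * \<mu>" and c: "\<gamma> * c = \<kappa> * \<theta>" and t: "0 \<le> t"
  shows "avg A (accum t) = (avg A (lam 0) - c * prob A) * exp (\<eta> * \<mu> * t) + (c - \<theta>) * prob A * exp (\<kappa> * t) + \<theta> * prob A"
proof -
  obtain B where B: "\<And>s. s \<in> {0..t} \<Longrightarrow> avg A (\<lambda>\<omega>. (1 + accum s \<omega>)\<^sup>2) \<le> B"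
    using avg_square_bounded[OF t] by blast
  show ?thesis
  proof (rule linear_volterra_unique[where T=t and B=B and x="\<lambda>t. avg A (accum t)" and \<alpha>="\<eta> * \<mu>"
      and f="\<lambda>u. \<eta> * \<mu> * (\<theta> * (exp (\<kappa> * u) - 1)) * prob A"])
  show "\<bar>avg A (accum s)\<bar> \<le> B" if "0 \<le> s" "s \<le> t" for s
    using B[of s] avg_accum_le_square[OF that(1)] avg_accum_nonneg[OF that(1)] that by simp
  show "((\<lambda>t. (avg A (lam 0) - c * prob A) * exp (\<eta> * \<mu> * t) + (c - \<theta>) * prob A * exp (\<kappa> * t) + \<theta> * prob A)
    has_real_derivative \<eta> * \<mu> * ((avg A (lam 0) - c * prob A) * exp (\<eta> * \<mu> * s) + (c - \<theta>) * prob A * exp (\<kappa> * s) + \<theta> * prob A)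
      + \<eta> * \<mu> * (\<theta> * (exp (\<kappa> * s) - 1)) * prob A) (at s)" for s
  proof -
    have "\<kappa> * (c - \<theta>) = \<eta> * \<mu> * c" using c \<gamma> by (simp add: algebra_simps)
    then have *: "\<kappa> * (c - \<theta>) * x = \<eta> * \<mu> * c * x" for x by simp
    show ?thesis
      by (rule derivative_eq_intros refl)+ (use *[of "prob A * exp (\<kappa> * s)"] in \<open>simp add: algebra_simps\<close>)
  qed
qed (use first_equation t eta_pos mark_moments(3) in \<open>auto simp: accum_0 algebra_simps\<close>)
qed

text \<open>With \<open>d = c - \<theta>\<close> and \<open>\<alpha> = \<eta> \<mu>\<close>, the claimed function satisfies the differential equation
  because of \<open>\<gamma> d = \<alpha> \<theta>\<close>, which restates \<open>\<gamma> c = \<kappa> \<theta>\<close>.\<close>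

lemma avg_square_explicit:
  fixes \<gamma> c R :: real
  assumes \<gamma>: "\<gamma> = \<kappa> - \<eta> * \<mu>" and c: "\<gamma> * c = \<kappa> * \<theta>" and R: "\<gamma> * R = \<eta>\<^sup>2 * (\<psi>\<^sup>2 + \<mu>\<^sup>2)" and t: "0 \<le> t"
  defines "v \<equiv> avg A (lam 0) - c * prob A"
    and "w \<equiv> avg A (\<lambda>\<omega>. (lam 0 \<omega>)\<^sup>2) - 2 * c * avg A (lam 0) + c\<^sup>2 * prob A"
  shows "avg A (\<lambda>\<omega>. (1 + accum t \<omega>)\<^sup>2) =
     (w - R * v - R * c * prob A / 2) * (exp (\<eta> * \<mu> * t))\<^sup>2
     + (2 * (c - \<theta>) + R) * v * (exp (\<eta> * \<mu> * t) * exp (\<kappa> * t))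
     + ((c - \<theta>)\<^sup>2 + R * c / 2) * prob A * (exp (\<kappa> * t))\<^sup>2
     + 2 * (1 + \<theta>) * v * exp (\<eta> * \<mu> * t) + 2 * (1 + \<theta>) * (c - \<theta>) * prob A * exp (\<kappa> * t)
     + (1 + \<theta>)\<^sup>2 * prob A" (is "_ = ?y t")
proof -
  obtain B where B: "\<And>s. s \<in> {0..t} \<Longrightarrow> avg A (\<lambda>\<omega>. (1 + accum s \<omega>)\<^sup>2) \<le> B"
    using avg_square_bounded[OF t] by blast
  show ?thesis
  proof (rule linear_volterra_unique[where T=t and B=B and x="\<lambda>t. avg A (\<lambda>\<omega>. (1 + accum t \<omega>)\<^sup>2)" and \<alpha>="2 * \<eta> * \<mu>"
      and f="\<lambda>u. square_forcing (v * exp (\<eta> * \<mu> * u) + (c - \<theta>) * prob A * exp (\<kappa> * u) + \<theta> * prob A) u" and y="?y"])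
  let ?m = "\<lambda>u. v * exp (\<eta> * \<mu> * u) + (c - \<theta>) * prob A * exp (\<kappa> * u) + \<theta> * prob A"
  have m: "avg A (accum u) = ?m u" if "0 \<le> u" for u
    unfolding v_def by (rule avg_accum_explicit[OF \<gamma> c that])
  show "\<bar>avg A (\<lambda>\<omega>. (1 + accum s \<omega>)\<^sup>2)\<bar> \<le> B" if "0 \<le> s" "s \<le> t" for s
    using B[of s] avg_square_nonneg[of s] that by simp
  show "has_bochner_integral lborel (\<lambda>u. (2 * \<eta> * \<mu> * avg A (\<lambda>\<omega>. (1 + accum u \<omega>)\<^sup>2) + square_forcing (?m u) u) * indicator {0..s} u)
    (avg A (\<lambda>\<omega>. (1 + accum s \<omega>)\<^sup>2) - avg A (\<lambda>\<omega>. (1 + accum 0 \<omega>)\<^sup>2))" if s: "0 \<le> s" "s \<le> t" for s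
    using second_equation[OF s(1)]
    by (rule has_bochner_integral_cong[THEN iffD1, rotated 3]) (auto simp: indicator_def m)
  show "isCont (\<lambda>u. square_forcing (?m u) u) s" for s
    unfolding square_forcing_def by (intro continuous_intros)
  show "(?y has_real_derivative 2 * \<eta> * \<mu> * ?y s + square_forcing (?m s) s) (at s)" for s
  proof -
    define \<alpha> where "\<alpha> = \<eta> * \<mu>"
    define a where "a = exp (\<alpha> * s)"
    define k where "k = exp (\<kappa> * s)"
    define p where "p = prob A"
    define d where "d = c - \<theta>"
    have \<kappa>: "\<kappa> = \<gamma> + \<alpha>" using \<gamma> by (simp add: \<alpha>_def)
    have rel: "\<gamma> * d - \<alpha> * \<theta> = 0" using c unfolding \<kappa> d_def by (simp add: algebra_simps)
    let ?D = "(w - R * v - R * c * p / 2) * (2 * \<alpha> * a\<^sup>2) + (2 * d + R) * v * ((\<alpha> + \<kappa>) * (a * k))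
      + (d\<^sup>2 + R * c / 2) * p * (2 * \<kappa> * k\<^sup>2) + 2 * (1 + \<theta>) * v * (\<alpha> * a) + 2 * (1 + \<theta>) * d * p * (\<kappa> * k)"
    have "(?y has_real_derivative ?D) (at s)"
      unfolding a_def k_def p_def d_def \<alpha>_def
      by (rule derivative_eq_intros refl)+ (simp add: algebra_simps power2_eq_square)
    moreover have "?D = 2 * \<eta> * \<mu> * ?y s + square_forcing (?m s) s"
    proof -
      have F: "square_forcing (?m s) s = 2 * \<alpha> * (\<theta> * (k - 1) - 1) * (p + (v * a + d * p * k + \<theta> * p)) + \<gamma> * R * k * ((v * a + d * p * k + \<theta> * p) + \<theta> * (k - 1) * p)"
        unfolding R by (simp add: square_forcing_def a_def k_def p_def d_def \<alpha>_def)
      have Y: "?y s = (w - R * v - R * c * p / 2) * a\<^sup>2 + (2 * d + R) * v * (a * k) + (d\<^sup>2 + R * c / 2) * p * k\<^sup>2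
         + 2 * (1 + \<theta>) * v * a + 2 * (1 + \<theta>) * d * p * k + (1 + \<theta>)\<^sup>2 * p"
        by (simp add: a_def k_def p_def d_def \<alpha>_def)
      have c': "c = d + \<theta>" by (simp add: d_def)
      \<comment> \<open>The defect is a multiple of \<open>\<gamma> d - \<alpha> \<theta>\<close>.\<close>
      have "?D - (2 * \<alpha> * ?y s + square_forcing (?m s) s)
        = (\<gamma> * d - \<alpha> * \<theta>) * (2 * v * (a * k) + 2 * d * p * k\<^sup>2 + 2 * (1 + \<theta>) * p * k)"
        unfolding F Y unfolding \<kappa> c' by (simp add: field_simps power2_eq_square)
      then have "?D = 2 * \<alpha> * ?y s + square_forcing (?m s) s" unfolding rel by simp
      then show ?thesis by (simp only: \<alpha>_def mult.assoc)
    qed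
    ultimately show ?thesis by simp
  qed
  show "?y 0 = avg A (\<lambda>\<omega>. (1 + accum 0 \<omega>)\<^sup>2)"
  proof -
    have i0: "integrable M (\<lambda>\<omega>. indicator A \<omega> * lam 0 \<omega>)" using accum_integrable[OF order_refl] by (simp add: accum_0)
    have i2: "integrable M (\<lambda>\<omega>. indicator A \<omega> * (lam 0 \<omega>)\<^sup>2)"
    proof -
      have "integrable M (\<lambda>\<omega>. indicator A \<omega> * (1 + accum 0 \<omega>)\<^sup>2 - 2 * (indicator A \<omega> * lam 0 \<omega>) - indicator A \<omega>)"
        by (intro Bochner_Integration.integrable_diff integrable_mult_right square_integrable i0) simp_all
      then show ?thesis by (simp add: accum_0 power2_eq_square algebra_simps)
    qed
    have "avg A (\<lambda>\<omega>. (1 + accum 0 \<omega>)\<^sup>2) = (\<integral>\<omega>. (indicator A \<omega> * (lam 0 \<omega>)\<^sup>2 + 2 * (indicator A \<omega> * lam 0 \<omega>)) + indicator A \<omega> \<partial>M)"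
      unfolding avg_def by (intro Bochner_Integration.integral_cong) (auto simp: accum_0 power2_eq_square algebra_simps)
    also have "\<dots> = avg A (\<lambda>\<omega>. (lam 0 \<omega>)\<^sup>2) + 2 * avg A (lam 0) + prob A"
      unfolding avg_def using i0 i2 by simp
    finally show ?thesis by (simp add: v_def w_def power2_eq_square algebra_simps)
  qed
qed (use t eta_pos mark_moments(3) in auto)
qed

lemma lam_integrable:
  assumes t: "0 \<le> t"
  shows "integrable M (\<lambda>\<omega>. indicator A \<omega> * lam t \<omega>)" and "integrable M (\<lambda>\<omega>. indicator A \<omega> * (lam t \<omega>)\<^sup>2)"
    and "avg A (lam t) = exp (- \<kappa> * t) * (avg A (accum t) - \<theta> * prob A) + \<theta> * prob A"
    and "avg A (\<lambda>\<omega>. (lam t \<omega>)\<^sup>2) =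
      (exp (- \<kappa> * t))\<^sup>2 * (avg A (\<lambda>\<omega>. (1 + accum t \<omega>)\<^sup>2) - 2 * (1 + \<theta>) * avg A (accum t) + (\<theta>\<^sup>2 - 1) * prob A)
      + 2 * \<theta> * exp (- \<kappa> * t) * (avg A (accum t) - \<theta> * prob A) + \<theta>\<^sup>2 * prob A"
proof -
  define q where "q = exp (- \<kappa> * t)"
  have lam: "lam t \<omega> = q * (accum t \<omega> - \<theta>) + \<theta>" for \<omega>
    by (simp add: q_def accum_def mult.assoc[symmetric] exp_add[symmetric])
  have e1: "indicator A \<omega> * lam t \<omega> = q * (indicator A \<omega> * accum t \<omega>) + (1 - q) * \<theta> * indicator A \<omega>" for \<omega>
    by (simp add: lam algebra_simps)
  have e2: "indicator A \<omega> * (lam t \<omega>)\<^sup>2 = q\<^sup>2 * (indicator A \<omega> * (1 + accum t \<omega>)\<^sup>2)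
     + ((2 * \<theta> * q - 2 * (1 + \<theta>) * q\<^sup>2) * (indicator A \<omega> * accum t \<omega>) + (q\<^sup>2 * (\<theta>\<^sup>2 - 1) - 2 * \<theta>\<^sup>2 * q + \<theta>\<^sup>2) * indicator A \<omega>)" for \<omega>
    by (simp add: lam algebra_simps power2_eq_square)
  have i1: "integrable M (\<lambda>\<omega>. q * (indicator A \<omega> * accum t \<omega>))" "integrable M (\<lambda>\<omega>. (1 - q) * \<theta> * indicator A \<omega> :: real)"
    by (intro integrable_mult_right accum_integrable[OF t] A_integrable)+
  have i2: "integrable M (\<lambda>\<omega>. q\<^sup>2 * (indicator A \<omega> * (1 + accum t \<omega>)\<^sup>2))"
    "integrable M (\<lambda>\<omega>. (2 * \<theta> * q - 2 * (1 + \<theta>) * q\<^sup>2) * (indicator A \<omega> * accum t \<omega>))"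
    "integrable M (\<lambda>\<omega>. (q\<^sup>2 * (\<theta>\<^sup>2 - 1) - 2 * \<theta>\<^sup>2 * q + \<theta>\<^sup>2) * indicator A \<omega> :: real)"
    by (intro integrable_mult_right accum_integrable[OF t] square_integrable[OF t] A_integrable)+
  show "integrable M (\<lambda>\<omega>. indicator A \<omega> * lam t \<omega>)" "integrable M (\<lambda>\<omega>. indicator A \<omega> * (lam t \<omega>)\<^sup>2)"
    unfolding e1 e2 by (intro Bochner_Integration.integrable_add i1 i2)+
  have "avg A (lam t) = q * avg A (accum t) + (1 - q) * \<theta> * prob A"
    unfolding avg_def e1 Bochner_Integration.integral_add[OF i1] by simp
  then show "avg A (lam t) = exp (- \<kappa> * t) * (avg A (accum t) - \<theta> * prob A) + \<theta> * prob A"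
    unfolding q_def[symmetric] by (simp add: algebra_simps)
  have "avg A (\<lambda>\<omega>. (lam t \<omega>)\<^sup>2) = q\<^sup>2 * avg A (\<lambda>\<omega>. (1 + accum t \<omega>)\<^sup>2)
     + ((2 * \<theta> * q - 2 * (1 + \<theta>) * q\<^sup>2) * avg A (accum t) + (q\<^sup>2 * (\<theta>\<^sup>2 - 1) - 2 * \<theta>\<^sup>2 * q + \<theta>\<^sup>2) * prob A)"
    unfolding avg_def e2 Bochner_Integration.integral_add[OF i2(1) Bochner_Integration.integrable_add[OF i2(2,3)]]
      Bochner_Integration.integral_add[OF i2(2,3)] by simp
  then show "avg A (\<lambda>\<omega>. (lam t \<omega>)\<^sup>2) =
      (exp (- \<kappa> * t))\<^sup>2 * (avg A (\<lambda>\<omega>. (1 + accum t \<omega>)\<^sup>2) - 2 * (1 + \<theta>) * avg A (accum t) + (\<theta>\<^sup>2 - 1) * prob A)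
      + 2 * \<theta> * exp (- \<kappa> * t) * (avg A (accum t) - \<theta> * prob A) + \<theta>\<^sup>2 * prob A"
    unfolding q_def[symmetric] by (simp add: algebra_simps power2_eq_square)
qed

text \<open>Conditionally on the start, the mean relaxes to \<open>c = \<kappa> \<theta> / \<gamma>\<close> at rate \<open>\<gamma>\<close>, and the variance
  is \<open>R ((\<lambda>\<^sub>0 - c) (e - e\<^sup>2) + c (1 - e\<^sup>2) / 2)\<close>. Both are averaged over \<open>A\<close> here.\<close>

theorem intensity_moments:
  fixes \<gamma> c R :: real
  assumes \<gamma>: "\<gamma> = \<kappa> - \<eta> * \<mu>" and c: "\<gamma> * c = \<kappa> * \<theta>" and R: "\<gamma> * R = \<eta>\<^sup>2 * (\<psi>\<^sup>2 + \<mu>\<^sup>2)" and t: "0 \<le> t"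
  defines "v \<equiv> avg A (lam 0) - c * prob A"
    and "w \<equiv> avg A (\<lambda>\<omega>. (lam 0 \<omega>)\<^sup>2) - 2 * c * avg A (lam 0) + c\<^sup>2 * prob A"
    and "e \<equiv> exp (- \<gamma> * t)"
  shows "avg A (lam t) = v * e + c * prob A"
    and "avg A (\<lambda>\<omega>. (lam t \<omega>)\<^sup>2) = w * e\<^sup>2 + 2 * c * v * e + c\<^sup>2 * prob A + R * (v * (e - e\<^sup>2) + c * prob A * (1 - e\<^sup>2) / 2)"
proof -
  define q where "q = exp (- \<kappa> * t)"
  define k where "k = exp (\<kappa> * t)"
  define p where "p = prob A"
  have qk: "q = 1 / k" by (simp add: q_def k_def exp_minus field_simps)
  have k: "k \<noteq> 0" by (simp add: k_def)
  have a: "exp (\<eta> * \<mu> * t) = k * e"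
    unfolding k_def e_def exp_add[symmetric] \<gamma> by (simp add: algebra_simps)
  have m: "avg A (accum t) = v * (k * e) + (c - \<theta>) * p * k + \<theta> * p"
    using avg_accum_explicit[OF \<gamma> c t] by (simp add: a k_def[symmetric] v_def p_def)
  have Q: "avg A (\<lambda>\<omega>. (1 + accum t \<omega>)\<^sup>2) = (w - R * v - R * c * p / 2) * (k * e)\<^sup>2
     + (2 * (c - \<theta>) + R) * v * (k * e * k) + ((c - \<theta>)\<^sup>2 + R * c / 2) * p * k\<^sup>2
     + 2 * (1 + \<theta>) * v * (k * e) + 2 * (1 + \<theta>) * (c - \<theta>) * p * k + (1 + \<theta>)\<^sup>2 * p"
    using avg_square_explicit[OF \<gamma> c R t] by (simp add: a k_def[symmetric] v_def w_def p_def)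
  show "avg A (lam t) = v * e + c * prob A"
    unfolding lam_integrable(3)[OF t] m q_def[symmetric] p_def[symmetric] qk using k by (simp add: field_simps)
  show "avg A (\<lambda>\<omega>. (lam t \<omega>)\<^sup>2) = w * e\<^sup>2 + 2 * c * v * e + c\<^sup>2 * prob A + R * (v * (e - e\<^sup>2) + c * prob A * (1 - e\<^sup>2) / 2)"
    unfolding lam_integrable(4)[OF t] m Q q_def[symmetric] p_def[symmetric] qk using k
    by (simp add: field_simps power2_eq_square)
qed

end

end

section \<open>Independent change of time\<close>

text \<open>For nonnegative functions, a factor known at time \<open>0\<close> may be pulled out of the conditional
  expectation even where this is infinite; the general case is the difference of two such parts.
  The lemma permits arguing on events where \<open>\<lambda>\<^sub>0\<close> is bounded.\<close>

lemma (in sigma_finite_subalgebra) real_cond_exp_local: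
  assumes B: "B \<in> sets F" and Y [measurable]: "Y \<in> borel_measurable M"
  shows "AE x in M. x \<in> B \<longrightarrow> real_cond_exp M F Y x = real_cond_exp M F (\<lambda>x. indicator B x * Y x) x"
proof -
  have i: "ennreal (indicator B x * y) = indicator B x * ennreal y" for x y
    by (simp add: indicator_def)
  have Bm: "(indicator B :: 'a \<Rightarrow> ennreal) \<in> borel_measurable F" using B by simp
  have "AE x in M. indicator B x * nn_cond_exp M F (\<lambda>x. ennreal (Y x)) x = nn_cond_exp M F (\<lambda>x. ennreal (indicator B x * Y x)) x"
    unfolding i by (rule nn_cond_exp_prod[OF Bm]) simp
  moreover have "AE x in M. indicator B x * nn_cond_exp M F (\<lambda>x. ennreal (- Y x)) x = nn_cond_exp M F (\<lambda>x. ennreal (- (indicator B x * Y x))) x"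
    unfolding mult_minus_right[symmetric] i by (rule nn_cond_exp_prod[OF Bm]) simp
  ultimately show ?thesis
  proof eventually_elim
    case (elim x)
    show ?case
    proof
      assume x: "x \<in> B"
      have "nn_cond_exp M F (\<lambda>x. ennreal (Y x)) x = nn_cond_exp M F (\<lambda>x. ennreal (indicator B x * Y x)) x"
        using elim(1) x by simp
      moreover have "nn_cond_exp M F (\<lambda>x. ennreal (- Y x)) x = nn_cond_exp M F (\<lambda>x. ennreal (- (indicator B x * Y x))) x"
        using elim(2) x by simp
      ultimately show "real_cond_exp M F Y x = real_cond_exp M F (\<lambda>x. indicator B x * Y x) x"
        by (simp only: real_cond_exp_def)
    qed
  qed
qed

context hawkes_process
begin

lemma initial_subalgebra: "sigma_finite_subalgebra M (F 0)"
proof (rule finite_measure_subalgebra_is_sigma_finite)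
  show "finite_measure_subalgebra M (F 0)"
    by unfold_locales (rule subalgebra_F)
qed

lemma initial_integrable:
  assumes A: "A \<in> sets (F 0)" and K: "\<And>\<omega>. \<omega> \<in> A \<Longrightarrow> lam 0 \<omega> \<le> K"
  shows "integrable M (\<lambda>\<omega>. indicator A \<omega> * lam 0 \<omega>)" "integrable M (\<lambda>\<omega>. indicator A \<omega> * (lam 0 \<omega>)\<^sup>2)"
    "integrable M (indicator A :: 'a \<Rightarrow> real)"
  using lam_integrable(1,2)[OF A K order_refl] A_integrable[OF A K] by auto

definition start_below :: "real \<Rightarrow> 'a set" where
  "start_below K = {\<omega> \<in> space M. lam 0 \<omega> \<le> K}"

lemma start_below_initial: "start_below K \<in> sets (F 0)"
proof -
  have "lam 0 \<in> borel_measurable (F 0)" by (rule lam_adapted) simp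
  then have "lam 0 -` {..K} \<inter> space (F 0) \<in> sets (F 0)" by (rule measurable_sets) simp
  also have "lam 0 -` {..K} \<inter> space (F 0) = start_below K" by (auto simp: start_below_def space_F)
  finally show ?thesis .
qed

lemma AE_if_on_start_below:
  assumes "\<And>n::nat. AE \<omega> in M. \<omega> \<in> start_below (real n) \<longrightarrow> P \<omega>"
  shows "AE \<omega> in M. P \<omega>"
proof -
  have "AE \<omega> in M. \<forall>n::nat. \<omega> \<in> start_below (real n) \<longrightarrow> P \<omega>"
    unfolding AE_all_countable using assms by blast
  then show ?thesis
    using AE_space
  proof eventually_elim
    case (elim \<omega>)
    obtain n :: nat where "lam 0 \<omega> \<le> real n" using real_arch_simple by blast
    with elim show ?case by (auto simp: start_below_def)
  qed
qed

lemma real_cond_exp_below: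
  assumes f: "\<And>A. A \<in> sets (F 0) \<Longrightarrow> (\<And>\<omega>. \<omega> \<in> A \<Longrightarrow> lam 0 \<omega> \<le> K) \<Longrightarrow>
      has_bochner_integral M (\<lambda>\<omega>. indicator A \<omega> * f \<omega>) (\<integral>\<omega>. indicator A \<omega> * g (lam 0 \<omega>) \<partial>M)"
    and g: "g \<in> borel_measurable borel" and gi: "integrable M (\<lambda>\<omega>. indicator (start_below K) \<omega> * g (lam 0 \<omega>))"
  shows "AE \<omega> in M. real_cond_exp M (F 0) (\<lambda>\<omega>. indicator (start_below K) \<omega> * f \<omega>) \<omega> = indicator (start_below K) \<omega> * g (lam 0 \<omega>)"
proof -
  interpret S: sigma_finite_subalgebra M "F 0" by (rule initial_subalgebra)
  let ?B = "start_below K"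
  show ?thesis
  proof (rule S.real_cond_exp_charact[OF _ _ gi])
    show "integrable M (\<lambda>\<omega>. indicator ?B \<omega> * f \<omega>)"
      using f[OF start_below_initial] by (simp add: has_bochner_integral_iff start_below_def)
    have "lam 0 \<in> borel_measurable (F 0)" by (rule lam_adapted) simp
    then show "(\<lambda>\<omega>. indicator ?B \<omega> * g (lam 0 \<omega>)) \<in> borel_measurable (F 0)"
      by (intro borel_measurable_times borel_measurable_indicator start_below_initial measurable_compose[OF _ g])
    fix A assume A: "A \<in> sets (F 0)"
    have AB: "A \<inter> ?B \<in> sets (F 0)" using A start_below_initial by blast
    have "(\<integral>\<omega>\<in>A. (indicator ?B \<omega> * f \<omega>) \<partial>M) = (\<integral>\<omega>. indicator (A \<inter> ?B) \<omega> * f \<omega> \<partial>M)"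
      unfolding set_lebesgue_integral_def by (intro Bochner_Integration.integral_cong) (auto simp: indicator_def)
    also have "\<dots> = (\<integral>\<omega>. indicator (A \<inter> ?B) \<omega> * g (lam 0 \<omega>) \<partial>M)"
      using f[OF AB] by (auto simp: has_bochner_integral_iff start_below_def)
    also have "\<dots> = (\<integral>\<omega>\<in>A. (indicator ?B \<omega> * g (lam 0 \<omega>)) \<partial>M)"
      unfolding set_lebesgue_integral_def by (intro Bochner_Integration.integral_cong) (auto simp: indicator_def)
    finally show "(\<integral>\<omega>\<in>A. (indicator ?B \<omega> * f \<omega>) \<partial>M) = (\<integral>\<omega>\<in>A. (indicator ?B \<omega> * g (lam 0 \<omega>)) \<partial>M)" .
  qed
qed

lemma below_bound: "\<omega> \<in> start_below K \<Longrightarrow> lam 0 \<omega> \<le> K"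
  by (simp add: start_below_def)

lemma quadratic_below_integrable:
  "integrable M (\<lambda>\<omega>. indicator (start_below K) \<omega> * (x * (lam 0 \<omega>)\<^sup>2 + y * lam 0 \<omega> + z))"
proof -
  note ini = initial_integrable[OF start_below_initial below_bound, of K]
  have "integrable M (\<lambda>\<omega>. x * (indicator (start_below K) \<omega> * (lam 0 \<omega>)\<^sup>2) + y * (indicator (start_below K) \<omega> * lam 0 \<omega>) + z * indicator (start_below K) \<omega>)"
    by (intro Bochner_Integration.integrable_add integrable_mult_right ini)
  then show ?thesis by (simp add: algebra_simps)
qed

context
  fixes \<tau> :: "'a \<Rightarrow> real"
  assumes time_measurable [measurable]: "\<tau> \<in> borel_measurable M" and time_nonneg: "\<And>\<omega>. 0 \<le> \<tau> \<omega>"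
    and indep_time: "\<And>E H. E \<in> sets borel \<Longrightarrow> H \<in> sets history_algebra \<Longrightarrow>
      prob ((\<tau> -` E \<inter> space M) \<inter> H) = prob (\<tau> -` E \<inter> space M) * prob H"
begin

text \<open>The random time may be drawn separately from the history.\<close>

lemma independent_time_integral:
  fixes \<phi> :: "real \<times> 'a \<Rightarrow> ennreal"
  assumes \<phi>: "\<phi> \<in> borel_measurable (borel \<Otimes>\<^sub>M history_algebra)"
  shows "(\<integral>\<^sup>+\<omega>. \<phi> (\<tau> \<omega>, \<omega>) \<partial>M) = (\<integral>\<^sup>+\<omega>'. (\<integral>\<^sup>+\<omega>. \<phi> (\<tau> \<omega>', \<omega>) \<partial>M) \<partial>M)"
proof (rule nn_integral_independent[OF time_measurable history_measurable_id _ \<phi>])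
  fix E :: "real set" and H assume E: "E \<in> sets borel" and H: "H \<in> sets history_algebra"
  have "(\<lambda>\<omega>. \<omega>) -` H \<inter> space M = H"
    using sets.sets_into_space[OF H] by (auto simp: space_history_algebra)
  then show "prob (\<tau> -` E \<inter> space M \<inter> ((\<lambda>\<omega>. \<omega>) -` H \<inter> space M)) = prob (\<tau> -` E \<inter> space M) * prob ((\<lambda>\<omega>. \<omega>) -` H \<inter> space M)"
    using indep_time[OF E H] by simp
qed

lemma time_changed_integral:
  fixes f :: "real \<Rightarrow> ennreal"
  assumes A: "A \<in> sets (F 0)" and f [measurable]: "f \<in> borel_measurable borel"
  shows "(\<integral>\<^sup>+\<omega>\<in>A. f (lam (\<tau> \<omega>) \<omega>) \<partial>M) = (\<integral>\<^sup>+\<omega>'. (\<integral>\<^sup>+\<omega>\<in>A. f (lam (\<tau> \<omega>') \<omega>) \<partial>M) \<partial>M)"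
proof -
  have AH: "A \<in> sets history_algebra" by (rule F_in_history[OF order_refl A])
  have "(\<lambda>x. f (lam (max 0 (fst x)) (snd x)) * indicator A (snd x)) \<in> borel_measurable (borel \<Otimes>\<^sub>M history_algebra)"
    by (intro borel_measurable_times_ennreal measurable_compose[OF lam_history_measurable f]
        measurable_compose[OF measurable_snd] borel_measurable_indicator AH)
  from independent_time_integral[OF this] show ?thesis
    by (simp only: fst_conv snd_conv max_absorb2[OF time_nonneg])
qed

lemma time_changed_measurable: "(\<lambda>\<omega>. lam (\<tau> \<omega>) \<omega>) \<in> borel_measurable M"
proof -
  have "(\<lambda>\<omega>. (\<tau> \<omega>, \<omega>)) \<in> M \<rightarrow>\<^sub>M borel \<Otimes>\<^sub>M M" by measurable
  from measurable_compose[OF this lam_jointly_measurable] show ?thesis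
    by (simp only: fst_conv snd_conv max_absorb2[OF time_nonneg])
qed

lemma exp_time_integrable: "0 \<le> a \<Longrightarrow> integrable M (\<lambda>\<omega>. exp (- a * \<tau> \<omega>))"
proof (rule integrable_const_bound[where B=1])
  assume "0 \<le> a"
  then show "AE \<omega> in M. norm (exp (- a * \<tau> \<omega>)) \<le> 1"
    using mult_nonneg_nonneg[OF _ time_nonneg, of a] by (intro AE_I2) simp
qed measurable

context
  fixes \<gamma> c R :: real
  assumes \<gamma>: "\<gamma> = \<kappa> - \<eta> * \<mu>" "0 < \<gamma>" and c: "\<gamma> * c = \<kappa> * \<theta>" and R: "\<gamma> * R = \<eta>\<^sup>2 * (\<psi>\<^sup>2 + \<mu>\<^sup>2)"
begin

abbreviation decay1 :: real where "decay1 \<equiv> expectation (\<lambda>\<omega>. exp (- \<gamma> * \<tau> \<omega>))"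
abbreviation decay2 :: real where "decay2 \<equiv> expectation (\<lambda>\<omega>. exp (- (2 * \<gamma>) * \<tau> \<omega>))"

definition mean_map :: "real \<Rightarrow> real" where
  "mean_map l = (l - c) * decay1 + c"

definition square_map :: "real \<Rightarrow> real" where
  "square_map l = (l - c)\<^sup>2 * decay2 + 2 * c * (l - c) * decay1 + c\<^sup>2
     + R * ((l - c) * (decay1 - decay2) + c * (1 - decay2) / 2)"

text \<open>The moments of \<open>\<lambda>\<^sub>t\<close> are exponential polynomials in \<open>t\<close>; averaging them over the
  independent time replaces each exponential by its expectation.\<close>

lemma time_changed_expectation:
  fixes f :: "real \<Rightarrow> real" and a0 a1 a2 :: real
  assumes A: "A \<in> sets (F 0)" and K: "\<And>\<omega>. \<omega> \<in> A \<Longrightarrow> lam 0 \<omega> \<le> K"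
    and f: "f \<in> borel_measurable borel" "\<And>x. 0 \<le> x \<Longrightarrow> 0 \<le> f x"
    and int: "\<And>t. 0 \<le> t \<Longrightarrow> integrable M (\<lambda>\<omega>. indicator A \<omega> * f (lam t \<omega>))"
    and avg: "\<And>t. 0 \<le> t \<Longrightarrow> avg A (\<lambda>\<omega>. f (lam t \<omega>)) = a2 * exp (- (2 * \<gamma>) * t) + a1 * exp (- \<gamma> * t) + a0"
  shows "has_bochner_integral M (\<lambda>\<omega>. indicator A \<omega> * f (lam (\<tau> \<omega>) \<omega>)) (a2 * decay2 + a1 * decay1 + a0)"
proof (rule has_bochner_integral_nn_integral)
  have AM: "A \<in> sets M" by (rule sets_F_M[OF A])
  have f0: "0 \<le> f (lam t \<omega>)" if "0 \<le> t" "\<omega> \<in> space M" for t \<omega>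
    by (intro f(2) lam_nonneg that)
  show "(\<lambda>\<omega>. indicator A \<omega> * f (lam (\<tau> \<omega>) \<omega>)) \<in> borel_measurable M"
    by (intro borel_measurable_times borel_measurable_indicator AM measurable_compose[OF time_changed_measurable f(1)])
  show "AE \<omega> in M. 0 \<le> indicator A \<omega> * f (lam (\<tau> \<omega>) \<omega>)"
    by (intro AE_I2 mult_nonneg_nonneg f0[OF time_nonneg]) simp_all
  let ?g = "\<lambda>t. a2 * exp (- (2 * \<gamma>) * t) + a1 * exp (- \<gamma> * t) + a0"
  have nn: "0 \<le> ?g t" if "0 \<le> t" for t
    unfolding avg[OF that, symmetric] avg_def using f0[OF that] by (intro integral_nonneg_AE AE_I2) simp
  have i: "integrable M (\<lambda>\<omega>. a2 * exp (- (2 * \<gamma>) * \<tau> \<omega>))" "integrable M (\<lambda>\<omega>. a1 * exp (- \<gamma> * \<tau> \<omega>))" "integrable M (\<lambda>\<omega>. a0)"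
    using \<gamma>(2) by (intro integrable_mult_right exp_time_integrable, simp)+ simp
  have val: "(\<integral>\<omega>. ?g (\<tau> \<omega>) \<partial>M) = a2 * decay2 + a1 * decay1 + a0"
    by (subst Bochner_Integration.integral_add[OF Bochner_Integration.integrable_add[OF i(1,2)] i(3)],
        subst Bochner_Integration.integral_add[OF i(1,2)]) (simp add: prob_space)
  show "0 \<le> a2 * decay2 + a1 * decay1 + a0"
    unfolding val[symmetric] using nn[OF time_nonneg] by (intro integral_nonneg_AE AE_I2)
  have "(\<integral>\<^sup>+\<omega>. ennreal (indicator A \<omega> * f (lam (\<tau> \<omega>) \<omega>)) \<partial>M) = (\<integral>\<^sup>+\<omega>\<in>A. ennreal (f (lam (\<tau> \<omega>) \<omega>)) \<partial>M)"
    by (intro nn_integral_cong) (simp add: indicator_def)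
  also have "\<dots> = (\<integral>\<^sup>+\<omega>'. (\<integral>\<^sup>+\<omega>\<in>A. ennreal (f (lam (\<tau> \<omega>') \<omega>)) \<partial>M) \<partial>M)"
    by (rule time_changed_integral[OF A measurable_compose[OF f(1) measurable_ennreal]])
  also have "\<dots> = (\<integral>\<^sup>+\<omega>'. ennreal (?g (\<tau> \<omega>')) \<partial>M)"
  proof (rule nn_integral_cong)
    fix \<omega>'
    show "(\<integral>\<^sup>+\<omega>\<in>A. ennreal (f (lam (\<tau> \<omega>') \<omega>)) \<partial>M) = ennreal (?g (\<tau> \<omega>'))"
      unfolding avg[OF time_nonneg, symmetric]
      by (rule nn_integral_avg[OF A K int[OF time_nonneg] f0[OF time_nonneg]])
  qed
  also have "\<dots> = ennreal (a2 * decay2 + a1 * decay1 + a0)"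
    unfolding val[symmetric] using nn[OF time_nonneg]
    by (intro nn_integral_eq_integral AE_I2 Bochner_Integration.integrable_add[OF Bochner_Integration.integrable_add[OF i(1,2)] i(3)])
  finally show "(\<integral>\<^sup>+\<omega>. ennreal (indicator A \<omega> * f (lam (\<tau> \<omega>) \<omega>)) \<partial>M) = ennreal (a2 * decay2 + a1 * decay1 + a0)" .
qed

lemma avg_quadratic:
  assumes A: "A \<in> sets (F 0)" and K: "\<And>\<omega>. \<omega> \<in> A \<Longrightarrow> lam 0 \<omega> \<le> K"
  shows "(\<integral>\<omega>. indicator A \<omega> * (x * (lam 0 \<omega>)\<^sup>2 + y * lam 0 \<omega> + z) \<partial>M)
    = x * avg A (\<lambda>\<omega>. (lam 0 \<omega>)\<^sup>2) + y * avg A (lam 0) + z * prob A"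
proof -
  note ini = initial_integrable[OF A K]
  have "(\<integral>\<omega>. indicator A \<omega> * (x * (lam 0 \<omega>)\<^sup>2 + y * lam 0 \<omega> + z) \<partial>M)
    = (\<integral>\<omega>. (x * (indicator A \<omega> * (lam 0 \<omega>)\<^sup>2) + y * (indicator A \<omega> * lam 0 \<omega>)) + z * indicator A \<omega> \<partial>M)"
    by (intro Bochner_Integration.integral_cong) (auto simp: algebra_simps)
  also have "\<dots> = x * avg A (\<lambda>\<omega>. (lam 0 \<omega>)\<^sup>2) + y * avg A (lam 0) + z * prob A"
    using ini sets.sets_into_space[OF sets_F_M[OF A]] by (simp add: avg_def Int_absorb2)
  finally show ?thesis .
qed

lemma mean_map_quadratic: "mean_map l = 0 * l\<^sup>2 + decay1 * l + (c - c * decay1)"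
  by (simp add: mean_map_def algebra_simps)

lemma square_map_quadratic: "square_map l = decay2 * l\<^sup>2 + (2 * c * decay1 - 2 * c * decay2 + R * (decay1 - decay2)) * l
   + (c\<^sup>2 * decay2 - 2 * c\<^sup>2 * decay1 + c\<^sup>2 + R * (- c * (decay1 - decay2) + c * (1 - decay2) / 2))"
  by (simp add: square_map_def algebra_simps power2_eq_square)

lemma time_changed_first:
  assumes A: "A \<in> sets (F 0)" and K: "\<And>\<omega>. \<omega> \<in> A \<Longrightarrow> lam 0 \<omega> \<le> K"
  shows "has_bochner_integral M (\<lambda>\<omega>. indicator A \<omega> * lam (\<tau> \<omega>) \<omega>) (\<integral>\<omega>. indicator A \<omega> * mean_map (lam 0 \<omega>) \<partial>M)"
proof -
  let ?v = "avg A (lam 0) - c * prob A"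
  have "has_bochner_integral M (\<lambda>\<omega>. indicator A \<omega> * lam (\<tau> \<omega>) \<omega>) (0 * decay2 + ?v * decay1 + c * prob A)"
  proof (rule time_changed_expectation[OF A K, where f="\<lambda>x. x"])
    fix t :: real assume t: "0 \<le> t"
    show "integrable M (\<lambda>\<omega>. indicator A \<omega> * lam t \<omega>)" by (rule lam_integrable(1)[OF A K t])
    have "avg A (lam t) = ?v * exp (- \<gamma> * t) + c * prob A" by (rule intensity_moments(1)[OF A K \<gamma>(1) c R t])
    then show "avg A (\<lambda>\<omega>. lam t \<omega>) = 0 * exp (- (2 * \<gamma>) * t) + ?v * exp (- \<gamma> * t) + c * prob A" by simp
  qed simp_all
  also have "0 * decay2 + ?v * decay1 + c * prob A = (\<integral>\<omega>. indicator A \<omega> * mean_map (lam 0 \<omega>) \<partial>M)"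
  proof -
    have "(\<integral>\<omega>. indicator A \<omega> * mean_map (lam 0 \<omega>) \<partial>M)
      = 0 * avg A (\<lambda>\<omega>. (lam 0 \<omega>)\<^sup>2) + decay1 * avg A (lam 0) + (c - c * decay1) * prob A"
      unfolding mean_map_quadratic by (rule avg_quadratic[OF A K])
    then show ?thesis by (simp add: algebra_simps)
  qed
  finally show ?thesis .
qed

lemma time_changed_second:
  assumes A: "A \<in> sets (F 0)" and K: "\<And>\<omega>. \<omega> \<in> A \<Longrightarrow> lam 0 \<omega> \<le> K"
  shows "has_bochner_integral M (\<lambda>\<omega>. indicator A \<omega> * (lam (\<tau> \<omega>) \<omega>)\<^sup>2) (\<integral>\<omega>. indicator A \<omega> * square_map (lam 0 \<omega>) \<partial>M)"
proof -
  define p where "p = prob A"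
  define v where "v = avg A (lam 0) - c * p"
  define w where "w = avg A (\<lambda>\<omega>. (lam 0 \<omega>)\<^sup>2) - 2 * c * avg A (lam 0) + c\<^sup>2 * p"
  let ?a0 = "c\<^sup>2 * p + R * (c * p / 2)" and ?a1 = "2 * c * v + R * v" and ?a2 = "w - R * v - R * (c * p / 2)"
  have e2: "exp (- (2 * \<gamma>) * t) = (exp (- \<gamma> * t))\<^sup>2" for t
    by (simp add: power2_eq_square exp_add[symmetric])
  have avg: "avg A (\<lambda>\<omega>. (lam t \<omega>)\<^sup>2) = ?a2 * exp (- (2 * \<gamma>) * t) + ?a1 * exp (- \<gamma> * t) + ?a0" if "0 \<le> t" for t
  proof -
    have "avg A (\<lambda>\<omega>. (lam t \<omega>)\<^sup>2) = w * (exp (- \<gamma> * t))\<^sup>2 + 2 * c * v * exp (- \<gamma> * t) + c\<^sup>2 * p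
      + R * (v * (exp (- \<gamma> * t) - (exp (- \<gamma> * t))\<^sup>2) + c * p * (1 - (exp (- \<gamma> * t))\<^sup>2) / 2)"
      unfolding v_def w_def p_def by (rule intensity_moments(2)[OF A K \<gamma>(1) c R that])
    also have "\<dots> = ?a2 * exp (- (2 * \<gamma>) * t) + ?a1 * exp (- \<gamma> * t) + ?a0"
      unfolding e2 by (simp add: field_simps)
    finally show ?thesis .
  qed
  have "has_bochner_integral M (\<lambda>\<omega>. indicator A \<omega> * (lam (\<tau> \<omega>) \<omega>)\<^sup>2) (?a2 * decay2 + ?a1 * decay1 + ?a0)"
  proof (rule time_changed_expectation[where f="\<lambda>x. x\<^sup>2", OF A K _ _ _ avg])
    show "integrable M (\<lambda>\<omega>. indicator A \<omega> * (lam t \<omega>)\<^sup>2)" if "0 \<le> t" for t by (rule lam_integrable(2)[OF A K that])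
    show "(\<lambda>x::real. x\<^sup>2) \<in> borel_measurable borel" by simp
  qed simp_all
  also have "?a2 * decay2 + ?a1 * decay1 + ?a0 = (\<integral>\<omega>. indicator A \<omega> * square_map (lam 0 \<omega>) \<partial>M)"
  proof -
    define d1 where "d1 = decay1"
    define d2 where "d2 = decay2"
    have "(\<integral>\<omega>. indicator A \<omega> * square_map (lam 0 \<omega>) \<partial>M)
      = d2 * avg A (\<lambda>\<omega>. (lam 0 \<omega>)\<^sup>2) + (2 * c * d1 - 2 * c * d2 + R * (d1 - d2)) * avg A (lam 0)
        + (c\<^sup>2 * d2 - 2 * c\<^sup>2 * d1 + c\<^sup>2 + R * (- c * (d1 - d2) + c * (1 - d2) / 2)) * p"
      unfolding square_map_quadratic d1_def d2_def p_def by (rule avg_quadratic[OF A K])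
    then show ?thesis
      unfolding d1_def[symmetric] d2_def[symmetric] by (simp add: v_def w_def field_simps power2_eq_square[of c])
  qed
  finally show ?thesis .
qed

lemma mean_map_measurable [measurable]: "mean_map \<in> borel_measurable borel"
  unfolding mean_map_def by measurable

lemma square_map_measurable [measurable]: "square_map \<in> borel_measurable borel"
  unfolding square_map_def by measurable

lemma mean_below:
  "AE \<omega> in M. real_cond_exp M (F 0) (\<lambda>\<omega>. indicator (start_below K) \<omega> * lam (\<tau> \<omega>) \<omega>) \<omega> = indicator (start_below K) \<omega> * mean_map (lam 0 \<omega>)"
  using quadratic_below_integrable[of K 0] by (intro real_cond_exp_below time_changed_first mean_map_measurable) (simp_all add: mean_map_quadratic)

lemma square_below:
  "AE \<omega> in M. real_cond_exp M (F 0) (\<lambda>\<omega>. indicator (start_below K) \<omega> * (lam (\<tau> \<omega>) \<omega>)\<^sup>2) \<omega> = indicator (start_below K) \<omega> * square_map (lam 0 \<omega>)"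
  by (intro real_cond_exp_below time_changed_second square_map_measurable) (simp_all only: square_map_quadratic quadratic_below_integrable)

theorem time_changed_mean:
  "AE \<omega> in M. real_cond_exp M (F 0) (\<lambda>\<omega>. lam (\<tau> \<omega>) \<omega>) \<omega> = mean_map (lam 0 \<omega>)"
proof (rule AE_if_on_start_below)
  fix n :: nat
  interpret S: sigma_finite_subalgebra M "F 0" by (rule initial_subalgebra)
  have "AE \<omega> in M. \<omega> \<in> start_below (real n) \<longrightarrow> real_cond_exp M (F 0) (\<lambda>\<omega>. lam (\<tau> \<omega>) \<omega>) \<omega>
      = real_cond_exp M (F 0) (\<lambda>\<omega>. indicator (start_below (real n)) \<omega> * lam (\<tau> \<omega>) \<omega>) \<omega>"
    by (rule S.real_cond_exp_local[OF start_below_initial time_changed_measurable])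
  then show "AE \<omega> in M. \<omega> \<in> start_below (real n) \<longrightarrow> real_cond_exp M (F 0) (\<lambda>\<omega>. lam (\<tau> \<omega>) \<omega>) \<omega> = mean_map (lam 0 \<omega>)"
    using mean_below[of "real n"] by eventually_elim auto
qed

text \<open>On \<open>\<lambda>\<^sub>0 \<le> K\<close> the conditional mean is bounded and known at time \<open>0\<close>, so the square
  \<open>(X - E\<^sub>0 X)\<^sup>2\<close> may be expanded under the conditional expectation.\<close>

theorem time_changed_variance:
  "AE \<omega> in M. cond_var M (F 0) (\<lambda>\<omega>. lam (\<tau> \<omega>) \<omega>) \<omega> = square_map (lam 0 \<omega>) - (mean_map (lam 0 \<omega>))\<^sup>2"
proof -
  interpret S: sigma_finite_subalgebra M "F 0" by (rule initial_subalgebra)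
  let ?X = "\<lambda>\<omega>. lam (\<tau> \<omega>) \<omega>"
  have l0: "lam 0 \<in> borel_measurable (F 0)" by (rule lam_adapted) simp
  have l0M: "lam 0 \<in> borel_measurable M" by (rule lam_measurable) simp
  have Dm: "(\<lambda>\<omega>. (?X \<omega> - mean_map (lam 0 \<omega>))\<^sup>2) \<in> borel_measurable M"
    by (intro borel_measurable_power borel_measurable_diff time_changed_measurable measurable_compose[OF l0M mean_map_measurable])
  have cv: "AE \<omega> in M. cond_var M (F 0) ?X \<omega> = real_cond_exp M (F 0) (\<lambda>\<omega>. (?X \<omega> - mean_map (lam 0 \<omega>))\<^sup>2) \<omega>"
    unfolding cond_var_def
  proof (rule S.real_cond_exp_cong)
    show "AE \<omega> in M. (?X \<omega> - real_cond_exp M (F 0) ?X \<omega>)\<^sup>2 = (?X \<omega> - mean_map (lam 0 \<omega>))\<^sup>2"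
      using time_changed_mean by eventually_elim simp
    show "(\<lambda>\<omega>. (?X \<omega> - real_cond_exp M (F 0) ?X \<omega>)\<^sup>2) \<in> borel_measurable M"
      by (intro borel_measurable_power borel_measurable_diff time_changed_measurable borel_measurable_cond_exp2)
  qed (rule Dm)
  have "AE \<omega> in M. real_cond_exp M (F 0) (\<lambda>\<omega>. (?X \<omega> - mean_map (lam 0 \<omega>))\<^sup>2) \<omega> = square_map (lam 0 \<omega>) - (mean_map (lam 0 \<omega>))\<^sup>2"
  proof (rule AE_if_on_start_below)
    fix n :: nat
    let ?B = "start_below (real n)"
    have B: "?B \<in> sets (F 0)" by (rule start_below_initial)
    have BM: "?B \<in> sets M" by (rule sets_F_M[OF B])
    define G where "G = (\<lambda>\<omega>. indicator ?B \<omega> * mean_map (lam 0 \<omega>))"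
    define V where "V = (\<lambda>\<omega>. indicator ?B \<omega> * ?X \<omega>)"
    define U where "U = (\<lambda>\<omega>. indicator ?B \<omega> * (?X \<omega>)\<^sup>2)"
    have Gm: "G \<in> borel_measurable (F 0)"
      unfolding G_def by (intro borel_measurable_times borel_measurable_indicator B measurable_compose[OF l0 mean_map_measurable])
    have GM: "G \<in> borel_measurable M"
      by (rule measurable_from_subalg[OF subalgebra_F Gm])
    have VM: "V \<in> borel_measurable M"
      unfolding V_def by (intro borel_measurable_times borel_measurable_indicator time_changed_measurable BM)
    have Ui: "integrable M U"
      using time_changed_second[OF B below_bound] by (simp add: U_def has_bochner_integral_iff)
    have Gsq: "integrable M (\<lambda>\<omega>. (G \<omega>)\<^sup>2)"
    proof -
      have "(G \<omega>)\<^sup>2 = indicator ?B \<omega> * (decay1\<^sup>2 * (lam 0 \<omega>)\<^sup>2 + 2 * decay1 * (c - c * decay1) * lam 0 \<omega> + (c - c * decay1)\<^sup>2)" for \<omega>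
        by (simp add: G_def mean_map_def power_mult_distrib indicator_def power2_eq_square algebra_simps)
      then show ?thesis using quadratic_below_integrable by simp
    qed
    have GVi: "integrable M (\<lambda>\<omega>. G \<omega> * V \<omega>)"
    proof (rule Bochner_Integration.integrable_bound)
      show "integrable M (\<lambda>\<omega>. (G \<omega>)\<^sup>2 + U \<omega>)" by (intro Bochner_Integration.integrable_add Gsq Ui)
      show "AE \<omega> in M. norm (G \<omega> * V \<omega>) \<le> norm ((G \<omega>)\<^sup>2 + U \<omega>)"
      proof (rule AE_I2)
        fix \<omega>
        have "U \<omega> = (V \<omega>)\<^sup>2" by (simp add: U_def V_def power_mult_distrib indicator_def)
        moreover have "2 * \<bar>G \<omega> * V \<omega>\<bar> \<le> (G \<omega>)\<^sup>2 + (V \<omega>)\<^sup>2"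
          using sum_squares_bound[of "\<bar>G \<omega>\<bar>" "\<bar>V \<omega>\<bar>"] by (simp add: abs_mult)
        ultimately show "norm (G \<omega> * V \<omega>) \<le> norm ((G \<omega>)\<^sup>2 + U \<omega>)"
          unfolding real_norm_def by linarith
      qed
      show "(\<lambda>\<omega>. G \<omega> * V \<omega>) \<in> borel_measurable M" by (intro borel_measurable_times GM VM)
    qed
    have eq: "indicator ?B \<omega> * (?X \<omega> - mean_map (lam 0 \<omega>))\<^sup>2 = (U \<omega> - 2 * (G \<omega> * V \<omega>)) + (G \<omega>)\<^sup>2" for \<omega>
      by (simp add: U_def V_def G_def indicator_def power2_eq_square algebra_simps)
    have 1: "AE \<omega> in M. real_cond_exp M (F 0) (\<lambda>\<omega>. (U \<omega> - 2 * (G \<omega> * V \<omega>)) + (G \<omega>)\<^sup>2) \<omega>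
        = real_cond_exp M (F 0) (\<lambda>\<omega>. U \<omega> - 2 * (G \<omega> * V \<omega>)) \<omega> + real_cond_exp M (F 0) (\<lambda>\<omega>. (G \<omega>)\<^sup>2) \<omega>"
      by (intro S.real_cond_exp_add Bochner_Integration.integrable_diff integrable_mult_right Ui GVi Gsq)
    have 2: "AE \<omega> in M. real_cond_exp M (F 0) (\<lambda>\<omega>. U \<omega> - 2 * (G \<omega> * V \<omega>)) \<omega>
        = real_cond_exp M (F 0) U \<omega> - real_cond_exp M (F 0) (\<lambda>\<omega>. 2 * (G \<omega> * V \<omega>)) \<omega>"
      by (intro S.real_cond_exp_diff integrable_mult_right Ui GVi)
    have 3: "AE \<omega> in M. real_cond_exp M (F 0) (\<lambda>\<omega>. 2 * (G \<omega> * V \<omega>)) \<omega> = 2 * real_cond_exp M (F 0) (\<lambda>\<omega>. G \<omega> * V \<omega>) \<omega>"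
      by (intro S.real_cond_exp_cmult GVi)
    have 4: "AE \<omega> in M. real_cond_exp M (F 0) (\<lambda>\<omega>. G \<omega> * V \<omega>) \<omega> = G \<omega> * real_cond_exp M (F 0) V \<omega>"
      by (intro S.real_cond_exp_mult Gm VM GVi)
    have 5: "AE \<omega> in M. real_cond_exp M (F 0) (\<lambda>\<omega>. (G \<omega>)\<^sup>2) \<omega> = (G \<omega>)\<^sup>2"
      by (intro S.real_cond_exp_F_meas Gsq borel_measurable_power Gm)
    have 6: "AE \<omega> in M. real_cond_exp M (F 0) V \<omega> = G \<omega>"
      unfolding V_def G_def by (rule mean_below)
    have 7: "AE \<omega> in M. real_cond_exp M (F 0) U \<omega> = indicator ?B \<omega> * square_map (lam 0 \<omega>)"
      unfolding U_def by (rule square_below)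
    have 8: "AE \<omega> in M. \<omega> \<in> ?B \<longrightarrow> real_cond_exp M (F 0) (\<lambda>\<omega>. (?X \<omega> - mean_map (lam 0 \<omega>))\<^sup>2) \<omega>
        = real_cond_exp M (F 0) (\<lambda>\<omega>. (U \<omega> - 2 * (G \<omega> * V \<omega>)) + (G \<omega>)\<^sup>2) \<omega>"
      unfolding eq[symmetric] by (rule S.real_cond_exp_local[OF B Dm])
    show "AE \<omega> in M. \<omega> \<in> ?B \<longrightarrow> real_cond_exp M (F 0) (\<lambda>\<omega>. (?X \<omega> - mean_map (lam 0 \<omega>))\<^sup>2) \<omega> = square_map (lam 0 \<omega>) - (mean_map (lam 0 \<omega>))\<^sup>2"
      using 1 2 3 4 5 6 7 8
    proof eventually_elim
      case (elim \<omega>)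
      show ?case
      proof
        assume \<omega>: "\<omega> \<in> ?B"
        then have "G \<omega> = mean_map (lam 0 \<omega>)" by (simp add: G_def)
        then show "real_cond_exp M (F 0) (\<lambda>\<omega>. (?X \<omega> - mean_map (lam 0 \<omega>))\<^sup>2) \<omega> = square_map (lam 0 \<omega>) - (mean_map (lam 0 \<omega>))\<^sup>2"
          using elim \<omega> by (simp add: power2_eq_square)
      qed
    qed
  qed
  with cv show ?thesis by eventually_elim simp
qed

theorem conditional_mean:
  "AE \<omega> in M. real_cond_exp M (F 0) (\<lambda>\<omega>. lam (\<tau> \<omega>) \<omega>) \<omega> = (lam 0 \<omega> - c) * decay1 + c"
  using time_changed_mean unfolding mean_map_def .

theorem conditional_variance:
  "AE \<omega> in M. cond_var M (F 0) (\<lambda>\<omega>. lam (\<tau> \<omega>) \<omega>) \<omega> =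
     (lam 0 \<omega> - c)\<^sup>2 * (decay2 - decay1\<^sup>2) + R * ((lam 0 \<omega> - c) * (decay1 - decay2) + c * (1 - decay2) / 2)"
proof -
  have "square_map l - (mean_map l)\<^sup>2 =
      (l - c)\<^sup>2 * (decay2 - decay1\<^sup>2) + R * ((l - c) * (decay1 - decay2) + c * (1 - decay2) / 2)" for l
    unfolding square_map_def mean_map_def by (simp add: power2_eq_square algebra_simps)
  with time_changed_variance show ?thesis by simp
qed

lemma cond_exp_of_time:
  assumes \<phi> [measurable]: "\<phi> \<in> borel_measurable borel" and nn: "\<And>x. 0 \<le> \<phi> x" and i: "integrable M (\<lambda>\<omega>. \<phi> (\<tau> \<omega>))"
  shows "AE \<omega> in M. real_cond_exp M (F 0) (\<lambda>\<omega>. \<phi> (\<tau> \<omega>)) \<omega> = expectation (\<lambda>\<omega>. \<phi> (\<tau> \<omega>))"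
proof -
  interpret S: sigma_finite_subalgebra M "F 0" by (rule initial_subalgebra)
  show ?thesis
  proof (rule S.real_cond_exp_charact[OF _ i])
    fix A assume A: "A \<in> sets (F 0)"
    have AM: "A \<in> sets M" by (rule sets_F_M[OF A])
    have \<phi>\<tau>: "(\<lambda>\<omega>. \<phi> (\<tau> \<omega>)) \<in> borel_measurable M" by (rule measurable_compose[OF time_measurable \<phi>])
    have AH: "A \<in> sets history_algebra" by (rule F_in_history[OF order_refl A])
    have m: "(\<lambda>x. ennreal (\<phi> (fst x)) * indicator A (snd x)) \<in> borel_measurable (borel \<Otimes>\<^sub>M history_algebra)"
      by (intro borel_measurable_times_ennreal measurable_compose[OF measurable_snd] borel_measurable_indicator AH
          measurable_compose[OF measurable_fst] measurable_compose[OF \<phi> measurable_ennreal])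
    have "(\<integral>\<^sup>+\<omega>. ennreal (indicator A \<omega> * \<phi> (\<tau> \<omega>)) \<partial>M) = (\<integral>\<^sup>+\<omega>. ennreal (\<phi> (\<tau> \<omega>)) * indicator A \<omega> \<partial>M)"
      by (intro nn_integral_cong) (simp add: indicator_def)
    also have "\<dots> = (\<integral>\<^sup>+\<omega>'. (\<integral>\<^sup>+\<omega>. ennreal (\<phi> (\<tau> \<omega>')) * indicator A \<omega> \<partial>M) \<partial>M)"
      using independent_time_integral[OF m] by simp
    also have "\<dots> = (\<integral>\<^sup>+\<omega>'. ennreal (\<phi> (\<tau> \<omega>')) * ennreal (prob A) \<partial>M)"
      unfolding nn_integral_cmult_indicator[OF AM] emeasure_eq_measure ..
    also have "\<dots> = (\<integral>\<^sup>+\<omega>'. ennreal (\<phi> (\<tau> \<omega>')) \<partial>M) * ennreal (prob A)"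
      by (intro nn_integral_multc measurable_compose[OF \<phi>\<tau> measurable_ennreal])
    also have "\<dots> = ennreal (expectation (\<lambda>\<omega>. \<phi> (\<tau> \<omega>)) * prob A)"
      using nn i by (subst nn_integral_eq_integral) (auto simp: ennreal_mult)
    finally have "(\<integral>\<^sup>+\<omega>. ennreal (indicator A \<omega> * \<phi> (\<tau> \<omega>)) \<partial>M) = ennreal (expectation (\<lambda>\<omega>. \<phi> (\<tau> \<omega>)) * prob A)" .
    then have "has_bochner_integral M (\<lambda>\<omega>. indicator A \<omega> * \<phi> (\<tau> \<omega>)) (expectation (\<lambda>\<omega>. \<phi> (\<tau> \<omega>)) * prob A)"
      using nn
      by (intro has_bochner_integral_nn_integral borel_measurable_times borel_measurable_indicator AM \<phi>\<tau> AE_I2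
          mult_nonneg_nonneg integral_nonneg_AE) simp_all
    then show "(\<integral>\<omega>\<in>A. \<phi> (\<tau> \<omega>) \<partial>M) = (\<integral>\<omega>\<in>A. expectation (\<lambda>\<omega>. \<phi> (\<tau> \<omega>)) \<partial>M)"
      using sets.sets_into_space[OF AM] by (simp add: set_lebesgue_integral_def has_bochner_integral_iff Int_absorb2)
  qed simp_all
qed

text \<open>Independence of the initial information makes the conditional variance a constant.\<close>

theorem cond_var_exp_time:
  "AE \<omega> in M. cond_var M (F 0) (\<lambda>\<omega>. exp (- \<gamma> * \<tau> \<omega>)) \<omega> = decay2 - decay1\<^sup>2"
proof -
  interpret S: sigma_finite_subalgebra M "F 0" by (rule initial_subalgebra)
  let ?Y = "\<lambda>\<omega>. exp (- \<gamma> * \<tau> \<omega>)"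
  have i1: "integrable M ?Y" using \<gamma>(2) by (intro exp_time_integrable) simp
  have i2: "integrable M (\<lambda>\<omega>. exp (- (2 * \<gamma>) * \<tau> \<omega>))" using \<gamma>(2) by (intro exp_time_integrable) simp
  have e: "AE \<omega> in M. real_cond_exp M (F 0) ?Y \<omega> = decay1"
    by (rule cond_exp_of_time[OF _ _ i1]) simp_all
  have eq: "(?Y \<omega> - decay1)\<^sup>2 = (exp (- (2 * \<gamma>) * \<tau> \<omega>) - 2 * decay1 * ?Y \<omega>) + decay1\<^sup>2" for \<omega>
    by (simp add: power2_eq_square algebra_simps exp_add[symmetric])
  have i3: "integrable M (\<lambda>\<omega>. exp (- (2 * \<gamma>) * \<tau> \<omega>) - 2 * decay1 * ?Y \<omega>)"
    by (intro Bochner_Integration.integrable_diff integrable_mult_right i1 i2)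
  have i4: "integrable M (\<lambda>\<omega>. (?Y \<omega> - decay1)\<^sup>2)"
    unfolding eq by (intro Bochner_Integration.integrable_add i3) simp
  have v: "expectation (\<lambda>\<omega>. (?Y \<omega> - decay1)\<^sup>2) = decay2 - decay1\<^sup>2"
    unfolding eq using i1 i2 by (subst Bochner_Integration.integral_add[OF i3]) (simp_all add: prob_space power2_eq_square)
  have "AE \<omega> in M. cond_var M (F 0) ?Y \<omega> = real_cond_exp M (F 0) (\<lambda>\<omega>. (?Y \<omega> - decay1)\<^sup>2) \<omega>"
    unfolding cond_var_def
  proof (rule S.real_cond_exp_cong)
    show "AE \<omega> in M. (?Y \<omega> - real_cond_exp M (F 0) ?Y \<omega>)\<^sup>2 = (?Y \<omega> - decay1)\<^sup>2"
      using e by eventually_elim simp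
  qed simp_all
  moreover have "AE \<omega> in M. real_cond_exp M (F 0) (\<lambda>\<omega>. (?Y \<omega> - decay1)\<^sup>2) \<omega> = expectation (\<lambda>\<omega>. (?Y \<omega> - decay1)\<^sup>2)"
    by (rule cond_exp_of_time[of "\<lambda>x. (exp (- \<gamma> * x) - decay1)\<^sup>2", OF _ _ i4]) simp_all
  ultimately show ?thesis unfolding v by eventually_elim simp
qed

end

end

end

section \<open>The time-changed intensity\<close>

theorem theorem3:
  fixes M :: "'a measure" and F :: "real \<Rightarrow> 'a measure"
    and N :: "real \<Rightarrow> 'a \<Rightarrow> nat" and lam :: "real \<Rightarrow> 'a \<Rightarrow> real"
    and \<xi> :: "nat \<Rightarrow> 'a \<Rightarrow> real" and D E :: "real \<Rightarrow> 'a \<Rightarrow> real"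
    and \<theta> \<eta> \<kappa> \<mu> \<psi> \<beta> \<nu> \<gamma> \<rho>1 \<rho>2 t :: real
  assumes beta: "0 < \<beta>" "\<beta> < 1" and nu: "0 < \<nu>"
    and hawkes: "hawkes_process M F N lam \<xi> \<theta> \<eta> \<kappa> \<mu> \<psi>"
    and subordinator: "tempered_stable_subordinator M D \<beta> \<nu>"
    and E: "E = first_passage D"
    and indep: "prob_space.indep_set M (history M F) (process_algebra M E)"
    and gamma: "\<gamma> = \<kappa> - \<eta> * \<mu>" "\<gamma> > 0"
    and rho1: "\<rho>1 = \<eta>\<^sup>2 * (\<psi>\<^sup>2 + \<mu>\<^sup>2)"
    and rho2: "\<rho>2 = \<eta>\<^sup>2 * \<kappa> * \<theta> * (\<psi>\<^sup>2 + \<mu>\<^sup>2) / (\<eta> * \<mu> - \<kappa>)"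
    and t: "0 \<le> t"
  shows "(AE \<omega> in M. real_cond_exp M (F 0) (\<lambda>\<omega>. lam (E t \<omega>) \<omega>) \<omega> =
      (lam 0 \<omega> - \<kappa> * \<theta> / \<gamma>) *
        (1 - \<gamma> * exp (- \<nu> * t) *
          (\<Sum>m. \<nu> ^ m * t powr (\<beta> + real m) *
            mittag_leffler \<beta> (\<beta> + real m + 1) ((\<nu> powr \<beta> - \<gamma>) * t powr \<beta>)))
      + \<kappa> * \<theta> / \<gamma>) \<and>
    (AE \<omega> in M. cond_var M (F 0) (\<lambda>\<omega>. lam (E t \<omega>) \<omega>) \<omega> =
      exp (- \<nu> * t) * (\<rho>1 * lam 0 \<omega> + \<rho>2) *
        ((\<Sum>m. 2 * \<nu> ^ m * t powr (\<beta> + real m) *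
            mittag_leffler \<beta> (\<beta> + real m + 1) ((\<nu> powr \<beta> - 2 * \<gamma>) * t powr \<beta>))
         - (\<Sum>m. \<nu> ^ m * t powr (\<beta> + real m) *
            mittag_leffler \<beta> (\<beta> + real m + 1) ((\<nu> powr \<beta> - \<gamma>) * t powr \<beta>)))
      - \<rho>2 * exp (- \<nu> * t) *
        (\<Sum>m. \<nu> ^ m * t powr (\<beta> + real m) *
            mittag_leffler \<beta> (\<beta> + real m + 1) ((\<nu> powr \<beta> - 2 * \<gamma>) * t powr \<beta>))
      + (lam 0 \<omega> - \<kappa> * \<theta> / \<gamma>)\<^sup>2 *
        cond_var M (F 0) (\<lambda>\<omega>. exp (- \<gamma> * E t \<omega>)) \<omega>)"
proof -
  interpret H: hawkes_process M F N lam \<xi> \<theta> \<eta> \<kappa> \<mu> \<psi> by (rule hawkes)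
  interpret D: tempered_stable_subordinator M D \<beta> \<nu> by (rule subordinator)
  have Em: "E t \<in> borel_measurable M" unfolding E by (rule D.first_passage_measurable)
  have E0: "0 \<le> E t \<omega>" for \<omega> unfolding E by (rule D.first_passage_nonneg)
  have Ei: "H.prob ((E t -` B \<inter> space M) \<inter> C) = H.prob (E t -` B \<inter> space M) * H.prob C"
    if B: "B \<in> sets borel" and C: "C \<in> sets H.history_algebra" for B C
  proof -
    have "E t -` B \<inter> space M \<in> process_algebra M E"
      unfolding process_algebra_def using t B by (intro sigma_sets.Basic UN_I[of t] in_vimage_algebra) auto
    moreover have "C \<in> history M F" using C by (simp add: H.sets_history_algebra)
    ultimately have "H.prob (C \<inter> (E t -` B \<inter> space M)) = H.prob C * H.prob (E t -` B \<inter> space M)"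
      by (intro H.indep_setD[OF indep])
    then show ?thesis by (simp only: Int_commute mult.commute)
  qed
  \<comment> \<open>The stationary mean of the intensity and the scale of its variance.\<close>
  define c where "c = \<kappa> * \<theta> / \<gamma>"
  define R where "R = \<rho>1 / \<gamma>"
  have c: "\<gamma> * c = \<kappa> * \<theta>" and R: "\<gamma> * R = \<eta>\<^sup>2 * (\<psi>\<^sup>2 + \<mu>\<^sup>2)"
    using gamma(2) by (simp_all add: c_def R_def rho1)
  have \<rho>2: "\<rho>2 = - \<rho>1 * c"
    using gamma(2) unfolding rho2 rho1 c_def gamma(1) by (simp add: field_simps)
  define S1 where "S1 = (\<Sum>m. \<nu> ^ m * t powr (\<beta> + real m) *
    mittag_leffler \<beta> (\<beta> + real m + 1) ((\<nu> powr \<beta> - \<gamma>) * t powr \<beta>))"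
  define S2 where "S2 = (\<Sum>m. \<nu> ^ m * t powr (\<beta> + real m) *
    mittag_leffler \<beta> (\<beta> + real m + 1) ((\<nu> powr \<beta> - 2 * \<gamma>) * t powr \<beta>))"
  let ?e1 = "H.expectation (\<lambda>\<omega>. exp (- \<gamma> * E t \<omega>))" and ?e2 = "H.expectation (\<lambda>\<omega>. exp (- (2 * \<gamma>) * E t \<omega>))"
  have law1: "AE \<omega> in M. real_cond_exp M (F 0) (\<lambda>\<omega>. lam (E t \<omega>) \<omega>) \<omega> = (lam 0 \<omega> - c) * ?e1 + c"
    by (rule H.conditional_mean[OF Em E0 _ gamma c R]; rule Ei; assumption)
  have law2: "AE \<omega> in M. cond_var M (F 0) (\<lambda>\<omega>. lam (E t \<omega>) \<omega>) \<omega> =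
      (lam 0 \<omega> - c)\<^sup>2 * (?e2 - ?e1\<^sup>2) + R * ((lam 0 \<omega> - c) * (?e1 - ?e2) + c * (1 - ?e2) / 2)"
    by (rule H.conditional_variance[OF Em E0 _ gamma c R]; rule Ei; assumption)
  have law3: "AE \<omega> in M. cond_var M (F 0) (\<lambda>\<omega>. exp (- \<gamma> * E t \<omega>)) \<omega> = ?e2 - ?e1\<^sup>2"
    by (rule H.cond_var_exp_time[OF Em E0 _ gamma c R]; rule Ei; assumption)
  have d1: "?e1 = 1 - \<gamma> * (exp (- \<nu> * t) * S1)"
    using D.first_passage_laplace[OF beta(1) nu gamma(2) t] by (simp add: E tempered_series_def S1_def)
  have d2: "?e2 = 1 - 2 * \<gamma> * (exp (- \<nu> * t) * S2)"
    using D.first_passage_laplace[OF beta(1) nu _ t, of "2 * \<gamma>"] gamma(2)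
    by (simp add: E tempered_series_def S2_def)
  have S22: "(\<Sum>m. 2 * \<nu> ^ m * t powr (\<beta> + real m) *
      mittag_leffler \<beta> (\<beta> + real m + 1) ((\<nu> powr \<beta> - 2 * \<gamma>) * t powr \<beta>)) = 2 * S2"
    using suminf_mult[OF tempered_series_summable[OF beta(1) nu t], of 2 "\<nu> powr \<beta> - 2 * \<gamma>"]
    by (simp add: S2_def mult.assoc)
  have mean: "AE \<omega> in M. real_cond_exp M (F 0) (\<lambda>\<omega>. lam (E t \<omega>) \<omega>) \<omega> =
      (lam 0 \<omega> - c) * (1 - \<gamma> * exp (- \<nu> * t) * S1) + c"
    using law1 unfolding d1 by (simp only: mult.assoc)
  have "AE \<omega> in M. cond_var M (F 0) (\<lambda>\<omega>. lam (E t \<omega>) \<omega>) \<omega> =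
      exp (- \<nu> * t) * (\<rho>1 * lam 0 \<omega> + \<rho>2) * (2 * S2 - S1) - \<rho>2 * exp (- \<nu> * t) * S2
      + (lam 0 \<omega> - c)\<^sup>2 * cond_var M (F 0) (\<lambda>\<omega>. exp (- \<gamma> * E t \<omega>)) \<omega>"
    using law2 law3
  proof eventually_elim
    case (elim \<omega>)
    have "R * ((lam 0 \<omega> - c) * (1 - \<gamma> * (exp (- \<nu> * t) * S1) - (1 - 2 * \<gamma> * (exp (- \<nu> * t) * S2)))
        + c * (1 - (1 - 2 * \<gamma> * (exp (- \<nu> * t) * S2))) / 2)
      = \<gamma> * R * exp (- \<nu> * t) * ((lam 0 \<omega> - c) * (2 * S2 - S1) + c * S2)"
      by (simp add: field_simps)
    also have "\<gamma> * R = \<rho>1" using R by (simp add: rho1)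
    also have "\<rho>1 * exp (- \<nu> * t) * ((lam 0 \<omega> - c) * (2 * S2 - S1) + c * S2)
      = exp (- \<nu> * t) * (\<rho>1 * lam 0 \<omega> + \<rho>2) * (2 * S2 - S1) - \<rho>2 * exp (- \<nu> * t) * S2"
      unfolding \<rho>2 by (simp add: algebra_simps)
    finally show ?case
      unfolding elim d1 d2 by simp
  qed
  with mean show ?thesis
    unfolding S22 S1_def[symmetric] S2_def[symmetric] c_def[symmetric] by (intro conjI)
qed

end
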